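(* Let $n\ge 1$, let $F\colon M\to N$ be a smooth map of manifolds, and let $\varpi=(\omega,\eta)\in\Omega^{n+1}(F)=\Omega^{n+1}(N)\oplus\Omega^{n}(M)$ be $d_F$-closed, i.e. $d\omega=0$ and $d\eta=F^*\omega$. Put $K:=\ker\bigl(F_*\colon H_n(M;\mathbb Z)\to H_n(N;\mathbb Z)\bigr)$ and $P_\omega:=\{\int_S\omega : S\in Z_{n+1}(N;\mathbb Z)\}\subseteq\mathbb R$. Then the assignment $$\Theta_\varpi\colon K\to\mathbb R/P_\omega,\qquad \Theta_\varpi[T]:=\Bigl(\int_S\omega-\int_T\eta\Bigr)\bmod P_\omega ,$$ where $T\in Z_n(M;\mathbb Z)$ is a cycle representing the class and $S\in C_{n+1}(N;\mathbb Z)$ is any chain with $\partial S=F_*T$, is a well-defined group homomorphism. Moreover: (i) $P_\omega\subseteq P_\varpi$, and $P_\varpi$ is the full preimage of $\operatorname{im}\Theta_\varpi$ under the projection $\mathbb R\to\mathbb R/P_\omega$; (ii) $\varpi$ is relatively integral if and only if $P_\omega\subseteq\mathbb Z$ and $\operatorname{im}\Theta_\varpi\subseteq\mathbb Z/P_\omega$; (iii) if $F_*\colon H_n(M;\mathbb Z)\to H_n(N;\mathbb Z)$ is injective, then $P_\varpi=P_\omega$, and relative integrality of $\varpi$ is equivalent to $P_\omega\subseteq\mathbb Z$; (iv) if $H_{n+1}(N;\mathbb Z)=0$, then $P_\omega=0$, $\Theta_\varpi$ takes values in $\mathbb R$, and $\varpi$ is relatively integral if and only if $\Theta_\varpi(K)\subseteq\mathbb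 Z$.
   Context: For a smooth map $F\colon M\to N$, the relative de Rham complex is $\Omega^k(F)=\Omega^k(N)\oplus\Omega^{k-1}(M)$ with $d_F(\alpha,\beta)=(d\alpha,\,F^*\alpha-d\beta)$. $C_k(P)$ denotes smooth singular $k$-chains on a manifold $P$ with $\mathbb Z$ coefficients and $Z_k(P;\mathbb Z)$ the cycles. The relative chain complex is $C_k(F)=C_k(N)\oplus C_{k-1}(M)$ with $\partial_F(S,T)=(\partial S-F_*T,\,-\partial T)$; a relative $k$-cycle is a pair $(S,T)$ with $\partial S=F_*T$, $\partial T=0$, and $Z_k(F)$ is the group of these. The pairing is $\langle(\alpha,\beta),(S,T)\rangle=\int_S\alpha-\int_T\beta$. The group of relative periods of a $d_F$-closed $\varpi\in\Omega^{n+1}(F)$ is $P_\varpi=\{\langle\varpi,c\rangle : c\in Z_{n+1}(F)\}\subseteq\mathbb R$, and $\varpi$ is relatively integral if $P_\varpi\subseteq\mathbb Z$. *)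

theory Defs
  imports "HOL-Analysis.Analysis" "HOL-Homology.Homology"
begin

section \<open>Smooth maps between vector spaces\<close>

primrec Ck_on :: "nat \<Rightarrow> 'e::real_normed_vector set \<Rightarrow> ('e \<Rightarrow> 'f::real_normed_vector) \<Rightarrow> bool" where
  "Ck_on 0 S f \<longleftrightarrow> continuous_on S f"
| "Ck_on (Suc k) S f \<longleftrightarrow>
     (\<forall>x\<in>S. f differentiable (at x)) \<and>
     (\<forall>v. Ck_on k S (\<lambda>x. frechet_derivative f (at x) v))"

text \<open>Only used for open sets and finite-dimensional domains, where this is the usual notion.\<close>

definition smooth_on :: "'e::real_normed_vector set \<Rightarrow> ('e \<Rightarrow> 'f::real_normed_vector) \<Rightarrow> bool" where
  "smooth_on S f \<longleftrightarrow> (\<forall>k. Ck_on k S f)"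

text \<open>
  The library's simplices live in the type \<open>nat \<Rightarrow> real\<close> (with the product topology), which
  plays the role of all coordinate spaces at once. There, smoothness on an open set means
  that all iterated partial derivatives exist and are continuous. A smooth function of the
  coordinates \<open>0, \<dots>, p\<close> extends to such a function constantly in the other coordinates, and
  conversely restricting such a function to the first coordinates gives a smooth function, so that
  locally extendable functions on \<open>standard_simplex p\<close> are the same for both notions.
\<close>

definition coord_deriv ::
    "nat \<Rightarrow> ((nat \<Rightarrow> real) \<Rightarrow> 'e::real_normed_vector) \<Rightarrow> (nat \<Rightarrow> real) \<Rightarrow> 'e" where
  "coord_deriv i f x = vector_derivative (\<lambda>s. f (x(i := s))) (at (x i))"

primrec coord_Ck_on ::
    "nat \<Rightarrow> (nat \<Rightarrow> real) set \<Rightarrow> ((nat \<Rightarrow> real) \<Rightarrow> 'e::real_normed_vector) \<Rightarrow> bool" where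
  "coord_Ck_on 0 V f \<longleftrightarrow> continuous_on V f"
| "coord_Ck_on (Suc k) V f \<longleftrightarrow>
     continuous_on V f \<and>
     (\<forall>i. (\<forall>x\<in>V. (\<lambda>s. f (x(i := s))) differentiable (at (x i))) \<and>
          coord_Ck_on k V (coord_deriv i f))"

definition coord_smooth_on ::
    "(nat \<Rightarrow> real) set \<Rightarrow> ((nat \<Rightarrow> real) \<Rightarrow> 'e::real_normed_vector) \<Rightarrow> bool" where
  "coord_smooth_on V f \<longleftrightarrow> (\<forall>k. coord_Ck_on k V f)"


section \<open>Smooth manifolds\<close>

text \<open>A chart is a pair of its domain and its coordinate map.\<close>

type_synonym ('a, 'e) chart = "'a set \<times> ('a \<Rightarrow> 'e)"

record ('a, 'e) manifold =
  mtop :: "'a topology"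
  atlas :: "('a, 'e) chart set"

definition chart_image :: "('a, 'e) chart \<Rightarrow> 'e set" where
  "chart_image c = snd c ` fst c"

definition chart_inv :: "('a, 'e) chart \<Rightarrow> 'e \<Rightarrow> 'a" where
  "chart_inv c = inv_into (fst c) (snd c)"

definition chart_trans :: "('a, 'e) chart \<Rightarrow> ('a, 'e) chart \<Rightarrow> 'e \<Rightarrow> 'e" where
  "chart_trans c c' = snd c' \<circ> chart_inv c"

text \<open>
  The model space is an arbitrary finite-dimensional inner product space. The class
  \<open>euclidean_space\<close> would exclude dimension zero.
\<close>

definition smooth_manifold :: "('a, 'e::real_inner) manifold \<Rightarrow> bool" where
  "smooth_manifold M \<longleftrightarrow>
     (\<exists>B. finite B \<and> span B = (UNIV :: 'e set)) \<and>
     Hausdorff_space (mtop M) \<and> second_countable (mtop M) \<and>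
     \<Union>(fst ` atlas M) = topspace (mtop M) \<and>
     (\<forall>c\<in>atlas M.
        openin (mtop M) (fst c) \<and> open (chart_image c) \<and>
        homeomorphic_map (subtopology (mtop M) (fst c)) (top_of_set (chart_image c)) (snd c)) \<and>
     (\<forall>c\<in>atlas M. \<forall>c'\<in>atlas M. smooth_on (snd c ` (fst c \<inter> fst c')) (chart_trans c c'))"

definition smooth_map ::
    "('a, 'e::real_inner) manifold \<Rightarrow> ('b, 'f::real_inner) manifold \<Rightarrow> ('a \<Rightarrow> 'b) \<Rightarrow> bool" where
  "smooth_map M N F \<longleftrightarrow>
     continuous_map (mtop M) (mtop N) F \<and>
     (\<forall>c\<in>atlas M. \<forall>d\<in>atlas N.
        smooth_on {x \<in> chart_image c. F (chart_inv c x) \<in> fst d} (snd d \<circ> F \<circ> chart_inv c))"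

definition chart_at :: "('a, 'e) manifold \<Rightarrow> 'a \<Rightarrow> ('a, 'e) chart" where
  "chart_at M p = (SOME c. c \<in> atlas M \<and> p \<in> fst c)"


section \<open>Differential forms\<close>

text \<open>
  A \<open>k\<close>-form on \<open>M\<close> is given by its local representatives: for each chart, a smooth
  family of alternating \<open>k\<close>-linear maps on the model space, indexed by the chart image, such that
  the representatives are related by pullback along the chart transitions. The \<open>k\<close> arguments
  are passed as a list; outside the chart images, and on lists of another length, the value is
  fixed to \<open>0\<close>, so that equality of forms is equality of functions.
\<close>

type_synonym ('a, 'e) form = "('a, 'e) chart \<Rightarrow> 'e \<Rightarrow> 'e list \<Rightarrow> real"

abbreviation zero_form :: "('a, 'e) form" where
  "zero_form \<equiv> (\<lambda>c x v. 0)"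

definition form_arg :: "('a, 'e) manifold \<Rightarrow> nat \<Rightarrow> ('a, 'e) chart \<Rightarrow> 'e \<Rightarrow> 'e list \<Rightarrow> bool" where
  "form_arg M k c x v \<longleftrightarrow> c \<in> atlas M \<and> x \<in> chart_image c \<and> length v = k"

definition alternating_multilinear :: "nat \<Rightarrow> ('e::real_vector list \<Rightarrow> real) \<Rightarrow> bool" where
  "alternating_multilinear k f \<longleftrightarrow>
     (\<forall>v. length v = k \<longrightarrow>
        (\<forall>i<k. linear (\<lambda>u. f (v[i := u]))) \<and>
        (\<forall>i j. i < j \<and> j < k \<and> v ! i = v ! j \<longrightarrow> f v = 0))"

definition forms :: "nat \<Rightarrow> ('a, 'e::real_inner) manifold \<Rightarrow> ('a, 'e) form set" where
  "forms k M = {\<omega>.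
     (\<forall>c x v. \<not> form_arg M k c x v \<longrightarrow> \<omega> c x v = 0) \<and>
     (\<forall>c\<in>atlas M. \<forall>x\<in>chart_image c. alternating_multilinear k (\<omega> c x)) \<and>
     (\<forall>c\<in>atlas M. \<forall>v. length v = k \<longrightarrow> smooth_on (chart_image c) (\<lambda>x. \<omega> c x v)) \<and>
     (\<forall>c\<in>atlas M. \<forall>c'\<in>atlas M. \<forall>x \<in> snd c ` (fst c \<inter> fst c'). \<forall>v. length v = k \<longrightarrow>
        \<omega> c x v = \<omega> c' (chart_trans c c' x) (map (frechet_derivative (chart_trans c c') (at x)) v))}"

definition ext_deriv ::
    "nat \<Rightarrow> ('a, 'e::real_inner) manifold \<Rightarrow> ('a, 'e) form \<Rightarrow> ('a, 'e) form" where
  "ext_deriv k M \<omega> = (\<lambda>c x v.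
     if form_arg M (Suc k) c x v
     then \<Sum>i\<le>k. (- 1) ^ i *
            frechet_derivative (\<lambda>y. \<omega> c y (take i v @ drop (Suc i) v)) (at x) (v ! i)
     else 0)"

definition pullback ::
    "nat \<Rightarrow> ('a, 'e::real_inner) manifold \<Rightarrow> ('b, 'f::real_inner) manifold \<Rightarrow> ('a \<Rightarrow> 'b)
      \<Rightarrow> ('b, 'f) form \<Rightarrow> ('a, 'e) form" where
  "pullback k M N F \<omega> = (\<lambda>c x v.
     if form_arg M k c x v
     then let q = F (chart_inv c x); d = chart_at N q
          in \<omega> d (snd d q) (map (frechet_derivative (snd d \<circ> F \<circ> chart_inv c) (at x)) v)
     else 0)"


section \<open>Smooth singular chains and homology\<close>

text \<open>
  Smoothness at a point of the closed simplex means, as usual, that the map extends smoothly to a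
  neighbourhood of that point.
\<close>

definition smooth_simplex ::
    "nat \<Rightarrow> ('a, 'e::real_inner) manifold \<Rightarrow> ((nat \<Rightarrow> real) \<Rightarrow> 'a) \<Rightarrow> bool" where
  "smooth_simplex p M \<sigma> \<longleftrightarrow>
     singular_simplex p (mtop M) \<sigma> \<and>
     (\<forall>t\<in>standard_simplex p. \<forall>c\<in>atlas M. \<sigma> t \<in> fst c \<longrightarrow>
        (\<exists>V f. open V \<and> t \<in> V \<and> coord_smooth_on V f \<and>
           (\<forall>s \<in> V \<inter> standard_simplex p. \<sigma> s \<in> fst c \<and> snd c (\<sigma> s) = f s)))"

definition smooth_chain_group :: "nat \<Rightarrow> ('a, 'e::real_inner) manifold \<Rightarrow> 'a chain monoid" where
  "smooth_chain_group k M = free_Abelian_group (Collect (smooth_simplex k M))"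

abbreviation smooth_chains :: "nat \<Rightarrow> ('a, 'e::real_inner) manifold \<Rightarrow> 'a chain set" where
  "smooth_chains k M \<equiv> carrier (smooth_chain_group k M)"

definition smooth_cycles :: "nat \<Rightarrow> ('a, 'e::real_inner) manifold \<Rightarrow> 'a chain set" where
  "smooth_cycles k M = {c \<in> smooth_chains k M. chain_boundary k c = 0}"

definition smooth_boundaries :: "nat \<Rightarrow> ('a, 'e::real_inner) manifold \<Rightarrow> 'a chain set" where
  "smooth_boundaries k M = chain_boundary (Suc k) ` smooth_chains (Suc k) M"

definition smooth_homology :: "nat \<Rightarrow> ('a, 'e::real_inner) manifold \<Rightarrow> 'a chain set monoid" where
  "smooth_homology k M =
     subgroup_generated (smooth_chain_group k M) (smooth_cycles k M) Mod smooth_boundaries k M"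

definition homology_class :: "nat \<Rightarrow> ('a, 'e::real_inner) manifold \<Rightarrow> 'a chain \<Rightarrow> 'a chain set" where
  "homology_class k M T = smooth_boundaries k M #>\<^bsub>smooth_chain_group k M\<^esub> T"

text \<open>The class of \<open>T\<close> is sent to the class of \<open>F\<^sub>* T\<close>.\<close>

definition homology_map ::
    "nat \<Rightarrow> ('b, 'f::real_inner) manifold \<Rightarrow> ('a \<Rightarrow> 'b) \<Rightarrow> 'a chain set \<Rightarrow> 'b chain set" where
  "homology_map k N F \<kappa> =
     smooth_boundaries k N <#>\<^bsub>smooth_chain_group k N\<^esub> (chain_map k F ` \<kappa>)"

definition homology_kernel ::
    "nat \<Rightarrow> ('a, 'e::real_inner) manifold \<Rightarrow> ('b, 'f::real_inner) manifold \<Rightarrow> ('a \<Rightarrow> 'b)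
      \<Rightarrow> 'a chain set set" where
  "homology_kernel k M N F = kernel (smooth_homology k M) (smooth_homology k N) (homology_map k N F)"


section \<open>Integration\<close>

text \<open>
  The simplex is parametrised by its barycentric coordinates \<open>1, \<dots>, p\<close>, which fixes its
  orientation. The integral is over the open simplex, where partial derivatives are unambiguous.
\<close>

definition open_simplex_coords :: "nat \<Rightarrow> (nat \<Rightarrow> real) set" where
  "open_simplex_coords p = {t \<in> extensional {1..p}. (\<forall>i\<in>{1..p}. 0 < t i) \<and> (\<Sum>i=1..p. t i) < 1}"

definition bary :: "nat \<Rightarrow> (nat \<Rightarrow> real) \<Rightarrow> nat \<Rightarrow> real" where
  "bary p t = (\<lambda>i. if i = 0 then 1 - (\<Sum>j=1..p. t j) else if i \<le> p then t i else 0)"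

definition simplex_integral ::
    "nat \<Rightarrow> ('a, 'e::real_inner) manifold \<Rightarrow> ('a, 'e) form \<Rightarrow> ((nat \<Rightarrow> real) \<Rightarrow> 'a) \<Rightarrow> real" where
  "simplex_integral p M \<omega> \<sigma> =
     set_lebesgue_integral (PiM {1..p} (\<lambda>_. lborel)) (open_simplex_coords p)
       (\<lambda>t. let q = \<sigma> (bary p t); c = chart_at M q
            in \<omega> c (snd c q) (map (\<lambda>i. coord_deriv i (snd c \<circ> \<sigma> \<circ> bary p) t) [1..<Suc p]))"

definition chain_integral ::
    "nat \<Rightarrow> ('a, 'e::real_inner) manifold \<Rightarrow> ('a, 'e) form \<Rightarrow> 'a chain \<Rightarrow> real" where
  "chain_integral p M \<omega> S =
     (\<Sum>\<sigma>\<in>Poly_Mapping.keys S. of_int (Poly_Mapping.lookup S \<sigma>) * simplex_integral p M \<omega> \<sigma>)"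

definition periods :: "nat \<Rightarrow> ('a, 'e::real_inner) manifold \<Rightarrow> ('a, 'e) form \<Rightarrow> real set" where
  "periods k M \<omega> = {chain_integral k M \<omega> S | S. S \<in> smooth_cycles k M}"


section \<open>The relative complexes of a smooth map\<close>

text \<open>In degree \<open>0\<close> the second components are the degree \<open>-1\<close> parts, hence zero.\<close>

definition rel_forms ::
    "nat \<Rightarrow> ('a, 'e::real_inner) manifold \<Rightarrow> ('b, 'f::real_inner) manifold
      \<Rightarrow> (('b, 'f) form \<times> ('a, 'e) form) set" where
  "rel_forms k M N = forms k N \<times> (if k = 0 then {zero_form} else forms (k - 1) M)"

definition rel_deriv ::
    "nat \<Rightarrow> ('a, 'e::real_inner) manifold \<Rightarrow> ('b, 'f::real_inner) manifold \<Rightarrow> ('a \<Rightarrow> 'b)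
      \<Rightarrow> ('b, 'f) form \<times> ('a, 'e) form \<Rightarrow> ('b, 'f) form \<times> ('a, 'e) form" where
  "rel_deriv k M N F = (\<lambda>(\<alpha>, \<beta>).
     (ext_deriv k N \<alpha>,
      \<lambda>c x v. pullback k M N F \<alpha> c x v - ext_deriv (k - 1) M \<beta> c x v))"

definition rel_closed ::
    "nat \<Rightarrow> ('a, 'e::real_inner) manifold \<Rightarrow> ('b, 'f::real_inner) manifold \<Rightarrow> ('a \<Rightarrow> 'b)
      \<Rightarrow> ('b, 'f) form \<times> ('a, 'e) form \<Rightarrow> bool" where
  "rel_closed k M N F w \<longleftrightarrow>
     w \<in> rel_forms k M N \<and> rel_deriv k M N F w = (zero_form, zero_form)"

definition rel_chains ::
    "nat \<Rightarrow> ('a, 'e::real_inner) manifold \<Rightarrow> ('b, 'f::real_inner) manifold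
      \<Rightarrow> ('b chain \<times> 'a chain) set" where
  "rel_chains k M N = smooth_chains k N \<times> (if k = 0 then {0} else smooth_chains (k - 1) M)"

definition rel_boundary ::
    "nat \<Rightarrow> ('a \<Rightarrow> 'b) \<Rightarrow> 'b chain \<times> 'a chain \<Rightarrow> 'b chain \<times> 'a chain" where
  "rel_boundary k F = (\<lambda>(S, T).
     (chain_boundary k S - chain_map (k - 1) F T, - chain_boundary (k - 1) T))"

definition rel_cycles ::
    "nat \<Rightarrow> ('a, 'e::real_inner) manifold \<Rightarrow> ('b, 'f::real_inner) manifold \<Rightarrow> ('a \<Rightarrow> 'b)
      \<Rightarrow> ('b chain \<times> 'a chain) set" where
  "rel_cycles k M N F = {c \<in> rel_chains k M N. rel_boundary k F c = (0, 0)}"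

definition rel_pairing ::
    "nat \<Rightarrow> ('a, 'e::real_inner) manifold \<Rightarrow> ('b, 'f::real_inner) manifold
      \<Rightarrow> ('b, 'f) form \<times> ('a, 'e) form \<Rightarrow> 'b chain \<times> 'a chain \<Rightarrow> real" where
  "rel_pairing k M N = (\<lambda>(\<alpha>, \<beta>) (S, T). chain_integral k N \<alpha> S - chain_integral (k - 1) M \<beta> T)"

definition rel_periods ::
    "nat \<Rightarrow> ('a, 'e::real_inner) manifold \<Rightarrow> ('b, 'f::real_inner) manifold \<Rightarrow> ('a \<Rightarrow> 'b)
      \<Rightarrow> ('b, 'f) form \<times> ('a, 'e) form \<Rightarrow> real set" where
  "rel_periods k M N F w = {rel_pairing k M N w c | c. c \<in> rel_cycles k M N F}"

definition rel_integral ::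
    "nat \<Rightarrow> ('a, 'e::real_inner) manifold \<Rightarrow> ('b, 'f::real_inner) manifold \<Rightarrow> ('a \<Rightarrow> 'b)
      \<Rightarrow> ('b, 'f) form \<times> ('a, 'e) form \<Rightarrow> bool" where
  "rel_integral k M N F w \<longleftrightarrow> rel_periods k M N F w \<subseteq> \<int>"


section \<open>The homomorphism \<open>\<Theta>\<close>\<close>

definition real_group :: "real monoid" where
  "real_group = \<lparr>carrier = UNIV, monoid.mult = (+), one = 0\<rparr>"

text \<open>
  The value on a class is computed from an arbitrary choice of \<open>T\<close> and \<open>S\<close>; that the choice
  does not matter is part of what has to be proved about it.
\<close>

definition Theta ::
    "nat \<Rightarrow> ('a, 'e::real_inner) manifold \<Rightarrow> ('b, 'f::real_inner) manifold \<Rightarrow> ('a \<Rightarrow> 'b)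
      \<Rightarrow> ('b, 'f) form \<Rightarrow> ('a, 'e) form \<Rightarrow> 'a chain set \<Rightarrow> real set" where
  "Theta n M N F \<omega> \<eta> \<kappa> =
     (let (S, T) = SOME (S, T).
            T \<in> smooth_cycles n M \<and> homology_class n M T = \<kappa> \<and>
            S \<in> smooth_chains (Suc n) N \<and> chain_boundary (Suc n) S = chain_map n F T
      in periods (Suc n) N \<omega> #>\<^bsub>real_group\<^esub>
           (chain_integral (Suc n) N \<omega> S - chain_integral n M \<eta> T))"

end

theory Submission
  imports Defs
begin

text \<open>
Everything rests on one computation. If \<open>T - T' = \<partial>R\<close> in \<open>M\<close>, \<open>\<partial>S = F\<^sub>* T\<close> and
\<open>\<partial>S' = F\<^sub>* T'\<close>, then \<open>S - S' - F\<^sub>* R\<close> is a cycle of \<open>N\<close>, and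
\<open>\<integral>\<^bsub>F\<^sub>* R\<^esub> \<omega> = \<integral>\<^bsub>R\<^esub> F\<^sup>* \<omega> = \<integral>\<^bsub>R\<^esub> d\<eta> = \<integral>\<^bsub>T - T'\<^esub> \<eta>\<close>. Hence the numbers
\<open>\<integral>\<^bsub>S\<^esub> \<omega> - \<integral>\<^bsub>T\<^esub> \<eta>\<close> belonging to one homology class differ by periods of \<open>\<omega>\<close>
(\<open>relative_period_indep\<close>), which makes \<open>\<Theta>\<close> well defined. It is additive because integration of
chains is. A relative cycle is exactly a pair \<open>(S, T)\<close> of the kind used to compute \<open>\<Theta>\<close>, so that the
relative periods are the reals whose coset is a value of \<open>\<Theta>\<close>; statements (i) to (iii) are formal
consequences. In (iv) every \<open>(n + 1)\<close>-cycle of \<open>N\<close> is a boundary \<open>\<partial>R\<close>, and \<open>\<integral>\<^bsub>\<partial>R\<^esub> \<omega> = \<integral>\<^bsub>R\<^esub> d\<omega> = 0\<close>.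

The analytic input is thus Stokes' theorem for smooth singular simplices (\<open>Stokes_simplex\<close>) and
naturality of the integral under \<open>F\<close> (\<open>simplex_integral_pullback\<close>).
A smooth simplex is given near each point of the closed standard simplex, in a chart, by a smooth function
\<open>f\<close> of the barycentric coordinates. The differences \<open>\<partial>\<^sub>i f - \<partial>\<^sub>j f\<close> of partial derivatives,
taken in directions tangent to the simplex, do not depend on the extension \<open>f\<close>, even at boundary points
(\<open>tangent_unique\<close>), and transform by the chart transitions. Therefore a form on the manifold has
well-defined coefficient functions along the whole closed simplex (\<open>simplex_form\<close>). For these, the
exterior derivative becomes an alternating sum of derivatives in the directions \<open>e\<^sub>k - e\<^sub>0\<close>
(\<open>ext_deriv_along_simplex\<close>: the second derivatives of \<open>f\<close> cancel by symmetry), and each summand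
integrates, by Fubini and the fundamental theorem of calculus, to a difference of two integrals over
codimension-one faces (\<open>face_integral_boundary_difference\<close>).
\<close>

section \<open>Calculus with iterated partial derivatives\<close>

lemma coord_Ck_on_subset: "coord_Ck_on k V f \<Longrightarrow> W \<subseteq> V \<Longrightarrow> coord_Ck_on k W f"
proof (induction k arbitrary: f)
  case (Suc k)
  then show ?case by (auto intro: continuous_on_subset)
qed (auto intro: continuous_on_subset)

lemma coord_Ck_on_continuous: "coord_Ck_on k V f \<Longrightarrow> continuous_on V f"
  by (cases k) auto

lemma coord_Ck_on_pred: "coord_Ck_on (Suc k) V f \<Longrightarrow> coord_Ck_on k V f"
proof (induction k arbitrary: f)
  case (Suc k)
  show ?case
    unfolding coord_Ck_on.simps(2)[of k]
    using Suc.IH Suc.prems unfolding coord_Ck_on.simps(2)[of "Suc k"] by blast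
qed simp

lemma eventually_curve_in_open:
  fixes \<gamma> :: "real \<Rightarrow> 'x::topological_space"
  assumes "open V" "isCont \<gamma> a" "\<gamma> a \<in> V"
  shows "\<forall>\<^sub>F s in nhds a. \<gamma> s \<in> V"
proof -
  have "\<forall>\<^sub>F s in at a. \<gamma> s \<in> V"
    using assms topological_tendstoD unfolding isCont_def by blast
  with assms(3) show ?thesis
    by (simp add: eventually_nhds_conv_at)
qed

lemma continuous_on_fun_upd: "continuous_on UNIV (\<lambda>s::real. x(i := s))" for x :: "nat \<Rightarrow> real"
proof (rule continuous_on_coordinatewise_then_product)
  fix j
  show "continuous_on UNIV (\<lambda>s. (x(i := s)) j)"
    by (cases "j = i") auto
qed

lemma isCont_fun_upd: "isCont (\<lambda>s::real. x(i := s)) a" for x :: "nat \<Rightarrow> real"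
  using continuous_on_fun_upd continuous_on_eq_continuous_at open_UNIV by blast

lemma eventually_fun_upd_in_open:
  fixes x :: "nat \<Rightarrow> real"
  assumes "open V" "x \<in> V"
  shows "\<forall>\<^sub>F s in nhds (x i). x(i := s) \<in> V"
  by (rule eventually_curve_in_open[OF assms(1) isCont_fun_upd]) (simp add: assms(2))

lemma has_vector_derivative_cong_nhds:
  assumes "(f has_vector_derivative D) (at a)" "\<forall>\<^sub>F s in nhds a. f s = g s"
  shows "(g has_vector_derivative D) (at a)"
proof -
  obtain S where "open S" "a \<in> S" "\<forall>s\<in>S. f s = g s"
    using assms(2) unfolding eventually_nhds by blast
  then show ?thesis
    using has_vector_derivative_transform_within_open[OF assms(1)] by blast
qed

lemma has_partial_cong:
  fixes f g :: "(nat \<Rightarrow> real) \<Rightarrow> 'e::real_normed_vector"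
  assumes "open V" "x \<in> V" "\<And>y. y \<in> V \<Longrightarrow> f y = g y"
    and "((\<lambda>s. f (x(i := s))) has_vector_derivative D) (at (x i))"
  shows "((\<lambda>s. g (x(i := s))) has_vector_derivative D) (at (x i))"
  by (rule has_vector_derivative_cong_nhds[OF assms(4)
        eventually_mono[OF eventually_fun_upd_in_open[OF assms(1,2)]]]) (simp add: assms(3))

lemma has_coord_deriv:
  assumes "coord_Ck_on (Suc k) V f" "x \<in> V"
  shows "((\<lambda>s. f (x(i := s))) has_vector_derivative coord_deriv i f x) (at (x i))"
  using assms by (auto simp: coord_deriv_def vector_derivative_works)

lemma coord_derivI:
  "((\<lambda>s. f (x(i := s))) has_vector_derivative D) (at (x i)) \<Longrightarrow> coord_deriv i f x = D"
  unfolding coord_deriv_def by (rule vector_derivative_at)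

lemma coord_Ck_on_cong:
  assumes "open V" "\<And>x. x \<in> V \<Longrightarrow> f x = g x" "coord_Ck_on k V f"
  shows "coord_Ck_on k V g"
  using assms(2,3)
proof (induction k arbitrary: f g)
  case 0
  then show ?case using continuous_on_cong by force
next
  case (Suc k)
  have D: "((\<lambda>s. g (x(i := s))) has_vector_derivative coord_deriv i f x) (at (x i))" if "x \<in> V" for x i
    by (rule has_partial_cong[OF assms(1) that Suc.prems(1) has_coord_deriv[OF Suc.prems(2) that]])
  have "coord_Ck_on k V (coord_deriv i g)" for i
  proof (rule Suc.IH[of "coord_deriv i f"])
    show "coord_deriv i f x = coord_deriv i g x" if "x \<in> V" for x
      using coord_derivI[OF D[OF that]] by simp
    show "coord_Ck_on k V (coord_deriv i f)"
      using Suc.prems(2) by simp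
  qed
  moreover have "continuous_on V g"
    using Suc.prems continuous_on_cong by force
  ultimately show ?case
    using D by (auto intro: differentiableI_vector)
qed

text \<open>
Partial derivatives enter only through their values on the open set, so they may be supplied as any
functions that satisfy the derivative condition there; the closure properties below are proved in this way.
\<close>

lemma coord_Ck_on_SucI:
  assumes "open V" "continuous_on V f"
    and "\<And>x i. x \<in> V \<Longrightarrow> ((\<lambda>s. f (x(i := s))) has_vector_derivative D i x) (at (x i))"
    and "\<And>i. coord_Ck_on k V (D i)"
  shows "coord_Ck_on (Suc k) V f"
proof -
  have "coord_Ck_on k V (coord_deriv i f)" for i
    by (rule coord_Ck_on_cong[OF assms(1) _ assms(4)]) (simp add: coord_derivI[OF assms(3)])
  then show ?thesis
    using assms(2,3) by (auto intro: differentiableI_vector)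
qed

lemma coord_Ck_on_const: "open V \<Longrightarrow> coord_Ck_on k V (\<lambda>x. c)"
proof (induction k arbitrary: c)
  case (Suc k)
  show ?case
    by (rule coord_Ck_on_SucI[where D = "\<lambda>i x. 0"]) (use Suc in \<open>auto intro: derivative_eq_intros\<close>)
qed simp

lemma coord_Ck_on_add:
  assumes "open V" "coord_Ck_on k V f" "coord_Ck_on k V g"
  shows "coord_Ck_on k V (\<lambda>x. f x + g x)"
  using assms(2,3)
proof (induction k arbitrary: f g)
  case (Suc k)
  show ?case
  proof (rule coord_Ck_on_SucI[where D = "\<lambda>i x. coord_deriv i f x + coord_deriv i g x", OF assms(1)])
    show "continuous_on V (\<lambda>x. f x + g x)"
      by (intro continuous_on_add coord_Ck_on_continuous[OF Suc.prems(1)] coord_Ck_on_continuous[OF Suc.prems(2)])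
    show "((\<lambda>s. f (x(i := s)) + g (x(i := s))) has_vector_derivative
          coord_deriv i f x + coord_deriv i g x) (at (x i))" if "x \<in> V" for x i
      by (intro has_vector_derivative_add has_coord_deriv[OF Suc.prems(1) that] has_coord_deriv[OF Suc.prems(2) that])
    show "coord_Ck_on k V (\<lambda>x. coord_deriv i f x + coord_deriv i g x)" for i
      using Suc.prems by (intro Suc.IH) auto
  qed
qed (auto intro: continuous_on_add)

lemma coord_Ck_on_bilinear:
  assumes "bounded_bilinear pr" "open V" "coord_Ck_on k V f" "coord_Ck_on k V g"
  shows "coord_Ck_on k V (\<lambda>x. pr (f x) (g x))"
  using assms(3,4)
proof (induction k arbitrary: f g)
  case 0
  then show ?case using bounded_bilinear.continuous_on[OF assms(1)] by auto
next
  case (Suc k)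
  show ?case
  proof (rule coord_Ck_on_SucI[where D = "\<lambda>i x. pr (f x) (coord_deriv i g x) + pr (coord_deriv i f x) (g x)", OF assms(2)])
    show "continuous_on V (\<lambda>x. pr (f x) (g x))"
      by (intro bounded_bilinear.continuous_on[OF assms(1)] coord_Ck_on_continuous[OF Suc.prems(1)]
          coord_Ck_on_continuous[OF Suc.prems(2)])
    show "((\<lambda>s. pr (f (x(i := s))) (g (x(i := s)))) has_vector_derivative
          pr (f x) (coord_deriv i g x) + pr (coord_deriv i f x) (g x)) (at (x i))" if "x \<in> V" for x i
      using bounded_bilinear.has_vector_derivative[OF assms(1) has_coord_deriv[OF Suc.prems(1) that, of i]
          has_coord_deriv[OF Suc.prems(2) that, of i]]
      unfolding fun_upd_triv .
    show "coord_Ck_on k V (\<lambda>x. pr (f x) (coord_deriv i g x) + pr (coord_deriv i f x) (g x))" for i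
      using Suc.prems Suc.IH[OF coord_Ck_on_pred[OF Suc.prems(1)], of "coord_deriv i g"]
        Suc.IH[OF _ coord_Ck_on_pred[OF Suc.prems(2)], of "coord_deriv i f"]
      by (intro coord_Ck_on_add assms(2)) auto
  qed
qed

lemma coord_Ck_on_sum:
  assumes "open V" "\<And>i. i \<in> I \<Longrightarrow> coord_Ck_on k V (f i)"
  shows "coord_Ck_on k V (\<lambda>x. \<Sum>i\<in>I. f i x)"
  using assms(2)
  by (induction I rule: infinite_finite_induct) (auto intro: coord_Ck_on_const coord_Ck_on_add assms(1))

lemma coord_Ck_on_prod:
  fixes f :: "'i \<Rightarrow> (nat \<Rightarrow> real) \<Rightarrow> real"
  assumes "open V" "\<And>i. i \<in> I \<Longrightarrow> coord_Ck_on k V (f i)"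
  shows "coord_Ck_on k V (\<lambda>x. \<Prod>i\<in>I. f i x)"
  using assms(2)
  by (induction I rule: infinite_finite_induct)
     (auto intro: coord_Ck_on_const coord_Ck_on_bilinear[OF bounded_bilinear_mult] assms(1))

lemma coord_Ck_on_minus:
  assumes "open V" "coord_Ck_on k V f" "coord_Ck_on k V g"
  shows "coord_Ck_on k V (\<lambda>x. f x - g x)"
  using coord_Ck_on_add[OF assms(1,2) coord_Ck_on_bilinear[OF bounded_bilinear_scaleR assms(1)
      coord_Ck_on_const[OF assms(1), of _ "-1"] assms(3)]]
  by simp

lemma coord_Ck_on_inner:
  fixes f :: "(nat \<Rightarrow> real) \<Rightarrow> 'e::real_inner"
  assumes "open V" "coord_Ck_on k V f"
  shows "coord_Ck_on k V (\<lambda>x. f x \<bullet> u)"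
  by (rule coord_Ck_on_bilinear[OF bounded_bilinear_inner assms coord_Ck_on_const[OF assms(1)]])

lemma coord_deriv_inner:
  fixes f :: "(nat \<Rightarrow> real) \<Rightarrow> 'e::real_inner"
  assumes "coord_Ck_on (Suc k) V f" "x \<in> V"
  shows "coord_deriv i (\<lambda>x. f x \<bullet> u) x = coord_deriv i f x \<bullet> u"
  by (rule coord_derivI)
    (rule bounded_linear.has_vector_derivative[OF bounded_linear_inner_left has_coord_deriv[OF assms]])

text \<open>
The model spaces of manifolds are only assumed to be spanned by a finite set. An orthonormal spanning set
makes coordinates available there, and with them the reduction of multivariate statements to finite sums
of real-valued ones.
\<close>

lemma orthonormal_expansion:
  assumes "\<exists>B. finite B \<and> span B = (UNIV :: 'e::real_inner set)"
  obtains E :: "'e::real_inner set" where "finite E" "\<And>x. x = (\<Sum>b\<in>E. (x \<bullet> b) *\<^sub>R b)"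
proof -
  obtain B where "finite B" "span B = (UNIV :: 'e set)" using assms by blast
  then obtain C where C: "finite C" "span C = (UNIV :: 'e set)" "pairwise orthogonal C"
    using basis_orthogonal by metis
  define E where "E = (\<lambda>b. b /\<^sub>R norm b) ` (C - {0})"
  have E: "finite E" using C(1) by (simp add: E_def)
  have span: "span E = UNIV"
  proof -
    have "c \<in> span E" if "c \<in> C" for c
    proof (cases "c = 0")
      case False
      then have "c = norm c *\<^sub>R (c /\<^sub>R norm c)" "c /\<^sub>R norm c \<in> E"
        using that by (auto simp: E_def)
      then show ?thesis by (metis span_scale span_base)
    qed (simp add: span_zero)
    then have "span C \<subseteq> span E" by (simp add: span_minimal subsetI)
    then show ?thesis using C(2) by auto
  qed
  have one: "b \<bullet> b = 1" if "b \<in> E" for b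
  proof -
    from that[unfolded E_def] obtain c where c: "b = c /\<^sub>R norm c" "c \<in> C - {0}"
      by (rule imageE)
    then have "norm b = 1" by simp
    then show ?thesis by (simp add: norm_eq_1)
  qed
  have orth: "b \<bullet> b' = 0" if "b \<in> E" "b' \<in> E" "b \<noteq> b'" for b b'
  proof -
    from that(1)[unfolded E_def] obtain c where c: "b = c /\<^sub>R norm c" "c \<in> C - {0}" by (rule imageE)
    from that(2)[unfolded E_def] obtain c' where c': "b' = c' /\<^sub>R norm c'" "c' \<in> C - {0}" by (rule imageE)
    have "c \<noteq> c'" using that(3) c c' by auto
    then have "c \<bullet> c' = 0" using C(3) c c' unfolding pairwise_def orthogonal_def by blast
    then show ?thesis by (simp add: c c')
  qed
  have "x = (\<Sum>b\<in>E. (x \<bullet> b) *\<^sub>R b)" for x :: 'e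
  proof -
    have "x \<in> span E" using span by simp
    then show ?thesis
    proof (induction rule: span_induct_alt)
      case (step c b y)
      have "(\<Sum>b'\<in>E. ((c *\<^sub>R b + y) \<bullet> b') *\<^sub>R b') = c *\<^sub>R (\<Sum>b'\<in>E. (b \<bullet> b') *\<^sub>R b') + (\<Sum>b'\<in>E. (y \<bullet> b') *\<^sub>R b')"
        by (simp add: inner_add_left scaleR_add_left sum.distrib scaleR_sum_right)
      also have "(\<Sum>b'\<in>E. (b \<bullet> b') *\<^sub>R b') = (\<Sum>b'\<in>E. if b' = b then b else 0)"
        by (rule sum.cong) (use one orth step in auto)
      also have "\<dots> = b" using step E by simp
      finally show ?case using step by simp
    qed simp
  qed
  with E that show ?thesis by blast
qed

lemma has_coord_deriv_compose:
  fixes g :: "'e::real_normed_vector \<Rightarrow> 'f::real_normed_vector"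
  assumes "((\<lambda>s. f (x(i := s))) has_vector_derivative D) (at (x i))" "g differentiable (at (f x))"
  shows "((\<lambda>s. g (f (x(i := s)))) has_vector_derivative frechet_derivative g (at (f x)) D) (at (x i))"
proof -
  have "(g has_derivative frechet_derivative g (at (f x))) (at (f (x(i := x i))))"
    using assms(2) by (simp add: frechet_derivative_works)
  from vector_derivative_diff_chain_within[OF assms(1) has_derivative_at_withinI[OF this]]
  show ?thesis unfolding o_def fun_upd_triv .
qed

text \<open>
By the chain rule, a partial derivative of \<open>g \<circ> f\<close> is the sum of the terms
\<open>(\<partial>\<^sub>i f \<bullet> b) D\<^sub>b g(f)\<close> over an orthonormal basis, to which the induction hypothesis applies
once \<open>f\<close> is regarded as one degree less smooth.
\<close>

lemma coord_Ck_on_compose: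
  fixes g :: "'e::real_inner \<Rightarrow> 'f::real_normed_vector"
  assumes "\<exists>B. finite B \<and> span B = (UNIV :: 'e set)"
    and "open V" "coord_Ck_on k V f" "Ck_on k S g" "f ` V \<subseteq> S"
  shows "coord_Ck_on k V (\<lambda>x. g (f x))"
proof -
  obtain E :: "'e set" where E: "finite E" "\<And>x::'e. x = (\<Sum>b\<in>E. (x \<bullet> b) *\<^sub>R b)"
    using orthonormal_expansion[OF assms(1)] by blast
  show ?thesis
    using assms(3,4)
  proof (induction k arbitrary: g)
    case 0
    then show ?case using assms(5) by (auto intro: continuous_on_compose2)
  next
    case (Suc k)
    have gd: "g differentiable (at (f x))" if "x \<in> V" for x
      using Suc.prems(2) that assms(5) by auto
    have lin: "linear (frechet_derivative g (at (f x)))" if "x \<in> V" for x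
      by (rule linear_frechet_derivative[OF gd[OF that]])
    show ?case
    proof (rule coord_Ck_on_SucI[where D = "\<lambda>i x. \<Sum>b\<in>E. (coord_deriv i f x \<bullet> b) *\<^sub>R frechet_derivative g (at (f x)) b", OF assms(2)])
      have "continuous_on S g"
        using Suc.prems(2) differentiable_imp_continuous_within
        by (metis Ck_on.simps(2) continuous_at_imp_continuous_on)
      with assms(5) show "continuous_on V (\<lambda>x. g (f x))"
        using coord_Ck_on_continuous[OF Suc.prems(1)] by (auto intro: continuous_on_compose2)
      show "((\<lambda>s. g (f (x(i := s)))) has_vector_derivative
            (\<Sum>b\<in>E. (coord_deriv i f x \<bullet> b) *\<^sub>R frechet_derivative g (at (f x)) b)) (at (x i))"
        if "x \<in> V" for x i
      proof -
        have "frechet_derivative g (at (f x)) (coord_deriv i f x)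
          = frechet_derivative g (at (f x)) (\<Sum>b\<in>E. (coord_deriv i f x \<bullet> b) *\<^sub>R b)"
          using E(2) by metis
        also have "\<dots> = (\<Sum>b\<in>E. (coord_deriv i f x \<bullet> b) *\<^sub>R frechet_derivative g (at (f x)) b)"
          using lin[OF that] by (simp add: linear_sum linear_scale)
        finally show ?thesis
          using has_coord_deriv_compose[OF has_coord_deriv[OF Suc.prems(1) that] gd[OF that], of i] by (simp only:)
      qed
      show "coord_Ck_on k V (\<lambda>x. \<Sum>b\<in>E. (coord_deriv i f x \<bullet> b) *\<^sub>R frechet_derivative g (at (f x)) b)" for i
      proof (intro coord_Ck_on_sum coord_Ck_on_bilinear[OF bounded_bilinear_scaleR] coord_Ck_on_inner assms(2))
        fix b
        show "coord_Ck_on k V (coord_deriv i f)" using Suc.prems(1) by simp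
        show "coord_Ck_on k V (\<lambda>x. frechet_derivative g (at (f x)) b)"
          by (rule Suc.IH[OF coord_Ck_on_pred[OF Suc.prems(1)], of "\<lambda>y. frechet_derivative g (at y) b"])
            (use Suc.prems(2) in simp)
      qed
    qed
  qed
qed

lemma continuous_on_fun_upd2: "continuous_on S (\<lambda>p. x(i := fst p, j := snd p))" for x :: "nat \<Rightarrow> real"
proof (rule continuous_on_coordinatewise_then_product)
  fix k
  show "continuous_on S (\<lambda>p. (x(i := fst p, j := snd p)) k)"
    by (cases "k = i"; cases "k = j") (simp_all add: continuous_on_fst continuous_on_snd continuous_on_id)
qed

text \<open>
A motion inside the plane of the standard simplex changes two coordinates at once. Its derivative is the
expected one since continuous partial derivatives give total differentiability in two variables.
\<close>

lemma has_vector_derivative_two_coords: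
  fixes f :: "(nat \<Rightarrow> real) \<Rightarrow> 'e::real_normed_vector"
  assumes V: "open V" "x \<in> V" and C1: "coord_Ck_on (Suc 0) V f" and ij: "i \<noteq> j"
  shows "((\<lambda>s. f (x(i := x i + s, j := x j - s))) has_vector_derivative coord_deriv i f x - coord_deriv j f x) (at 0)"
proof -
  define \<phi> where "\<phi> = (\<lambda>p::real\<times>real. x(i := fst p, j := snd p))"
  have cphi: "continuous_on UNIV \<phi>"
    unfolding \<phi>_def by (rule continuous_on_fun_upd2)
  have "open (\<phi> -` V)" using cphi V(1) open_vimage by blast
  moreover have "(x i, x j) \<in> \<phi> -` V" using V ij by (simp add: \<phi>_def)
  ultimately obtain A B where AB: "open A" "open B" "(x i, x j) \<in> A \<times> B" "A \<times> B \<subseteq> \<phi> -` V"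
    using open_prod_elim by metis
  obtain e where e: "e > 0" "ball (x j) e \<subseteq> B" using AB(2,3) openE by blast
  define Y where "Y = ball (x j) e"
  have Y: "open Y" "convex Y" "x j \<in> Y" "\<And>a b. a \<in> A \<Longrightarrow> b \<in> Y \<Longrightarrow> x(i := a, j := b) \<in> V"
  proof -
    show "x(i := a, j := b) \<in> V" if "a \<in> A" "b \<in> Y" for a b
    proof -
      have "(a, b) \<in> \<phi> -` V" using that e(2) AB(4) unfolding Y_def by blast
      then show ?thesis by (simp add: \<phi>_def)
    qed
  qed (use e in \<open>simp_all add: Y_def\<close>)
  let ?fy = "\<lambda>a b. blinfun_scaleR_left (coord_deriv j f (x(i := a, j := b)))"
  have "((\<lambda>(a, b). f (x(i := a, j := b))) has_derivative
     (\<lambda>(ta, tb). ta *\<^sub>R coord_deriv i f x + blinfun_apply (?fy (x i) (x j)) tb)) (at (x i, x j) within A \<times> Y)"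
  proof (rule has_derivative_partialsI)
    show "((\<lambda>a. f (x(i := a, j := x j))) has_derivative (\<lambda>ta. ta *\<^sub>R coord_deriv i f x)) (at (x i) within A)"
      using has_coord_deriv[OF C1 V(2), of i] ij
      by (auto simp: has_vector_derivative_def fun_upd_twist[OF ij] intro: has_derivative_at_withinI)
    show "((\<lambda>b. f (x(i := a, j := b))) has_derivative blinfun_apply (?fy a b)) (at b within Y)"
      if "a \<in> A" "b \<in> Y" for a b
      using has_coord_deriv[OF C1 Y(4)[OF that], of j]
      by (auto simp: has_vector_derivative_def intro: has_derivative_at_withinI)
    have "continuous_on (A \<times> Y) (\<lambda>p. coord_deriv j f (\<phi> p))"
      by (rule continuous_on_compose2[of V "coord_deriv j f" _ \<phi>])
        (use C1 Y(4) in \<open>auto simp: \<phi>_def intro: continuous_on_subset[OF cphi, unfolded \<phi>_def]\<close>)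
    then have "continuous_on (A \<times> Y) (\<lambda>p. blinfun_scaleR_left (coord_deriv j f (\<phi> p)))"
      by (rule bounded_linear.continuous_on[OF bounded_linear_blinfun_scaleR_left])
    then show "continuous (at (x i, x j) within A \<times> Y) (\<lambda>(a, b). ?fy a b)"
      using AB(3) Y(3) by (simp add: continuous_on_eq_continuous_within case_prod_unfold \<phi>_def)
  qed (use Y in auto)
  then have D: "((\<lambda>(a, b). f (x(i := a, j := b))) has_derivative
     (\<lambda>(ta, tb). ta *\<^sub>R coord_deriv i f x + tb *\<^sub>R coord_deriv j f x)) (at (x i, x j))"
    using AB Y ij at_within_open[OF _ open_Times[OF AB(1) Y(1)], of "(x i, x j)"] by simp
  have "((\<lambda>s. (x i + s, x j - s)) has_vector_derivative (1, -1)) (at 0)"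
    by (auto intro!: derivative_eq_intros simp: has_vector_derivative_def)
  from vector_derivative_diff_chain_within[OF this, of "\<lambda>(a, b). f (x(i := a, j := b))"
      "\<lambda>(ta, tb). ta *\<^sub>R coord_deriv i f x + tb *\<^sub>R coord_deriv j f x"] has_derivative_at_withinI[OF D]
  show ?thesis by (simp add: o_def)
qed

text \<open>
Two applications of the mean value theorem. The left-hand side is symmetric in the two variables; comparing
the two orders of differentiation gives the symmetry of second derivatives.
\<close>

lemma second_difference_mean_value:
  fixes \<phi> P Q :: "real \<Rightarrow> real \<Rightarrow> real"
  assumes "h > 0"
    and P: "\<And>a b. a0 \<le> a \<Longrightarrow> a \<le> a0 + h \<Longrightarrow> b0 \<le> b \<Longrightarrow> b \<le> b0 + h \<Longrightarrow>
          ((\<lambda>a. \<phi> a b) has_real_derivative P a b) (at a)"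
    and Q: "\<And>a b. a0 \<le> a \<Longrightarrow> a \<le> a0 + h \<Longrightarrow> b0 \<le> b \<Longrightarrow> b \<le> b0 + h \<Longrightarrow>
          ((\<lambda>b. P a b) has_real_derivative Q a b) (at b)"
  obtains a b where "a0 \<le> a" "a \<le> a0 + h" "b0 \<le> b" "b \<le> b0 + h"
    "\<phi> (a0 + h) (b0 + h) - \<phi> (a0 + h) b0 - \<phi> a0 (b0 + h) + \<phi> a0 b0 = h * (h * Q a b)"
proof -
  have "\<exists>z. a0 < z \<and> z < a0 + h \<and> (\<phi> (a0 + h) (b0 + h) - \<phi> (a0 + h) b0) - (\<phi> a0 (b0 + h) - \<phi> a0 b0)
        = (a0 + h - a0) * (P z (b0 + h) - P z b0)"
    by (rule MVT2[where f = "\<lambda>a. \<phi> a (b0 + h) - \<phi> a b0"]) (use assms(1) P in \<open>auto intro!: DERIV_diff\<close>)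
  then obtain a where a: "a0 < a" "a < a0 + h"
    "(\<phi> (a0 + h) (b0 + h) - \<phi> (a0 + h) b0) - (\<phi> a0 (b0 + h) - \<phi> a0 b0) = h * (P a (b0 + h) - P a b0)"
    by auto
  have "\<exists>z. b0 < z \<and> z < b0 + h \<and> P a (b0 + h) - P a b0 = (b0 + h - b0) * Q a z"
    by (rule MVT2) (use assms(1) Q a in auto)
  then obtain b where "b0 < b" "b < b0 + h" "P a (b0 + h) - P a b0 = h * Q a b"
    by auto
  with a that[of a b] show ?thesis by auto
qed

lemma coord_deriv_commute_real:
  fixes f :: "(nat \<Rightarrow> real) \<Rightarrow> real"
  assumes V: "open V" "x \<in> V" and C2: "coord_Ck_on (Suc (Suc 0)) V f" and ij: "i \<noteq> j"
  shows "coord_deriv i (coord_deriv j f) x = coord_deriv j (coord_deriv i f) x"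
proof -
  let ?A = "coord_deriv j (coord_deriv i f)" and ?B = "coord_deriv i (coord_deriv j f)"
  have C1: "coord_Ck_on (Suc 0) V f" by (rule coord_Ck_on_pred[OF C2])
  have C1': "coord_Ck_on (Suc 0) V (coord_deriv l f)" for l
    using C2 unfolding coord_Ck_on.simps(2)[of "Suc 0"] by blast
  have cA: "continuous_on V ?A" and cB: "continuous_on V ?B"
    using C1' by simp_all
  have "\<bar>?B x - ?A x\<bar> \<le> 2 * e" if "e > 0" for e
  proof -
    define W where "W = {y \<in> V. dist (?A y) (?A x) < e} \<inter> {y \<in> V. dist (?B y) (?B x) < e}"
    have "open ({y \<in> V. dist (?A y) (?A x) < e})"
      using continuous_open_preimage[OF cA V(1), of "ball (?A x) e"]
      by (auto simp: vimage_def Int_def dist_commute)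
    moreover have "open ({y \<in> V. dist (?B y) (?B x) < e})"
      using continuous_open_preimage[OF cB V(1), of "ball (?B x) e"]
      by (auto simp: vimage_def Int_def dist_commute)
    ultimately have W: "open W" "x \<in> W" "W \<subseteq> V"
      using V(2) that unfolding W_def by auto
    define \<phi> where "\<phi> = (\<lambda>p::real\<times>real. x(i := fst p, j := snd p))"
    have cphi: "continuous_on UNIV \<phi>"
      unfolding \<phi>_def by (rule continuous_on_fun_upd2)
    have "open (\<phi> -` W)" using cphi W(1) open_vimage by blast
    moreover have "(x i, x j) \<in> \<phi> -` W" using W ij by (simp add: \<phi>_def)
    ultimately obtain S T where ST: "open S" "open T" "(x i, x j) \<in> S \<times> T" "S \<times> T \<subseteq> \<phi> -` W"
      using open_prod_elim by metis
    obtain d where d: "d > 0" "cball (x i) d \<subseteq> S" using ST open_contains_cball by (metis SigmaD1)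
    obtain d' where d': "d' > 0" "cball (x j) d' \<subseteq> T" using ST open_contains_cball by (metis SigmaD2)
    define h where "h = min d d'"
    have h: "h > 0" using d d' by (simp add: h_def)
    have in_W: "x(i := a, j := b) \<in> W" if "x i \<le> a" "a \<le> x i + h" "x j \<le> b" "b \<le> x j + h" for a b
    proof -
      have "a \<in> S" "b \<in> T"
        using that d(2) d'(2) by (auto simp: h_def subset_iff dist_real_def)
      then show ?thesis using ST(4) by (auto simp: \<phi>_def)
    qed
    have D: "((\<lambda>a. g (x(i := a, j := b))) has_real_derivative coord_deriv i g (x(i := a, j := b))) (at a)"
      "((\<lambda>b. g (x(i := a, j := b))) has_real_derivative coord_deriv j g (x(i := a, j := b))) (at b)"
      if "coord_Ck_on (Suc 0) V g" "x i \<le> a" "a \<le> x i + h" "x j \<le> b" "b \<le> x j + h"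
      for a b and g :: "(nat \<Rightarrow> real) \<Rightarrow> real"
      using has_coord_deriv[OF that(1), of "x(i := a, j := b)" i] has_coord_deriv[OF that(1), of "x(i := a, j := b)" j]
        in_W[OF that(2-)] W(3) ij fun_upd_twist[OF ij, of x]
      by (auto simp: has_real_derivative_iff_has_vector_derivative fun_upd_twist[OF ij])
    \<comment> \<open>the same second difference, evaluated with both orders of differentiation\<close>
    obtain a b where ab: "x i \<le> a" "a \<le> x i + h" "x j \<le> b" "b \<le> x j + h"
      "f (x(i := x i + h, j := x j + h)) - f (x(i := x i + h, j := x j)) - f (x(i := x i, j := x j + h)) + f (x(i := x i, j := x j))
         = h * (h * ?A (x(i := a, j := b)))"
      using second_difference_mean_value[where \<phi> = "\<lambda>a b. f (x(i := a, j := b))"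
          and P = "\<lambda>a b. coord_deriv i f (x(i := a, j := b))"
          and Q = "\<lambda>a b. ?A (x(i := a, j := b))" and ?a0.0 = "x i" and ?b0.0 = "x j", OF h D(1)[OF C1] D(2)[OF C1']]
      by blast
    obtain b' a' where ab': "x j \<le> b'" "b' \<le> x j + h" "x i \<le> a'" "a' \<le> x i + h"
      "f (x(i := x i + h, j := x j + h)) - f (x(i := x i, j := x j + h)) - f (x(i := x i + h, j := x j)) + f (x(i := x i, j := x j))
         = h * (h * ?B (x(i := a', j := b')))"
      using second_difference_mean_value[where \<phi> = "\<lambda>b a. f (x(i := a, j := b))"
          and P = "\<lambda>b a. coord_deriv j f (x(i := a, j := b))"
          and Q = "\<lambda>b a. ?B (x(i := a, j := b))" and ?a0.0 = "x j" and ?b0.0 = "x i", OF h D(2)[OF C1] D(1)[OF C1']]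
      by blast
    have "?A (x(i := a, j := b)) = ?B (x(i := a', j := b'))"
    proof -
      have "h * (h * ?A (x(i := a, j := b))) = h * (h * ?B (x(i := a', j := b')))"
        using ab(5) ab'(5) by linarith
      then show ?thesis using h by simp
    qed
    moreover have "dist (?A (x(i := a, j := b))) (?A x) < e" "dist (?B (x(i := a', j := b'))) (?B x) < e"
      using in_W[OF ab(1-4)] in_W[OF ab'(3,4,1,2)] by (auto simp: W_def)
    ultimately show ?thesis by (auto simp: dist_real_def)
  qed
  \<comment> \<open>the bound \<open>2 * e\<close> fails if \<open>e\<close> is a quarter of a positive distance\<close>
  from this[of "\<bar>?B x - ?A x\<bar> / 4"] show ?thesis by (cases "?B x = ?A x") auto
qed

text \<open>
Inner products with fixed vectors reduce the symmetry of second derivatives to the real-valued case.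
\<close>

lemma coord_deriv_commute:
  fixes f :: "(nat \<Rightarrow> real) \<Rightarrow> 'e::real_inner"
  assumes V: "open V" "x \<in> V" and C2: "coord_Ck_on (Suc (Suc 0)) V f"
  shows "coord_deriv i (coord_deriv j f) x = coord_deriv j (coord_deriv i f) x"
proof (cases "i = j")
  case False
  have C1: "coord_Ck_on (Suc 0) V f" by (rule coord_Ck_on_pred[OF C2])
  have C1': "coord_Ck_on (Suc 0) V (coord_deriv l f)" for l
    using C2 unfolding coord_Ck_on.simps(2)[of "Suc 0"] by blast
  have inn: "coord_deriv k (coord_deriv l (\<lambda>y. f y \<bullet> u)) x = coord_deriv k (coord_deriv l f) x \<bullet> u" for k l u
  proof (rule coord_derivI)
    show "((\<lambda>s. coord_deriv l (\<lambda>y. f y \<bullet> u) (x(k := s))) has_vector_derivative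
          coord_deriv k (coord_deriv l f) x \<bullet> u) (at (x k))"
    proof (rule has_partial_cong[OF V])
      show "coord_deriv l f y \<bullet> u = coord_deriv l (\<lambda>y. f y \<bullet> u) y" if "y \<in> V" for y
        using coord_deriv_inner[OF C1 that] by simp
      show "((\<lambda>s. coord_deriv l f (x(k := s)) \<bullet> u) has_vector_derivative coord_deriv k (coord_deriv l f) x \<bullet> u) (at (x k))"
        by (rule bounded_linear.has_vector_derivative[OF bounded_linear_inner_left has_coord_deriv[OF C1' V(2)]])
    qed
  qed
  have "coord_deriv i (coord_deriv j f) x \<bullet> u = coord_deriv j (coord_deriv i f) x \<bullet> u" for u
    using coord_deriv_commute_real[OF V coord_Ck_on_inner[OF V(1) C2, of u] False] by (simp add: inn)
  then show ?thesis
    by (metis inner_commute vector_eq_ldot)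
qed simp

text \<open>
The \<open>k\<close>-th face map of simplices moves coordinate \<open>i\<close> to position \<open>skip k i\<close>.
\<close>

definition skip :: "nat \<Rightarrow> nat \<Rightarrow> nat" where "skip k i = (if i < k then i else Suc i)"

lemma simplical_face_skip: "simplical_face k x (skip k i) = x i"
  by (simp add: simplical_face_def skip_def)

lemma simplical_face_fun_upd:
  "simplical_face k (x(i := s)) = (simplical_face k x)(skip k i := s)"
  by (auto simp: simplical_face_def skip_def fun_eq_iff)

lemma continuous_on_simplical_face: "continuous_on S (simplical_face k :: (nat \<Rightarrow> real) \<Rightarrow> _)"
proof (rule continuous_on_coordinatewise_then_product)
  fix i
  show "continuous_on S (\<lambda>x::nat \<Rightarrow> real. simplical_face k x i)"
    by (cases "i < k"; cases "i = k")
      (auto simp: simplical_face_def intro!: continuous_on_subset[OF continuous_on_product_coordinates])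
qed

lemma open_simplical_face_vimage: "open V \<Longrightarrow> open (simplical_face k -` V :: (nat \<Rightarrow> real) set)"
  using open_vimage continuous_on_simplical_face by blast

lemma has_coord_deriv_simplical_face:
  assumes "coord_Ck_on (Suc m) V f" "simplical_face k x \<in> V"
  shows "((\<lambda>s. f (simplical_face k (x(i := s)))) has_vector_derivative
           coord_deriv (skip k i) f (simplical_face k x)) (at (x i))"
  using has_coord_deriv[OF assms, of "skip k i"]
  by (simp add: simplical_face_skip simplical_face_fun_upd)

lemma coord_Ck_on_simplical_face:
  assumes "open V" "coord_Ck_on m V f"
  shows "coord_Ck_on m (simplical_face k -` V) (\<lambda>x. f (simplical_face k x))"
  using assms(2)
proof (induction m arbitrary: f)
  case 0
  then show ?case
    by (auto intro!: continuous_on_compose2[OF _ continuous_on_simplical_face])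
next
  case (Suc m)
  show ?case
  proof (rule coord_Ck_on_SucI[where D = "\<lambda>i x. coord_deriv (skip k i) f (simplical_face k x)"])
    show "continuous_on (simplical_face k -` V) (\<lambda>x. f (simplical_face k x))"
      by (rule continuous_on_compose2[OF coord_Ck_on_continuous[OF Suc.prems] continuous_on_simplical_face]) auto
    show "coord_Ck_on m (simplical_face k -` V) (\<lambda>x. coord_deriv (skip k i) f (simplical_face k x))" for i
      using Suc by auto
    show "open (simplical_face k -` V)"
      by (rule open_simplical_face_vimage[OF assms(1)])
    show "((\<lambda>s. f (simplical_face k (x(i := s)))) has_vector_derivative
           coord_deriv (skip k i) f (simplical_face k x)) (at (x i))" if "x \<in> simplical_face k -` V" for x i
      by (rule has_coord_deriv_simplical_face[OF Suc.prems]) (use that in simp)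
  qed
qed

lemma coord_deriv_simplical_face:
  assumes "coord_Ck_on (Suc m) V f" "simplical_face k x \<in> V"
  shows "coord_deriv i (\<lambda>x. f (simplical_face k x)) x = coord_deriv (skip k i) f (simplical_face k x)"
  by (rule coord_derivI[OF has_coord_deriv_simplical_face[OF assms]])

section \<open>Integration over the faces of a simplex\<close>

text \<open>
For a set \<open>A\<close> of vertices and a distinguished \<open>i \<in> A\<close>, a point of the face spanned by \<open>A\<close> is
determined by its barycentric coordinates at \<open>A - {i}\<close>; the one at \<open>i\<close> makes the sum equal to one.
Treating all faces of the standard simplex in this common form, inside one coordinate space, avoids
reparametrising them by lower-dimensional standard simplices before it is necessary.
\<close>

definition face_coords :: "nat set \<Rightarrow> nat \<Rightarrow> (nat \<Rightarrow> real) \<Rightarrow> nat \<Rightarrow> real" where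
  "face_coords A i t = (\<lambda>j. if j = i then 1 - (\<Sum>k\<in>A - {i}. t k) else if j \<in> A then t j else 0)"

definition closed_face :: "nat set \<Rightarrow> (nat \<Rightarrow> real) set" where
  "closed_face A = {x. (\<forall>j\<in>A. 0 \<le> x j) \<and> (\<forall>j. j \<notin> A \<longrightarrow> x j = 0) \<and> sum x A = 1}"

definition open_face :: "nat set \<Rightarrow> (nat \<Rightarrow> real) set" where
  "open_face A = {x. (\<forall>j\<in>A. 0 < x j) \<and> (\<forall>j. j \<notin> A \<longrightarrow> x j = 0) \<and> sum x A = 1}"

definition face_integral :: "nat set \<Rightarrow> nat \<Rightarrow> ((nat \<Rightarrow> real) \<Rightarrow> real) \<Rightarrow> real" where
  "face_integral A i H = (\<integral>t. indicator (open_face A) (face_coords A i t) * H (face_coords A i t) \<partial>PiM (A - {i}) (\<lambda>_. lborel))"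

lemma open_face_subset_closed_face: "open_face A \<subseteq> closed_face A"
  by (auto simp: open_face_def closed_face_def less_imp_le)

lemma closed_face_mono:
  assumes "A \<subseteq> B" "finite B"
  shows "closed_face A \<subseteq> closed_face B"
proof
  fix x assume x: "x \<in> closed_face A"
  then have "sum x B = sum x A"
    using assms by (intro sum.mono_neutral_right) (auto simp: closed_face_def)
  with x assms(1) show "x \<in> closed_face B"
    by (auto simp: closed_face_def)
qed

lemma closed_face_le_1:
  assumes "finite A" "x \<in> closed_face A"
  shows "0 \<le> x j" "x j \<le> 1"
proof -
  show "0 \<le> x j"
    using assms(2) by (cases "j \<in> A") (auto simp: closed_face_def)
  show "x j \<le> 1"
  proof (cases "j \<in> A")
    case True
    then have "x j \<le> sum x A" using assms by (intro member_le_sum) (auto simp: closed_face_def)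
    then show ?thesis using assms(2) by (simp add: closed_face_def)
  qed (use assms(2) in \<open>simp add: closed_face_def\<close>)
qed

lemma standard_simplex_eq_closed_face: "standard_simplex p = closed_face {..p}"
proof
  show "standard_simplex p \<subseteq> closed_face {..p}"
    by (auto simp: standard_simplex_def closed_face_def)
  show "closed_face {..p} \<subseteq> standard_simplex p"
    using closed_face_le_1[of "{..p}"] by (auto simp: standard_simplex_def) (auto simp: closed_face_def)
qed

lemma open_face_in_standard_simplex: "x \<in> open_face {..p} \<Longrightarrow> x \<in> standard_simplex p"
  using open_face_subset_closed_face by (auto simp: standard_simplex_eq_closed_face)

lemma compact_standard_simplex: "compact (standard_simplex p)"
  using compactin_standard_simplex[of p] by (simp add: euclidean_product_topology)

lemma compact_closed_face:
  assumes "finite A"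
  shows "compact (closed_face A)"
proof -
  obtain p where p: "A \<subseteq> {..p}" using assms finite_nat_set_iff_bounded_le by (auto simp: subset_iff)
  have "closed_face A = standard_simplex p \<inter> (\<Inter>j\<in>-A. {x. x j = 0})"
  proof
    show "closed_face A \<subseteq> standard_simplex p \<inter> (\<Inter>j\<in>-A. {x. x j = 0})"
      using closed_face_mono[OF p] standard_simplex_eq_closed_face by (auto simp: closed_face_def)
    show "standard_simplex p \<inter> (\<Inter>j\<in>-A. {x. x j = 0}) \<subseteq> closed_face A"
    proof
      fix x assume x: "x \<in> standard_simplex p \<inter> (\<Inter>j\<in>-A. {x. x j = 0})"
      then have "sum x {..p} = sum x A"
        using p by (intro sum.mono_neutral_right) auto
      with x show "x \<in> closed_face A"
        by (auto simp: standard_simplex_def closed_face_def)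
    qed
  qed
  moreover have "closed (\<Inter>j\<in>-A. {x::nat \<Rightarrow> real. x j = 0})"
    by (intro closed_INT ballI closed_Collect_eq continuous_on_const continuous_on_product_coordinates)
  ultimately show ?thesis using compact_standard_simplex by (simp add: compact_Int_closed)
qed

lemma open_face_borel [measurable]:
  assumes "finite A"
  shows "open_face A \<in> sets borel"
proof -
  have "open_face A = (\<Inter>j\<in>A. {x. 0 < x j}) \<inter> closed_face A"
    by (auto simp: open_face_def closed_face_def less_imp_le)
  moreover have "open (\<Inter>j\<in>A. {x::nat \<Rightarrow> real. 0 < x j})"
    using assms by (intro open_INT ballI open_Collect_less continuous_on_const continuous_on_product_coordinates)
  moreover have "closed (closed_face A)"
  proof -
    have "closed_face A = (\<Inter>j\<in>A. {x. 0 \<le> x j}) \<inter> (\<Inter>j\<in>-A. {x. x j = 0}) \<inter> {x. sum x A = 1}"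
      by (auto simp: closed_face_def)
    then show ?thesis
      by (auto intro!: closed_Int closed_INT closed_Collect_le closed_Collect_eq continuous_on_const
          continuous_on_product_coordinates continuous_on_sum)
  qed
  ultimately show ?thesis by (simp add: borel_open borel_closed sets.Int)
qed

text \<open>
The Borel sets of the product topology on sequences form the product sigma-algebra, so measurability may be
checked coordinate by coordinate.
\<close>

lemma face_coords_measurable:
  assumes "finite A"
  shows "face_coords A i \<in> PiM (A - {i}) (\<lambda>_. lborel) \<rightarrow>\<^sub>M borel"
proof (rule measurable_coordinatewise_then_product)
  fix j
  have comp: "(\<lambda>t. t k) \<in> borel_measurable (PiM (A - {i}) (\<lambda>_. lborel :: real measure))" if "k \<in> A - {i}" for k
    using measurable_component_singleton[OF that, of "\<lambda>_. lborel :: real measure"] by simp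
  show "(\<lambda>t. face_coords A i t j) \<in> borel_measurable (PiM (A - {i}) (\<lambda>_. lborel))"
  proof (cases "j = i")
    case True
    then show ?thesis
      using comp by (simp add: face_coords_def)
  next
    case False
    then show ?thesis using comp by (cases "j \<in> A") (simp_all add: face_coords_def)
  qed
qed

interpretation lborel_product: product_sigma_finite "\<lambda>_::nat. lborel :: real measure"
  by standard

lemma open_face_integrand_measurable:
  fixes H :: "(nat \<Rightarrow> real) \<Rightarrow> real"
  assumes "finite A" "continuous_on (open_face A) H"
  shows "(\<lambda>x. indicator (open_face A) x * H x) \<in> borel_measurable borel"
  using borel_measurable_continuous_on_indicator[OF open_face_borel[OF assms(1)] assms(2)] by simp

lemma face_coords_in_open_face_bounds:
  assumes "finite A" "face_coords A i t \<in> open_face A" "j \<in> A - {i}"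
  shows "0 \<le> t j" "t j \<le> 1"
  using closed_face_le_1[OF assms(1), of "face_coords A i t" j] open_face_subset_closed_face assms(2,3)
  by (auto simp: face_coords_def split: if_splits)

text \<open>
The face lies over the unit cube, which has finite measure.
\<close>

lemma face_integrand_integrable:
  fixes H :: "(nat \<Rightarrow> real) \<Rightarrow> real"
  assumes A: "finite A" and H: "continuous_on (open_face A) H" "\<And>x. x \<in> open_face A \<Longrightarrow> \<bar>H x\<bar> \<le> B"
  shows "integrable (PiM (A - {i}) (\<lambda>_. lborel)) (\<lambda>t. indicator (open_face A) (face_coords A i t) * H (face_coords A i t))"
proof (rule integrableI_bounded_set[where A = "Pi\<^sub>E (A - {i}) (\<lambda>_. {0..1})" and B = "max B 0"])
  let ?P = "PiM (A - {i}) (\<lambda>_. lborel :: real measure)"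
  show "Pi\<^sub>E (A - {i}) (\<lambda>_. {0..1}) \<in> sets ?P"
    using A by (intro sets_PiM_I_finite) auto
  have "emeasure ?P (Pi\<^sub>E (A - {i}) (\<lambda>_. {0..1})) = (\<Prod>j\<in>A - {i}. emeasure lborel {0..1::real})"
    using A by (intro lborel_product.emeasure_PiM) auto
  also have "\<dots> < \<infinity>" by simp
  finally show "emeasure ?P (Pi\<^sub>E (A - {i}) (\<lambda>_. {0..1})) < \<infinity>" .
  show "(\<lambda>t. indicator (open_face A) (face_coords A i t) * H (face_coords A i t)) \<in> borel_measurable ?P"
    using measurable_compose[OF face_coords_measurable[OF A] open_face_integrand_measurable[OF A H(1)]] .
  show "AE t in ?P. t \<in> Pi\<^sub>E (A - {i}) (\<lambda>_. {0..1}) \<longrightarrow>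
      norm (indicator (open_face A) (face_coords A i t) * H (face_coords A i t)) \<le> max B 0"
    using H(2) by (intro AE_I2) (auto simp: indicator_def le_max_iff_disj)
  show "AE t in ?P. t \<notin> Pi\<^sub>E (A - {i}) (\<lambda>_. {0..1}) \<longrightarrow>
      indicator (open_face A) (face_coords A i t) * H (face_coords A i t) = 0"
  proof (intro AE_I2 impI)
    fix t assume that: "t \<in> space ?P" "t \<notin> Pi\<^sub>E (A - {i}) (\<lambda>_. {0..1})"
    have "face_coords A i t \<notin> open_face A"
      using face_coords_in_open_face_bounds[OF A, of i t] that by (auto simp: space_PiM PiE_def)
    then show "indicator (open_face A) (face_coords A i t) * H (face_coords A i t) = 0" by simp
  qed
qed

text \<open>
The segment, parametrised by the coordinate \<open>y\<close> at \<open>k\<close>, along which the coordinates other than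
\<open>i\<close> and \<open>k\<close> are kept at the values given by \<open>x\<close>.
\<close>

definition face_segment :: "nat set \<Rightarrow> nat \<Rightarrow> nat \<Rightarrow> (nat \<Rightarrow> real) \<Rightarrow> real \<Rightarrow> nat \<Rightarrow> real" where
  "face_segment A i k x y = (\<lambda>j. if j = k then y else if j = i then (1 - (\<Sum>l\<in>A - {i, k}. x l)) - y
     else if j \<in> A then x j else 0)"

lemma face_coords_fun_upd:
  assumes "finite A" "i \<in> A" "k \<in> A" "i \<noteq> k"
  shows "face_coords A i (x(k := y)) = face_segment A i k x y"
proof -
  have "(\<Sum>l\<in>A - {i}. (x(k := y)) l) = y + (\<Sum>l\<in>A - {i, k}. x l)"
  proof -
    have "A - {i} = insert k (A - {i, k})" using assms by auto
    then have "(\<Sum>l\<in>A - {i}. (x(k := y)) l) = y + (\<Sum>l\<in>A - {i, k}. (x(k := y)) l)"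
      using assms(1) by simp
    also have "(\<Sum>l\<in>A - {i, k}. (x(k := y)) l) = (\<Sum>l\<in>A - {i, k}. x l)"
      by (rule sum.cong) auto
    finally show ?thesis .
  qed
  with assms show ?thesis by (auto simp: face_coords_def face_segment_def fun_eq_iff)
qed

lemma face_segment_swap:
  assumes "i \<noteq> k"
  shows "face_segment A k i x y = face_segment A i k x ((1 - (\<Sum>l\<in>A - {i, k}. x l)) - y)"
  using assms by (auto simp: face_segment_def fun_eq_iff insert_commute)

lemma face_segment_in_open_face:
  assumes "finite A" "i \<in> A" "k \<in> A" "i \<noteq> k"
  shows "face_segment A i k x y \<in> open_face A \<longleftrightarrow>
    (\<forall>l\<in>A - {i, k}. 0 < x l) \<and> 0 < y \<and> y < 1 - (\<Sum>l\<in>A - {i, k}. x l)"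
proof -
  have "sum (face_segment A i k x y) A = 1"
  proof -
    have "A = insert i (insert k (A - {i, k}))" using assms by auto
    then have "sum (face_segment A i k x y) A = sum (face_segment A i k x y) (insert i (insert k (A - {i, k})))" by simp
    also have "\<dots> = 1 - (\<Sum>l\<in>A - {i, k}. x l) + sum (face_segment A i k x y) (A - {i, k})"
      using assms by (simp add: face_segment_def)
    also have "sum (face_segment A i k x y) (A - {i, k}) = (\<Sum>l\<in>A - {i, k}. x l)"
      by (rule sum.cong) (auto simp: face_segment_def)
    finally show ?thesis by simp
  qed
  moreover have "face_segment A i k x y j = 0" if "j \<notin> A" for j
    using that assms by (auto simp: face_segment_def)
  moreover have "(\<forall>j\<in>A. 0 < face_segment A i k x y j) \<longleftrightarrow>
     (\<forall>l\<in>A - {i, k}. 0 < x l) \<and> 0 < y \<and> y < 1 - (\<Sum>l\<in>A - {i, k}. x l)"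
    using assms by (auto simp: face_segment_def)
  ultimately show ?thesis by (auto simp: open_face_def)
qed

lemma face_integral_Fubini:
  fixes H :: "(nat \<Rightarrow> real) \<Rightarrow> real"
  assumes A: "finite A" "i \<in> A" "k \<in> A" "i \<noteq> k"
    and H: "continuous_on (open_face A) H" "\<And>x. x \<in> open_face A \<Longrightarrow> \<bar>H x\<bar> \<le> B"
  shows "face_integral A i H = (\<integral>x. (\<integral>y. indicator (open_face A) (face_segment A i k x y) * H (face_segment A i k x y) \<partial>lborel)
           \<partial>PiM (A - {i, k}) (\<lambda>_. lborel))"
proof -
  have ins: "A - {i} = insert k (A - {i, k})" using A by auto
  show ?thesis
    unfolding face_integral_def ins
    by (subst lborel_product.product_integral_insert)
      (use A face_integrand_integrable[OF A(1) H, of i] in \<open>simp_all add: ins face_coords_fun_upd\<close>)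
qed

text \<open>
Exchanging the distinguished vertices \<open>i\<close> and \<open>k\<close> reverses the segments between them, and Lebesgue
measure on the line is invariant under reflection.
\<close>

lemma face_integral_vertex_indep:
  fixes H :: "(nat \<Rightarrow> real) \<Rightarrow> real"
  assumes A: "finite A" "i \<in> A" "k \<in> A"
    and H: "continuous_on (open_face A) H" "\<And>x. x \<in> open_face A \<Longrightarrow> \<bar>H x\<bar> \<le> B"
  shows "face_integral A i H = face_integral A k H"
proof (cases "i = k")
  case False
  let ?h = "\<lambda>x. indicator (open_face A) x * H x"
  have "(\<integral>y. ?h (face_segment A i k x y) \<partial>lborel) = (\<integral>y. ?h (face_segment A k i x y) \<partial>lborel)" for x
    by (subst lborel_integral_real_affine[where c = "-1" and t = "1 - (\<Sum>l\<in>A - {i, k}. x l)"])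
      (simp_all add: face_segment_swap[OF False])
  then show ?thesis
    using face_integral_Fubini[OF A False H] face_integral_Fubini[OF A(1,3,2) not_sym[OF False] H]
    by (simp add: insert_commute)
qed simp

text \<open>
The derivative is only defined in the open interval; being bounded and continuous there, it is Lebesgue
integrable, and its integral agrees with the gauge integral of the fundamental theorem of calculus.
\<close>

lemma integral_bounded_derivative:
  fixes f g :: "real \<Rightarrow> real"
  assumes "0 < r" and f: "continuous_on {0..r} f"
    and D: "\<And>y. 0 < y \<Longrightarrow> y < r \<Longrightarrow> (f has_real_derivative g y) (at y)"
    and g: "continuous_on {0<..<r} g" "\<And>y. 0 < y \<Longrightarrow> y < r \<Longrightarrow> \<bar>g y\<bar> \<le> B"
  shows "(\<integral>y. indicator {0<..<r} y * g y \<partial>lborel) = f r - f 0"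
proof -
  let ?g = "\<lambda>y. indicator {0<..<r} y * g y"
  have "integrable lborel ?g"
  proof (rule integrableI_bounded_set[where A = "{0..r}" and B = "max B 0"])
    show "?g \<in> borel_measurable lborel"
      using borel_measurable_continuous_on_indicator[OF _ g(1)] by simp
    show "AE y in lborel. y \<in> {0..r} \<longrightarrow> norm (?g y) \<le> max B 0"
      using g(2) by (intro AE_I2) (auto simp: indicator_def le_max_iff_disj)
  qed (use assms(1) in \<open>auto simp: indicator_def\<close>)
  then have "(?g has_integral (\<integral>y. ?g y \<partial>lborel)) UNIV"
    by (rule has_integral_integral_lborel)
  moreover have "(?g has_integral (f r - f 0)) {0..r}"
    using assms(1) f D
    by (intro fundamental_theorem_of_calculus_interior)
      (auto simp: has_real_derivative_iff_has_vector_derivative)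
  then have "(?g has_integral (f r - f 0)) UNIV"
    by (rule has_integral_on_superset) (auto simp: indicator_def)
  ultimately show ?thesis by (rule has_integral_unique)
qed

lemma continuous_on_face_segment: "continuous_on S (face_segment A i k x)"
proof (rule continuous_on_coordinatewise_then_product)
  fix j
  show "continuous_on S (\<lambda>y. face_segment A i k x y j)"
    by (cases "j = k"; cases "j = i"; cases "j \<in> A") (auto simp: face_segment_def intro!: continuous_intros)
qed

text \<open>
After Fubini, the inner integral runs along the segments in direction \<open>e\<^sub>k - e\<^sub>i\<close>, where the fundamental
theorem of calculus applies. The upper end of a segment, where the coordinate at \<open>i\<close> vanishes, lies on
the face opposite to \<open>i\<close>, and the lower end on the face opposite to \<open>k\<close>.
\<close>

lemma face_integral_direction_derivative:
  fixes W G :: "(nat \<Rightarrow> real) \<Rightarrow> real"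
  assumes A: "finite A" "i \<in> A" "k \<in> A" "i \<noteq> k"
    and W: "continuous_on (closed_face A) W"
    and G: "continuous_on (open_face A) G" "\<And>x. x \<in> open_face A \<Longrightarrow> \<bar>G x\<bar> \<le> B"
    and D: "\<And>x. x \<in> open_face A \<Longrightarrow> ((\<lambda>s. W (x(k := x k + s, i := x i - s))) has_real_derivative G x) (at 0)"
  shows "face_integral A i G = face_integral (A - {i}) k W - face_integral (A - {k}) i W"
proof -
  let ?J = "A - {i, k}"
  let ?P = "PiM ?J (\<lambda>_. lborel :: real measure)"
  have J: "A - {i} - {k} = ?J" "A - {k} - {i} = ?J" by auto
  have W': "continuous_on (closed_face B') W" if "B' \<subseteq> A" for B'
    using continuous_on_subset[OF W closed_face_mono[OF that A(1)]] .
  have "bounded (W ` closed_face A)"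
    by (rule compact_imp_bounded[OF compact_continuous_image[OF W compact_closed_face[OF A(1)]]])
  then obtain C where C: "\<And>x. x \<in> closed_face A \<Longrightarrow> \<bar>W x\<bar> \<le> C"
    unfolding bounded_iff by auto
  have int: "integrable (PiM (B' - {l}) (\<lambda>_. lborel)) (\<lambda>t. indicator (open_face B') (face_coords B' l t) * W (face_coords B' l t))"
    if "B' \<subseteq> A" for B' l
  proof (rule face_integrand_integrable[where B = C])
    show "finite B'" using that A(1) finite_subset by blast
    show "continuous_on (open_face B') W"
      using W'[OF that] open_face_subset_closed_face continuous_on_subset by blast
    show "\<bar>W x\<bar> \<le> C" if "x \<in> open_face B'" for x
      using that open_face_subset_closed_face closed_face_mono[OF \<open>B' \<subseteq> A\<close> A(1)] C by blast
  qed
  have "(\<integral>y. indicator (open_face A) (face_segment A i k x y) * G (face_segment A i k x y) \<partial>lborel) =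
      indicator (open_face (A - {i})) (face_coords (A - {i}) k x) * W (face_coords (A - {i}) k x)
      - indicator (open_face (A - {k})) (face_coords (A - {k}) i x) * W (face_coords (A - {k}) i x)" for x
  proof -
    define r where "r = 1 - (\<Sum>l\<in>?J. x l)"
    have ends: "face_coords (A - {i}) k x = face_segment A i k x r" "face_coords (A - {k}) i x = face_segment A i k x 0"
      using A unfolding face_coords_def face_segment_def r_def J by (auto simp: fun_eq_iff)
    have sumJ: "sum (face_segment A i k x y) ?J = (\<Sum>l\<in>?J. x l)" for y
      by (rule sum.cong) (auto simp: face_segment_def)
    have ik: "A - {i} = insert k ?J" "A - {k} = insert i ?J" using A by auto
    have at_k: "face_segment A i k x y k = y" "face_segment A i k x y i = r - y" for y
      using A by (auto simp: face_segment_def r_def)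
    have top: "face_segment A i k x r \<in> open_face (A - {i}) \<longleftrightarrow> (\<forall>l\<in>?J. 0 < x l) \<and> 0 < r"
      using A at_k[of r] sumJ[of r] unfolding open_face_def ik
      by (auto simp: face_segment_def r_def)
    have bot: "face_segment A i k x 0 \<in> open_face (A - {k}) \<longleftrightarrow> (\<forall>l\<in>?J. 0 < x l) \<and> 0 < r"
      using A at_k[of 0] sumJ[of 0] unfolding open_face_def ik
      by (auto simp: face_segment_def r_def)
    have seg: "face_segment A i k x y \<in> open_face A \<longleftrightarrow> (\<forall>l\<in>?J. 0 < x l) \<and> 0 < y \<and> y < r" for y
      unfolding r_def by (rule face_segment_in_open_face[OF A])
    show ?thesis
    proof (cases "(\<forall>l\<in>?J. 0 < x l) \<and> 0 < r")
      case False
      then have "face_segment A i k x y \<notin> open_face A" for y using seg by auto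
      then show ?thesis using False top bot unfolding ends by simp
    next
      case True
      have cl: "face_segment A i k x y \<in> closed_face A" if "0 \<le> y" "y \<le> r" for y
      proof -
        consider "y = 0" | "y = r" | "0 < y" "y < r" using \<open>0 \<le> y\<close> \<open>y \<le> r\<close> by linarith
        then show ?thesis
        proof cases
          case 1
          with bot True open_face_subset_closed_face[of "A - {k}"] closed_face_mono[of "A - {k}" A] A
          show ?thesis by blast
        next
          case 2
          with top True open_face_subset_closed_face[of "A - {i}"] closed_face_mono[of "A - {i}" A] A
          show ?thesis by blast
        next
          case 3
          with seg True open_face_subset_closed_face[of A] show ?thesis by blast
        qed
      qed
      have "(\<integral>y. indicator {0<..<r} y * G (face_segment A i k x y) \<partial>lborel) =
          W (face_segment A i k x r) - W (face_segment A i k x 0)"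
      proof (rule integral_bounded_derivative[where B = B])
        show "continuous_on {0..r} (\<lambda>y. W (face_segment A i k x y))"
          by (rule continuous_on_compose2[OF W continuous_on_face_segment]) (use cl in auto)
        show "continuous_on {0<..<r} (\<lambda>y. G (face_segment A i k x y))"
          by (rule continuous_on_compose2[OF G(1) continuous_on_face_segment]) (use seg True in auto)
        fix y assume y: "0 < y" "y < r"
        then have o: "face_segment A i k x y \<in> open_face A" using seg True by blast
        then show "\<bar>G (face_segment A i k x y)\<bar> \<le> B" by (rule G(2))
        have eq: "(face_segment A i k x y)(k := face_segment A i k x y k + s, i := face_segment A i k x y i - s)
             = face_segment A i k x (y + s)" for s
          using A by (auto simp: face_segment_def fun_eq_iff)
        have "((\<lambda>s. W (face_segment A i k x (y + s))) has_real_derivative G (face_segment A i k x y)) (at 0)"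
          using D[OF o] unfolding eq .
        then show "((\<lambda>y. W (face_segment A i k x y)) has_real_derivative G (face_segment A i k x y)) (at y)"
          using DERIV_shift[of "\<lambda>y. W (face_segment A i k x y)" "G (face_segment A i k x y)" 0 y]
          by (simp add: add.commute)
      qed (use True in auto)
      moreover have "indicator {0<..<r} y = (indicator (open_face A) (face_segment A i k x y) :: real)" for y
        using seg True by (auto simp: indicator_def)
      ultimately show ?thesis using True top bot unfolding ends by simp
    qed
  qed
  then have "face_integral A i G = (\<integral>x. indicator (open_face (A - {i})) (face_coords (A - {i}) k x) * W (face_coords (A - {i}) k x)
      - indicator (open_face (A - {k})) (face_coords (A - {k}) i x) * W (face_coords (A - {k}) i x) \<partial>?P)"
    using face_integral_Fubini[OF A G] by simp
  also have "\<dots> = face_integral (A - {i}) k W - face_integral (A - {k}) i W"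
    unfolding face_integral_def J using int[of "A - {i}" k] int[of "A - {k}" i]
    by (intro Bochner_Integration.integral_diff) (simp_all add: J Diff_subset)
  finally show ?thesis .
qed

lemma distr_lborel_PiM_reindex:
  fixes \<psi> :: "nat \<Rightarrow> nat"
  assumes "finite I" "bij_betw \<psi> J I"
  shows "distr (PiM I (\<lambda>_. lborel)) (PiM J (\<lambda>_. lborel)) (\<lambda>t. \<lambda>j\<in>J. t (\<psi> j)) = PiM J (\<lambda>_. lborel :: real measure)"
proof (rule lborel_product.PiM_eqI)
  show J: "finite J" using assms bij_betw_finite by blast
  have meas: "(\<lambda>t. \<lambda>j\<in>J. t (\<psi> j)) \<in> PiM I (\<lambda>_. lborel) \<rightarrow>\<^sub>M PiM J (\<lambda>_. lborel :: real measure)"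
    using assms(2) by (intro measurable_restrict measurable_component_singleton) (auto simp: bij_betw_def)
  fix S :: "nat \<Rightarrow> real set" assume S: "\<And>j. j \<in> J \<Longrightarrow> S j \<in> sets lborel"
  let ?\<phi> = "inv_into J \<psi>"
  have inv: "\<psi> j \<in> I" "?\<phi> (\<psi> j) = j" if "j \<in> J" for j
    using assms(2) that by (auto simp: bij_betw_def)
  have inv': "?\<phi> i \<in> J" "\<psi> (?\<phi> i) = i" if "i \<in> I" for i
    using assms(2) that by (auto simp: bij_betw_def inv_into_into f_inv_into_f)
  have "(\<lambda>t. \<lambda>j\<in>J. t (\<psi> j)) -` Pi\<^sub>E J S \<inter> space (PiM I (\<lambda>_. lborel)) = Pi\<^sub>E I (\<lambda>i. S (?\<phi> i))"
  proof (rule Set.set_eqI, rule iffI)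
    fix t assume t: "t \<in> (\<lambda>t. \<lambda>j\<in>J. t (\<psi> j)) -` Pi\<^sub>E J S \<inter> space (PiM I (\<lambda>_. lborel))"
    have "t i \<in> S (?\<phi> i)" if "i \<in> I" for i
    proof -
      have "(\<lambda>j\<in>J. t (\<psi> j)) (?\<phi> i) \<in> S (?\<phi> i)" using t inv'(1)[OF that] by auto
      then show ?thesis using inv'[OF that] by simp
    qed
    with t show "t \<in> Pi\<^sub>E I (\<lambda>i. S (?\<phi> i))" by (auto simp: space_PiM PiE_def)
  next
    fix t assume t: "t \<in> Pi\<^sub>E I (\<lambda>i. S (?\<phi> i))"
    have "t (\<psi> j) \<in> S j" if "j \<in> J" for j
      using PiE_mem[OF t inv(1)[OF that]] inv(2)[OF that] by simp
    with t show "t \<in> (\<lambda>t. \<lambda>j\<in>J. t (\<psi> j)) -` Pi\<^sub>E J S \<inter> space (PiM I (\<lambda>_. lborel))"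
      by (auto simp: space_PiM PiE_def)
  qed
  then have "emeasure (distr (PiM I (\<lambda>_. lborel)) (PiM J (\<lambda>_. lborel)) (\<lambda>t. \<lambda>j\<in>J. t (\<psi> j))) (Pi\<^sub>E J S)
     = emeasure (PiM I (\<lambda>_. lborel)) (Pi\<^sub>E I (\<lambda>i. S (?\<phi> i)))"
    using S J by (subst emeasure_distr[OF meas]) (auto intro: sets_PiM_I_finite)
  also have "\<dots> = (\<Prod>i\<in>I. emeasure lborel (S (?\<phi> i)))"
    using S inv' assms(1) by (intro lborel_product.emeasure_PiM) auto
  also have "\<dots> = (\<Prod>j\<in>J. emeasure lborel (S j))"
    using inv by (subst prod.reindex_bij_betw[OF assms(2), symmetric]) simp
  finally show "emeasure (distr (PiM I (\<lambda>_. lborel)) (PiM J (\<lambda>_. lborel)) (\<lambda>t. \<lambda>j\<in>J. t (\<psi> j))) (Pi\<^sub>E J S)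
     = (\<Prod>j\<in>J. emeasure lborel (S j))" .
qed simp

lemma skip_image:
  assumes "k \<le> Suc q"
  shows "bij_betw (skip k) {..q} ({..Suc q} - {k})"
  unfolding bij_betw_def
proof
  show "inj_on (skip k) {..q}" by (auto simp: inj_on_def skip_def split: if_splits)
  show "skip k ` {..q} = {..Suc q} - {k}"
  proof
    show "{..Suc q} - {k} \<subseteq> skip k ` {..q}"
    proof
      fix j assume j: "j \<in> {..Suc q} - {k}"
      show "j \<in> skip k ` {..q}"
      proof (cases "j < k")
        case True
        then show ?thesis using assms by (intro image_eqI[of _ _ j]) (auto simp: skip_def)
      next
        case False
        then show ?thesis using j by (intro image_eqI[of _ _ "j - 1"]) (auto simp: skip_def)
      qed
    qed
  qed (use assms in \<open>auto simp: skip_def\<close>)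
qed

lemma sum_simplical_face:
  fixes x :: "nat \<Rightarrow> real"
  assumes "k \<le> Suc q"
  shows "sum (simplical_face k x) ({..Suc q} - {k}) = sum x {..q}"
  using sum.reindex_bij_betw[OF skip_image[OF assms], of "simplical_face k x"]
  by (simp add: simplical_face_skip)

lemma simplical_face_in_open_face:
  assumes "k \<le> Suc q"
  shows "simplical_face k x \<in> open_face ({..Suc q} - {k}) \<longleftrightarrow> x \<in> open_face {..q}"
proof -
  have im: "{..Suc q} - {k} = skip k ` {..q}"
    using skip_image[OF assms] by (simp add: bij_betw_def)
  have "(\<forall>j. j \<notin> {..Suc q} - {k} \<longrightarrow> simplical_face k x j = 0) \<longleftrightarrow> (\<forall>j. j \<notin> {..q} \<longrightarrow> x j = 0)"
  proof (intro iffI allI impI)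
    fix j assume "\<forall>j. j \<notin> {..Suc q} - {k} \<longrightarrow> simplical_face k x j = 0" "j \<notin> {..q}"
    then have "simplical_face k x (Suc j) = 0" by auto
    with \<open>j \<notin> {..q}\<close> assms show "x j = 0" by (auto simp: simplical_face_def)
  next
    fix j assume x: "\<forall>j. j \<notin> {..q} \<longrightarrow> x j = 0" and j: "j \<notin> {..Suc q} - {k}"
    show "simplical_face k x j = 0"
    proof (cases "j = k")
      case False
      with j have "Suc q < j" by simp
      then have "x (j - 1) = 0" using x by auto
      with \<open>Suc q < j\<close> assms show ?thesis by (simp add: simplical_face_def)
    qed (simp add: simplical_face_def)
  qed
  moreover have "(\<forall>j\<in>{..Suc q} - {k}. 0 < simplical_face k x j) \<longleftrightarrow> (\<forall>j\<in>{..q}. 0 < x j)"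
    unfolding im by (simp add: simplical_face_skip)
  ultimately show ?thesis
    unfolding open_face_def by (simp only: sum_simplical_face[OF assms] mem_Collect_eq)
qed

lemma face_integral_simplical_face:
  assumes k: "k \<le> Suc q"
    and H: "continuous_on (open_face ({..Suc q} - {k})) H"
  shows "face_integral {..q} 0 (\<lambda>x. H (simplical_face k x)) = face_integral ({..Suc q} - {k}) (skip k 0) H"
proof -
  define B where "B = {..Suc q} - {k}"
  let ?\<psi> = "inv_into {..q} (skip k)"
  let ?I = "{..q} - {0}" and ?J = "B - {skip k 0}"
  let ?g = "\<lambda>t::nat \<Rightarrow> real. \<lambda>j\<in>?J. t (?\<psi> j)"
  have bij: "bij_betw (skip k) {..q} B" unfolding B_def by (rule skip_image[OF k])
  have B: "finite B" by (simp add: B_def)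
  have inv: "?\<psi> (skip k i) = i" if "i \<le> q" for i
    using bij that by (simp add: bij_betw_def)
  have bij0: "bij_betw (skip k) ?I ?J"
  proof -
    have "skip k 0 \<in> B" using bij by (auto simp: bij_betw_def)
    then show ?thesis using bij_betw_DiffI[OF bij, of "{0}" "{skip k 0}"] by simp
  qed
  then have bij': "bij_betw ?\<psi> ?J ?I"
    using bij_betw_inv_into_subset[OF bij, of ?I ?J] by (auto simp: bij_betw_def)
  have meas: "?g \<in> PiM ?I (\<lambda>_. lborel) \<rightarrow>\<^sub>M PiM ?J (\<lambda>_. lborel :: real measure)"
    using bij' by (intro measurable_restrict measurable_component_singleton) (auto simp: bij_betw_def)
  have eq: "face_coords B (skip k 0) (?g t) = simplical_face k (face_coords {..q} 0 t)" for t
  proof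
    fix j
    have "(\<Sum>l\<in>?J. ?g t l) = (\<Sum>i\<in>?I. ?g t (skip k i))"
      by (rule sum.reindex_bij_betw[OF bij0, symmetric])
    also have "\<dots> = (\<Sum>i\<in>?I. t i)"
      using bij0 by (intro sum.cong) (auto simp: inv bij_betw_def)
    finally have S: "(\<Sum>l\<in>?J. ?g t l) = (\<Sum>i\<in>?I. t i)" .
    show "face_coords B (skip k 0) (?g t) j = simplical_face k (face_coords {..q} 0 t) j"
    proof (cases "j \<in> B")
      case True
      then obtain i where i: "i \<le> q" "j = skip k i" using bij by (auto simp: bij_betw_def)
      then have "i \<noteq> 0 \<Longrightarrow> skip k i \<noteq> skip k 0"
        using bij by (auto simp: bij_betw_def inj_on_def)
      with i True S show ?thesis
        by (cases "i = 0") (auto simp: face_coords_def simplical_face_skip inv)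
    next
      case False
      then have "j \<noteq> skip k 0" using bij by (auto simp: bij_betw_def)
      moreover have "simplical_face k (face_coords {..q} 0 t) j = 0"
      proof (cases "j = k")
        case False
        with \<open>j \<notin> B\<close> have "Suc q < j" by (simp add: B_def)
        then show ?thesis using k by (simp add: simplical_face_def face_coords_def)
      qed (simp add: simplical_face_def)
      ultimately show ?thesis using False by (simp add: face_coords_def)
    qed
  qed
  let ?h = "\<lambda>x. indicator (open_face B) x * H x"
  have "face_integral B (skip k 0) H =
     (\<integral>t. ?h (face_coords B (skip k 0) t) \<partial>distr (PiM ?I (\<lambda>_. lborel)) (PiM ?J (\<lambda>_. lborel)) ?g)"
    unfolding face_integral_def by (subst distr_lborel_PiM_reindex[OF _ bij']) simp_all
  also have "\<dots> = (\<integral>t. ?h (face_coords B (skip k 0) (?g t)) \<partial>PiM ?I (\<lambda>_. lborel))"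
    by (rule integral_distr[OF meas])
      (rule measurable_compose[OF face_coords_measurable[OF B] open_face_integrand_measurable[OF B H[folded B_def]]])
  also have "\<dots> = face_integral {..q} 0 (\<lambda>x. H (simplical_face k x))"
    unfolding face_integral_def eq using simplical_face_in_open_face[OF k, folded B_def]
    by (simp add: indicator_def)
  finally show ?thesis by (simp add: B_def)
qed

text \<open>
The face opposite to vertex \<open>0\<close> comes with distinguished vertex \<open>k\<close>, whereas its parametrisation by
the face map has distinguished vertex \<open>1\<close>; independence of that choice bridges the difference.
\<close>

lemma face_integral_boundary_difference:
  fixes W G :: "(nat \<Rightarrow> real) \<Rightarrow> real"
  assumes k: "1 \<le> k" "k \<le> Suc q"
    and W: "continuous_on (standard_simplex (Suc q)) W"
    and G: "continuous_on (open_face {..Suc q}) G" "\<And>x. x \<in> open_face {..Suc q} \<Longrightarrow> \<bar>G x\<bar> \<le> B"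
    and D: "\<And>x. x \<in> open_face {..Suc q} \<Longrightarrow> ((\<lambda>s. W (x(k := x k + s, 0 := x 0 - s))) has_real_derivative G x) (at 0)"
  shows "face_integral {..Suc q} 0 G =
    face_integral {..q} 0 (\<lambda>x. W (simplical_face 0 x)) - face_integral {..q} 0 (\<lambda>x. W (simplical_face k x))"
proof -
  have W': "continuous_on (closed_face {..Suc q}) W" using W by (simp add: standard_simplex_eq_closed_face)
  have Wo: "continuous_on (open_face B') W" if "B' \<subseteq> {..Suc q}" for B'
    using continuous_on_subset[OF W'] open_face_subset_closed_face closed_face_mono[OF that] by (meson finite_atMost order_trans)
  have "bounded (W ` closed_face {..Suc q})"
    by (rule compact_imp_bounded[OF compact_continuous_image[OF W' compact_closed_face]]) simp
  then obtain C where C: "\<And>x. x \<in> closed_face {..Suc q} \<Longrightarrow> \<bar>W x\<bar> \<le> C"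
    unfolding bounded_iff by auto
  have "face_integral {..Suc q} 0 G = face_integral ({..Suc q} - {0}) k W - face_integral ({..Suc q} - {k}) 0 W"
    by (rule face_integral_direction_derivative[OF _ _ _ _ W' G D]) (use k in auto)
  also have "face_integral ({..Suc q} - {0}) k W = face_integral ({..Suc q} - {0}) (skip 0 0) W"
  proof (rule face_integral_vertex_indep[where B = C])
    show "\<bar>W x\<bar> \<le> C" if "x \<in> open_face ({..Suc q} - {0})" for x
      using that C open_face_subset_closed_face closed_face_mono[of "{..Suc q} - {0}" "{..Suc q}"] by blast
  qed (use k in \<open>auto simp: skip_def intro!: Wo\<close>)
  also have "\<dots> = face_integral {..q} 0 (\<lambda>x. W (simplical_face 0 x))"
    by (rule face_integral_simplical_face[symmetric]) (auto intro: Wo)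
  also have "face_integral ({..Suc q} - {k}) 0 W = face_integral ({..Suc q} - {k}) (skip k 0) W"
    using k by (simp add: skip_def)
  also have "\<dots> = face_integral {..q} 0 (\<lambda>x. W (simplical_face k x))"
    by (rule face_integral_simplical_face[symmetric]) (use k in \<open>auto intro: Wo\<close>)
  finally show ?thesis .
qed

section \<open>Smooth simplices in charts\<close>

lemma chart_inv_snd:
  assumes "smooth_manifold M" "c \<in> atlas M" "q \<in> fst c"
  shows "chart_inv c (snd c q) = q"
proof -
  have h: "homeomorphic_map (subtopology (mtop M) (fst c)) (top_of_set (chart_image c)) (snd c)"
    and o: "openin (mtop M) (fst c)"
    using assms(1,2) unfolding smooth_manifold_def by auto
  have "topspace (subtopology (mtop M) (fst c)) = fst c"
    using openin_subset[OF o] by auto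
  then have "inj_on (snd c) (fst c)"
    using homeomorphic_imp_injective_map[OF h] by simp
  then show ?thesis using assms(3) by (simp add: chart_inv_def)
qed

lemma snd_chart_inv:
  assumes "y \<in> chart_image c"
  shows "chart_inv c y \<in> fst c" "snd c (chart_inv c y) = y"
  using assms by (auto simp: chart_inv_def chart_image_def inv_into_into f_inv_into_f)

lemma chart_at:
  assumes "smooth_manifold M" "q \<in> topspace (mtop M)"
  shows "chart_at M q \<in> atlas M" "q \<in> fst (chart_at M q)"
proof -
  have "q \<in> \<Union>(fst ` atlas M)" using assms unfolding smooth_manifold_def by metis
  then have "\<exists>c. c \<in> atlas M \<and> q \<in> fst c" by auto
  from someI_ex[OF this] show "chart_at M q \<in> atlas M" "q \<in> fst (chart_at M q)"
    by (auto simp: chart_at_def)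
qed

lemma open_chart_image:
  "smooth_manifold M \<Longrightarrow> c \<in> atlas M \<Longrightarrow> open (chart_image c)"
  unfolding smooth_manifold_def by blast

lemma chart_overlap_eq:
  assumes "smooth_manifold M" "c \<in> atlas M"
  shows "snd c ` (fst c \<inter> U) = {y \<in> chart_image c. chart_inv c y \<in> U}"
proof
  show "snd c ` (fst c \<inter> U) \<subseteq> {y \<in> chart_image c. chart_inv c y \<in> U}"
    using chart_inv_snd[OF assms(1,2)] by (auto simp: chart_image_def)
  show "{y \<in> chart_image c. chart_inv c y \<in> U} \<subseteq> snd c ` (fst c \<inter> U)"
  proof
    fix y assume "y \<in> {y \<in> chart_image c. chart_inv c y \<in> U}"
    then have "chart_inv c y \<in> fst c \<inter> U" "y = snd c (chart_inv c y)"
      using snd_chart_inv[of y c] by auto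
    then show "y \<in> snd c ` (fst c \<inter> U)" by (rule image_eqI[rotated])
  qed
qed

lemma open_chart_image_of_open:
  assumes "smooth_manifold M" "c \<in> atlas M" "openin (mtop M) U"
  shows "open {y \<in> chart_image c. chart_inv c y \<in> U}"
proof -
  have h: "homeomorphic_map (subtopology (mtop M) (fst c)) (top_of_set (chart_image c)) (snd c)"
    and o: "openin (mtop M) (fst c)" and oc: "open (chart_image c)"
    using assms(1,2) unfolding smooth_manifold_def by auto
  have "openin (subtopology (mtop M) (fst c)) (fst c \<inter> U)"
    using assms(3) o by (auto simp: openin_subtopology_Int2 openin_open_subtopology openin_Int)
  then have "openin (top_of_set (chart_image c)) (snd c ` (fst c \<inter> U))"
    using homeomorphic_imp_open_map[OF h] by (auto simp: open_map_def)
  then have "open (snd c ` (fst c \<inter> U))"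
    using oc openin_open_trans by blast
  then show ?thesis by (simp add: chart_overlap_eq[OF assms(1,2)])
qed

lemma smooth_on_differentiable:
  assumes "smooth_on S f" "x \<in> S"
  shows "f differentiable (at x)"
proof -
  have "Ck_on (Suc 0) S f" using assms(1) unfolding smooth_on_def by blast
  with assms(2) show ?thesis by simp
qed

lemma coord_smooth_on_C1: "coord_smooth_on V f \<Longrightarrow> coord_Ck_on k V f"
  unfolding coord_smooth_on_def by blast

lemma coord_smooth_on_continuous: "coord_smooth_on V f \<Longrightarrow> continuous_on V f"
  using coord_Ck_on_continuous[OF coord_smooth_on_C1] .

lemma coord_smooth_on_coord_deriv: "coord_smooth_on V f \<Longrightarrow> coord_smooth_on V (coord_deriv i f)"
  unfolding coord_smooth_on_def using coord_Ck_on.simps(2) by blast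

text \<open>
\<open>f\<close> is a smooth function on the open set \<open>V\<close> that represents \<open>\<sigma>\<close> in the chart \<open>c\<close> on the part of
the closed simplex inside \<open>V\<close>. That its values stay in the chart image can always be achieved by
shrinking \<open>V\<close> and allows \<open>f\<close> to be composed with maps defined on the chart image.
\<close>

definition local_rep :: "nat \<Rightarrow> ('a, 'e::real_inner) manifold \<Rightarrow> ((nat \<Rightarrow> real) \<Rightarrow> 'a) \<Rightarrow> ('a, 'e) chart
    \<Rightarrow> (nat \<Rightarrow> real) set \<Rightarrow> ((nat \<Rightarrow> real) \<Rightarrow> 'e) \<Rightarrow> bool" where
  "local_rep p M \<sigma> c V f \<longleftrightarrow> c \<in> atlas M \<and> open V \<and> coord_smooth_on V f \<and> f ` V \<subseteq> chart_image c \<and>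
     (\<forall>s\<in>V \<inter> standard_simplex p. \<sigma> s \<in> fst c \<and> snd c (\<sigma> s) = f s)"

lemma local_repD:
  assumes "local_rep p M \<sigma> c V f"
  shows "c \<in> atlas M" "open V" "coord_smooth_on V f" "coord_Ck_on k V f"
    and "x \<in> V \<Longrightarrow> f x \<in> chart_image c"
    and "x \<in> V \<Longrightarrow> x \<in> standard_simplex p \<Longrightarrow> \<sigma> x \<in> fst c"
    and "x \<in> V \<Longrightarrow> x \<in> standard_simplex p \<Longrightarrow> snd c (\<sigma> x) = f x"
  using assms unfolding local_rep_def by (auto simp: coord_smooth_on_C1)

lemma open_preimage_rep:
  assumes "open V" "coord_smooth_on V f" "open U"
  shows "open {y \<in> V. f y \<in> U}"
  using continuous_open_preimage[OF coord_smooth_on_continuous[OF assms(2)] assms(1,3)]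
  by (simp add: vimage_def Int_def)

lemma coord_smooth_on_subset: "coord_smooth_on V f \<Longrightarrow> W \<subseteq> V \<Longrightarrow> coord_smooth_on W f"
  unfolding coord_smooth_on_def using coord_Ck_on_subset by blast

lemma local_rep_exists:
  assumes M: "smooth_manifold M" and \<sigma>: "smooth_simplex p M \<sigma>"
    and t: "t \<in> standard_simplex p" "c \<in> atlas M" "\<sigma> t \<in> fst c"
  obtains V f where "t \<in> V" "local_rep p M \<sigma> c V f"
proof -
  obtain V f where V: "open V" "t \<in> V" "coord_smooth_on V f"
     "\<forall>s \<in> V \<inter> standard_simplex p. \<sigma> s \<in> fst c \<and> snd c (\<sigma> s) = f s"
    using \<sigma> t unfolding smooth_simplex_def by blast
  define W where "W = {y \<in> V. f y \<in> chart_image c}"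
  have "open W"
    unfolding W_def by (rule open_preimage_rep[OF V(1,3) open_chart_image[OF M t(2)]])
  moreover have "f t = snd c (\<sigma> t)" using V(2,4) t(1) by auto
  then have "t \<in> W" using V(2) t(3) by (auto simp: W_def chart_image_def)
  moreover have "coord_smooth_on W f" by (rule coord_smooth_on_subset[OF V(3)]) (auto simp: W_def)
  ultimately have "local_rep p M \<sigma> c W f"
    using V(4) t(2) by (auto simp: local_rep_def W_def)
  with \<open>t \<in> W\<close> that show ?thesis by blast
qed

lemma smooth_simplex_topspace:
  "smooth_simplex p M \<sigma> \<Longrightarrow> t \<in> standard_simplex p \<Longrightarrow> \<sigma> t \<in> topspace (mtop M)"
  unfolding smooth_simplex_def singular_simplex_def continuous_map_def by auto

lemma local_rep_compose:
  fixes M :: "('a, 'e::real_inner) manifold" and N :: "('b, 'f::real_inner) manifold"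
  assumes fin: "\<exists>B. finite B \<and> span B = (UNIV :: 'e set)" and rep: "local_rep p M \<sigma> c V f"
    and g: "open U" "smooth_on U g" "g ` U \<subseteq> chart_image d" and d: "d \<in> atlas N"
    and \<tau>: "\<And>s. s \<in> standard_simplex p \<Longrightarrow> s \<in> V \<Longrightarrow> f s \<in> U \<Longrightarrow> \<tau> s \<in> fst d \<and> snd d (\<tau> s) = g (f s)"
  shows "local_rep p N \<tau> d {y \<in> V. f y \<in> U} (\<lambda>y. g (f y))"
proof -
  have V: "open V" "coord_smooth_on V f" using rep by (auto simp: local_rep_def)
  have W: "open {y \<in> V. f y \<in> U}" by (rule open_preimage_rep[OF V g(1)])
  have "coord_smooth_on {y \<in> V. f y \<in> U} (\<lambda>y. g (f y))"
    unfolding coord_smooth_on_def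
  proof
    fix k
    show "coord_Ck_on k {y \<in> V. f y \<in> U} (\<lambda>y. g (f y))"
    proof (rule coord_Ck_on_compose[OF fin W])
      show "coord_Ck_on k {y \<in> V. f y \<in> U} f"
        by (rule coord_Ck_on_subset[OF coord_smooth_on_C1[OF V(2)]]) auto
      show "Ck_on k U g" using g(2) unfolding smooth_on_def by blast
    qed auto
  qed
  then show ?thesis using W g(3) d \<tau> unfolding local_rep_def by auto
qed

lemma local_rep_change_chart:
  assumes M: "smooth_manifold M" and rep: "local_rep p M \<sigma> c V f"
    and c': "c' \<in> atlas M"
  shows "local_rep p M \<sigma> c' {y \<in> V. f y \<in> snd c ` (fst c \<inter> fst c')} (\<lambda>y. chart_trans c c' (f y))"
proof (rule local_rep_compose[OF _ rep _ _ _ c'])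
  have c: "c \<in> atlas M" using rep by (simp add: local_rep_def)
  have o: "openin (mtop M) (fst c')" using M c' unfolding smooth_manifold_def by blast
  show "\<exists>B. finite B \<and> span B = (UNIV :: 'b set)" using M unfolding smooth_manifold_def by blast
  show "open (snd c ` (fst c \<inter> fst c'))"
    unfolding chart_overlap_eq[OF M c] by (rule open_chart_image_of_open[OF M c o])
  show "smooth_on (snd c ` (fst c \<inter> fst c')) (chart_trans c c')"
    using M c c' unfolding smooth_manifold_def by blast
  show "chart_trans c c' ` (snd c ` (fst c \<inter> fst c')) \<subseteq> chart_image c'"
    using chart_inv_snd[OF M c] by (auto simp: chart_trans_def chart_image_def)
  show "\<sigma> s \<in> fst c' \<and> snd c' (\<sigma> s) = chart_trans c c' (f s)"
    if "s \<in> standard_simplex p" "s \<in> V" "f s \<in> snd c ` (fst c \<inter> fst c')" for s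
  proof -
    have s: "\<sigma> s \<in> fst c" "snd c (\<sigma> s) = f s" using rep that(1,2) by (auto simp: local_rep_def)
    then have "chart_inv c (f s) = \<sigma> s" using chart_inv_snd[OF M c s(1)] by simp
    with that(3) show ?thesis
      unfolding chart_overlap_eq[OF M c] by (simp add: chart_trans_def)
  qed
qed

lemma smooth_map_coordinate_rep:
  assumes M: "smooth_manifold M" and F: "smooth_map M N F" and c: "c \<in> atlas M" and d: "d \<in> atlas N"
    and N: "smooth_manifold N"
  shows "open {y \<in> chart_image c. F (chart_inv c y) \<in> fst d}"
    and "smooth_on {y \<in> chart_image c. F (chart_inv c y) \<in> fst d} (snd d \<circ> F \<circ> chart_inv c)"
proof -
  have od: "openin (mtop N) (fst d)" using N d unfolding smooth_manifold_def by blast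
  have "openin (mtop M) {q \<in> topspace (mtop M). F q \<in> fst d}"
    using F od unfolding smooth_map_def continuous_map_def by blast
  from open_chart_image_of_open[OF M c this]
  have "open {y \<in> chart_image c. chart_inv c y \<in> {q \<in> topspace (mtop M). F q \<in> fst d}}" .
  moreover have "fst c \<subseteq> topspace (mtop M)" using M c unfolding smooth_manifold_def by auto
  then have "{y \<in> chart_image c. chart_inv c y \<in> {q \<in> topspace (mtop M). F q \<in> fst d}} =
      {y \<in> chart_image c. F (chart_inv c y) \<in> fst d}"
    by (intro Collect_cong) (auto dest: snd_chart_inv(1))
  ultimately show "open {y \<in> chart_image c. F (chart_inv c y) \<in> fst d}" by simp
  show "smooth_on {y \<in> chart_image c. F (chart_inv c y) \<in> fst d} (snd d \<circ> F \<circ> chart_inv c)"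
    using F c d unfolding smooth_map_def by blast
qed

lemma local_rep_simplex_map:
  assumes M: "smooth_manifold M" and N: "smooth_manifold N" and F: "smooth_map M N F"
    and rep: "local_rep p M \<sigma> c V f" and d: "d \<in> atlas N"
  shows "local_rep p N (simplex_map p F \<sigma>) d {y \<in> V. f y \<in> {y \<in> chart_image c. F (chart_inv c y) \<in> fst d}}
     (\<lambda>y. (snd d \<circ> F \<circ> chart_inv c) (f y))"
proof (rule local_rep_compose[OF _ rep _ _ _ d])
  have c: "c \<in> atlas M" using rep by (simp add: local_rep_def)
  show "\<exists>B. finite B \<and> span B = (UNIV :: 'b set)" using M unfolding smooth_manifold_def by blast
  show "open {y \<in> chart_image c. F (chart_inv c y) \<in> fst d}"
    "smooth_on {y \<in> chart_image c. F (chart_inv c y) \<in> fst d} (snd d \<circ> F \<circ> chart_inv c)"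
    by (rule smooth_map_coordinate_rep[OF M F c d N])+
  show "(snd d \<circ> F \<circ> chart_inv c) ` {y \<in> chart_image c. F (chart_inv c y) \<in> fst d} \<subseteq> chart_image d"
    by (auto simp: chart_image_def)
  show "simplex_map p F \<sigma> s \<in> fst d \<and> snd d (simplex_map p F \<sigma> s) = (snd d \<circ> F \<circ> chart_inv c) (f s)"
    if "s \<in> standard_simplex p" "s \<in> V" "f s \<in> {y \<in> chart_image c. F (chart_inv c y) \<in> fst d}" for s
  proof -
    have s: "\<sigma> s \<in> fst c" "snd c (\<sigma> s) = f s" using rep that(1,2) by (auto simp: local_rep_def)
    then have "chart_inv c (f s) = \<sigma> s" using chart_inv_snd[OF M c s(1)] by simp
    with that(1,3) show ?thesis by (simp add: simplex_map_def)
  qed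
qed

lemma smooth_simplexI:
  assumes "singular_simplex p (mtop M) \<sigma>"
    and "\<And>t c. t \<in> standard_simplex p \<Longrightarrow> c \<in> atlas M \<Longrightarrow> \<sigma> t \<in> fst c \<Longrightarrow> \<exists>V f. t \<in> V \<and> local_rep p M \<sigma> c V f"
  shows "smooth_simplex p M \<sigma>"
  unfolding smooth_simplex_def
proof (intro conjI ballI impI assms(1))
  fix t c assume "t \<in> standard_simplex p" "c \<in> atlas M" "\<sigma> t \<in> fst c"
  then obtain V f where "t \<in> V" "local_rep p M \<sigma> c V f" using assms(2) by blast
  then show "\<exists>V f. open V \<and> t \<in> V \<and> coord_smooth_on V f \<and>
      (\<forall>s \<in> V \<inter> standard_simplex p. \<sigma> s \<in> fst c \<and> snd c (\<sigma> s) = f s)"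
    unfolding local_rep_def by (intro exI[of _ V] exI[of _ f]) simp
qed

lemma smooth_simplex_simplex_map:
  assumes M: "smooth_manifold M" and N: "smooth_manifold N" and F: "smooth_map M N F"
    and \<sigma>: "smooth_simplex p M \<sigma>"
  shows "smooth_simplex p N (simplex_map p F \<sigma>)"
proof (rule smooth_simplexI)
  show "singular_simplex p (mtop N) (simplex_map p F \<sigma>)"
    using \<sigma> F unfolding smooth_simplex_def smooth_map_def by (blast intro: singular_simplex_simplex_map)
  fix t d assume t: "t \<in> standard_simplex p" and d: "d \<in> atlas N" "simplex_map p F \<sigma> t \<in> fst d"
  let ?c = "chart_at M (\<sigma> t)"
  have c: "?c \<in> atlas M" "\<sigma> t \<in> fst ?c"
    using chart_at[OF M smooth_simplex_topspace[OF \<sigma> t]] by auto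
  obtain V f where V: "t \<in> V" "local_rep p M \<sigma> ?c V f"
    using local_rep_exists[OF M \<sigma> t c] .
  have "f t = snd ?c (\<sigma> t)" using V t by (auto simp: local_rep_def)
  then have "f t \<in> {y \<in> chart_image ?c. F (chart_inv ?c y) \<in> fst d}"
    using d(2) t c(2) chart_inv_snd[OF M c] by (auto simp: simplex_map_def chart_image_def)
  with V(1) have "t \<in> {y \<in> V. f y \<in> {y \<in> chart_image ?c. F (chart_inv ?c y) \<in> fst d}}" by simp
  from conjI[OF this local_rep_simplex_map[OF M N F V(2) d(1)]]
  show "\<exists>V f. t \<in> V \<and> local_rep p N (simplex_map p F \<sigma>) d V f"
    by (intro exI)
qed

lemma local_rep_singular_face:
  assumes rep: "local_rep (Suc q) M \<sigma> c V f" and k: "k \<le> Suc q"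
  shows "local_rep q M (singular_face (Suc q) k \<sigma>) c (simplical_face k -` V) (\<lambda>y. f (simplical_face k y))"
proof -
  have V: "open V" "coord_smooth_on V f" using rep by (auto simp: local_rep_def)
  have "coord_smooth_on (simplical_face k -` V) (\<lambda>y. f (simplical_face k y))"
    unfolding coord_smooth_on_def using coord_Ck_on_simplical_face[OF V(1) coord_smooth_on_C1[OF V(2)]] by blast
  moreover have "simplical_face k s \<in> standard_simplex (Suc q)" if "s \<in> standard_simplex q" for s
    using simplical_face_in_standard_simplex[of "Suc q" k s] k that by simp
  ultimately show ?thesis
    using rep open_simplical_face_vimage[OF V(1)] by (auto simp: local_rep_def singular_face_def)
qed

lemma smooth_simplex_singular_face:
  assumes M: "smooth_manifold M" and \<sigma>: "smooth_simplex (Suc q) M \<sigma>" and k: "k \<le> Suc q"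
  shows "smooth_simplex q M (singular_face (Suc q) k \<sigma>)"
proof (rule smooth_simplexI)
  show "singular_simplex q (mtop M) (singular_face (Suc q) k \<sigma>)"
    using singular_simplex_singular_face[of "Suc q" "mtop M" \<sigma> k] \<sigma> k by (simp add: smooth_simplex_def)
  fix t c assume t: "t \<in> standard_simplex q" and c: "c \<in> atlas M" "singular_face (Suc q) k \<sigma> t \<in> fst c"
  have ft: "simplical_face k t \<in> standard_simplex (Suc q)"
    using simplical_face_in_standard_simplex[of "Suc q" k t] k t by simp
  have "\<sigma> (simplical_face k t) \<in> fst c" using c(2) t by (simp add: singular_face_def)
  then obtain V f where V: "simplical_face k t \<in> V" "local_rep (Suc q) M \<sigma> c V f"
    by (rule local_rep_exists[OF M \<sigma> ft c(1)])
  from V(1) have "t \<in> simplical_face k -` V" by simp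
  from conjI[OF this local_rep_singular_face[OF V(2) k]]
  show "\<exists>V f. t \<in> V \<and> local_rep q M (singular_face (Suc q) k \<sigma>) c V f"
    by (intro exI)
qed

text \<open>
The derivative of \<open>f\<close> in the direction \<open>e\<^sub>i - e\<^sub>j\<close>, which is tangent to the simplex, for \<open>d = (i, j)\<close>.
\<close>

definition tangent :: "((nat \<Rightarrow> real) \<Rightarrow> 'e::real_normed_vector) \<Rightarrow> (nat \<Rightarrow> real) \<Rightarrow> nat \<times> nat \<Rightarrow> 'e" where
  "tangent f x d = coord_deriv (fst d) f x - coord_deriv (snd d) f x"

lemma eventually_in_open_face:
  assumes x: "x \<in> open_face A" and A: "finite A" "i \<in> A" "j \<in> A" "i \<noteq> j"
  shows "\<forall>\<^sub>F s in nhds 0. x(i := x i + s, j := x j - s) \<in> open_face A"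
proof -
  have "0 < x i" "0 < x j" using x A by (auto simp: open_face_def)
  then have "\<forall>\<^sub>F s in nhds (0::real). s \<in> {- x i<..<x j}"
    by (intro eventually_nhds_in_open) auto
  then show ?thesis
  proof eventually_elim
    case (elim s)
    have "sum (x(i := x i + s, j := x j - s)) A = sum x A"
    proof -
      have *: "A = insert i (insert j (A - {i, j}))" using A by auto
      have "sum (x(i := x i + s, j := x j - s)) (A - {i, j}) = sum x (A - {i, j})"
        by (rule sum.cong) auto
      then show ?thesis using A by (subst (1 2) *) simp
    qed
    then show ?case using x elim A by (auto simp: open_face_def)
  qed
qed

lemma eventually_curve_in_simplex:
  assumes "x \<in> open_face {..p}" "open V" "x \<in> V" "i \<le> p" "j \<le> p" "i \<noteq> j"
  shows "\<forall>\<^sub>F r in nhds 0. x(i := x i + r, j := x j - r) \<in> open_face {..p} \<inter> V"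
proof -
  have "\<forall>\<^sub>F r in nhds 0. x(i := x i + r, j := x j - r) \<in> open_face {..p}"
    using eventually_in_open_face[OF assms(1) _ _ _ assms(6)] assms by simp
  moreover have "\<forall>\<^sub>F r in nhds 0. x(i := x i + r, j := x j - r) \<in> V"
  proof (rule eventually_curve_in_open[OF assms(2)])
    have "continuous_on UNIV (\<lambda>r. x(i := fst (x i + r, x j - r), j := snd (x i + r, x j - r)))"
      by (rule continuous_on_compose2[OF continuous_on_fun_upd2[of UNIV]]) (auto intro!: continuous_intros)
    then show "isCont (\<lambda>r. x(i := x i + r, j := x j - r)) 0" by (simp add: continuous_on_eq_continuous_at)
  qed (use assms(3) in simp)
  ultimately show ?thesis by eventually_elim simp
qed

text \<open>
In the interior of the simplex the motion in a tangent direction stays inside the simplex for a short time,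
where \<open>g\<close> vanishes. A boundary point is the limit of interior points on the segment to the barycentre, and the
tangential derivative is continuous.
\<close>

lemma tangent_0_on_simplex:
  fixes g :: "(nat \<Rightarrow> real) \<Rightarrow> 'e::real_normed_vector"
  assumes V: "open V" "x \<in> V" "x \<in> standard_simplex p" and g: "coord_Ck_on (Suc 0) V g"
    and zero: "\<And>y. y \<in> V \<Longrightarrow> y \<in> standard_simplex p \<Longrightarrow> g y = 0"
    and ij: "i \<le> p" "j \<le> p"
  shows "tangent g x (i, j) = 0"
proof (cases "i = j")
  case False
  \<comment> \<open>first the interior points, around which \<open>g\<close> vanishes in the direction of motion\<close>
  have interior: "tangent g y (i, j) = 0" if y: "y \<in> V" "y \<in> open_face {..p}" for y
  proof -
    have "\<forall>\<^sub>F s in nhds 0. y(i := y i + s, j := y j - s) \<in> open_face {..p} \<inter> V"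
      by (rule eventually_curve_in_simplex[OF y(2) V(1) y(1) ij False])
    then have "\<forall>\<^sub>F s in nhds 0. g (y(i := y i + s, j := y j - s)) = 0"
      by eventually_elim (use zero open_face_in_standard_simplex in blast)
    with has_vector_derivative_two_coords[OF V(1) y(1) g False]
    have "((\<lambda>s. 0) has_vector_derivative tangent g y (i, j)) (at (0::real))"
      by (auto simp: tangent_def intro: has_vector_derivative_cong_nhds)
    then show ?thesis
      using has_vector_derivative_const vector_derivative_unique_at by blast
  qed
  define b where "b = (\<lambda>l. if l \<le> p then 1 / real (Suc p) else 0)"
  have b: "b \<in> open_face {..p}" by (auto simp: b_def open_face_def)
  \<comment> \<open>the segment from \<open>x\<close> to the barycentre \<open>b\<close>, which is in the open face for \<open>0 < e < 1\<close>\<close>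
  define \<gamma> where "\<gamma> = (\<lambda>e. \<lambda>l. (1 - e) * x l + e * b l)"
  have c\<gamma>: "continuous_on UNIV \<gamma>"
    unfolding \<gamma>_def by (rule continuous_on_coordinatewise_then_product) (intro continuous_intros)
  have \<gamma>0: "\<gamma> 0 = x" by (simp add: \<gamma>_def)
  have \<gamma>V: "\<forall>\<^sub>F e in nhds 0. \<gamma> e \<in> V"
    by (rule eventually_curve_in_open[OF V(1)]) (use c\<gamma> V(2) \<gamma>0 in \<open>auto simp: continuous_on_eq_continuous_at\<close>)
  have \<gamma>o: "\<gamma> e \<in> open_face {..p}" if "0 < e" "e < 1" for e
  proof -
    have "0 < \<gamma> e l" if "l \<le> p" for l
      using b V(3) \<open>0 < e\<close> \<open>e < 1\<close> that unfolding \<gamma>_def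
      by (intro add_nonneg_pos mult_nonneg_nonneg mult_pos_pos) (auto simp: open_face_def standard_simplex_def)
    moreover have "sum (\<gamma> e) {..p} = 1"
      using b V(3) by (simp add: \<gamma>_def sum.distrib sum_distrib_left[symmetric] open_face_def standard_simplex_def)
    moreover have "\<gamma> e l = 0" if "\<not> l \<le> p" for l
      using b V(3) that by (simp add: \<gamma>_def open_face_def standard_simplex_def)
    ultimately show ?thesis by (auto simp: open_face_def)
  qed
  have ct: "continuous_on V (\<lambda>y. tangent g y (i, j))"
    using g by (auto simp: tangent_def intro!: continuous_intros)
  then have "isCont (\<lambda>y. tangent g y (i, j)) (\<gamma> 0)"
    using V \<gamma>0 by (simp add: continuous_on_eq_continuous_at)
  moreover have "isCont \<gamma> 0"
    using c\<gamma> by (simp add: continuous_on_eq_continuous_at)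
  ultimately have "isCont (\<lambda>e. tangent g (\<gamma> e) (i, j)) 0"
    by (rule isCont_o2[rotated])
  then have "((\<lambda>e. tangent g (\<gamma> e) (i, j)) \<longlongrightarrow> tangent g x (i, j)) (at_right 0)"
    using \<gamma>0 by (simp add: isCont_def filterlim_at_split)
  moreover have "\<forall>\<^sub>F e in at_right 0. tangent g (\<gamma> e) (i, j) = 0"
  proof -
    have "\<forall>\<^sub>F e in at_right 0. \<gamma> e \<in> V"
      using \<gamma>V by (simp add: eventually_nhds_conv_at eventually_at_split)
    moreover have "\<forall>\<^sub>F e in at_right 0. e \<in> {0<..<1::real}"
      by (rule eventually_at_right_real) simp
    ultimately show ?thesis
      by eventually_elim (use interior \<gamma>o in auto)
  qed
  then have "((\<lambda>e. tangent g (\<gamma> e) (i, j)) \<longlongrightarrow> 0) (at_right 0)"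
    by (rule tendsto_eventually)
  ultimately show ?thesis
    by (intro tendsto_unique[OF trivial_limit_at_right_real])
qed (simp add: tangent_def)

lemma tangent_diff:
  assumes "coord_Ck_on (Suc 0) V f" "coord_Ck_on (Suc 0) V g" "x \<in> V"
  shows "tangent (\<lambda>y. f y - g y) x d = tangent f x d - tangent g x d"
proof -
  have "coord_deriv i (\<lambda>y. f y - g y) x = coord_deriv i f x - coord_deriv i g x" for i
    by (rule coord_derivI) (intro has_vector_derivative_diff has_coord_deriv[OF assms(1,3)] has_coord_deriv[OF assms(2,3)])
  then show ?thesis by (simp add: tangent_def)
qed

lemma tangent_unique:
  fixes f g :: "(nat \<Rightarrow> real) \<Rightarrow> 'e::real_normed_vector"
  assumes V: "open V" "x \<in> V" and W: "open W" "x \<in> W" and x: "x \<in> standard_simplex p"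
    and f: "coord_Ck_on (Suc 0) V f" and g: "coord_Ck_on (Suc 0) W g"
    and eq: "\<And>y. y \<in> V \<Longrightarrow> y \<in> W \<Longrightarrow> y \<in> standard_simplex p \<Longrightarrow> f y = g y"
    and d: "fst d \<le> p" "snd d \<le> p"
  shows "tangent f x d = tangent g x d"
proof -
  have VW: "open (V \<inter> W)" "x \<in> V \<inter> W" using V W by auto
  have f': "coord_Ck_on (Suc 0) (V \<inter> W) f" and g': "coord_Ck_on (Suc 0) (V \<inter> W) g"
    by (rule coord_Ck_on_subset[OF f Int_lower1], rule coord_Ck_on_subset[OF g Int_lower2])
  have "tangent (\<lambda>y. f y - g y) x (fst d, snd d) = 0"
    by (rule tangent_0_on_simplex[OF VW x coord_Ck_on_minus[OF VW(1) f' g']]) (use eq d in auto)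
  then show ?thesis using tangent_diff[OF f' g' VW(2), of d] by simp
qed

lemma tangent_compose:
  assumes "coord_Ck_on (Suc 0) V f" "x \<in> V" "g differentiable (at (f x))"
  shows "tangent (\<lambda>y. g (f y)) x d = frechet_derivative g (at (f x)) (tangent f x d)"
proof -
  have "coord_deriv i (\<lambda>y. g (f y)) x = frechet_derivative g (at (f x)) (coord_deriv i f x)" for i
    by (rule coord_derivI[OF has_coord_deriv_compose[OF has_coord_deriv[OF assms(1,2)] assms(3)]])
  then show ?thesis
    using linear_diff[OF linear_frechet_derivative[OF assms(3)]] by (simp add: tangent_def)
qed

text \<open>
The pullback of \<open>\<omega>\<close> along \<open>\<sigma>\<close> at a point \<open>x\<close> of the closed simplex, evaluated on the tangent
directions \<open>ds\<close>.
\<close>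

definition simplex_form :: "nat \<Rightarrow> ('a, 'e::real_inner) manifold \<Rightarrow> ('a, 'e) form \<Rightarrow> ((nat \<Rightarrow> real) \<Rightarrow> 'a)
    \<Rightarrow> (nat \<times> nat) list \<Rightarrow> (nat \<Rightarrow> real) \<Rightarrow> real" where
  "simplex_form p M \<omega> \<sigma> ds x = (let c = chart_at M (\<sigma> x); f = SOME f. \<exists>V. x \<in> V \<and> local_rep p M \<sigma> c V f
     in \<omega> c (f x) (map (tangent f x) ds))"

lemma forms_transition:
  assumes "\<omega> \<in> forms k M" "c \<in> atlas M" "c' \<in> atlas M" "x \<in> snd c ` (fst c \<inter> fst c')" "length v = k"
  shows "\<omega> c x v = \<omega> c' (chart_trans c c' x) (map (frechet_derivative (chart_trans c c') (at x)) v)"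
proof -
  have "\<forall>c\<in>atlas M. \<forall>c'\<in>atlas M. \<forall>x \<in> snd c ` (fst c \<inter> fst c'). \<forall>v. length v = k \<longrightarrow>
        \<omega> c x v = \<omega> c' (chart_trans c c' x) (map (frechet_derivative (chart_trans c c') (at x)) v)"
    using assms(1) unfolding forms_def mem_Collect_eq by (elim conjE)
  from this[rule_format, OF assms(2-5)] show ?thesis .
qed

lemma forms_alternating:
  "\<omega> \<in> forms k M \<Longrightarrow> c \<in> atlas M \<Longrightarrow> x \<in> chart_image c \<Longrightarrow> alternating_multilinear k (\<omega> c x)"
  unfolding forms_def by simp

lemma forms_smooth:
  "\<omega> \<in> forms k M \<Longrightarrow> c \<in> atlas M \<Longrightarrow> length v = k \<Longrightarrow> smooth_on (chart_image c) (\<lambda>x. \<omega> c x v)"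
  unfolding forms_def by simp

text \<open>
The value does not depend on the choices in the definition: two representatives in the same chart have the
same tangential derivatives, and a change of the chart acts on them by the derivative of the transition
map, as it does on the form.
\<close>

lemma simplex_form_eq:
  assumes M: "smooth_manifold M" and \<sigma>: "smooth_simplex p M \<sigma>" and \<omega>: "\<omega> \<in> forms k M"
    and rep: "local_rep p M \<sigma> c V f" and x: "x \<in> V" "x \<in> standard_simplex p"
    and ds: "length ds = k" "\<And>d. d \<in> set ds \<Longrightarrow> fst d \<le> p \<and> snd d \<le> p"
  shows "simplex_form p M \<omega> \<sigma> ds x = \<omega> c (f x) (map (tangent f x) ds)"
proof -
  define c' where "c' = chart_at M (\<sigma> x)"
  define f' where "f' = (SOME f. \<exists>V. x \<in> V \<and> local_rep p M \<sigma> c' V f)"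
  have c': "c' \<in> atlas M" "\<sigma> x \<in> fst c'"
    unfolding c'_def using chart_at[OF M smooth_simplex_topspace[OF \<sigma> x(2)]] by auto
  obtain V0 f0 where V0: "x \<in> V0" "local_rep p M \<sigma> c' V0 f0"
    by (rule local_rep_exists[OF M \<sigma> x(2) c'])
  then have "\<exists>f V. x \<in> V \<and> local_rep p M \<sigma> c' V f"
    by (intro exI conjI V0)
  from someI_ex[OF this] obtain V' where V': "x \<in> V'" "local_rep p M \<sigma> c' V' f'"
    unfolding f'_def by blast
  have c: "c \<in> atlas M" using rep by (simp add: local_rep_def)
  have sx: "\<sigma> x \<in> fst c" "f x = snd c (\<sigma> x)" using rep x by (auto simp: local_rep_def)
  let ?h = "chart_trans c c'" and ?U = "snd c ` (fst c \<inter> fst c')"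
  let ?W = "{y \<in> V. f y \<in> ?U}"
  have fxU: "f x \<in> ?U" using sx c'(2) by auto
  have rep': "local_rep p M \<sigma> c' ?W (\<lambda>y. ?h (f y))"
    by (rule local_rep_change_chart[OF M rep c'(1)])
  have xW: "x \<in> ?W" using x(1) fxU by simp
  have "?h (f x) = f' x"
    using local_repD(7)[OF rep' xW x(2)] local_repD(7)[OF V'(2,1) x(2)] by simp
  moreover have "tangent f' x d = frechet_derivative ?h (at (f x)) (tangent f x d)" if "d \<in> set ds" for d
  proof -
    have "tangent f' x d = tangent (\<lambda>y. ?h (f y)) x d"
    proof (rule tangent_unique)
      show "f' y = ?h (f y)" if "y \<in> V'" "y \<in> ?W" "y \<in> standard_simplex p" for y
      proof -
        show ?thesis using local_repD(7)[OF rep' that(2,3)] local_repD(7)[OF V'(2) that(1,3)] by simp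
      qed
      show "coord_Ck_on (Suc 0) V' f'" "open V'" by (rule local_repD[OF V'(2)])+
      show "coord_Ck_on (Suc 0) ?W (\<lambda>y. ?h (f y))" "open ?W" by (rule local_repD[OF rep'])+
      show "fst d \<le> p" "snd d \<le> p" using ds(2)[OF that] by auto
    qed (rule V'(1) xW x(2))+
    also have "\<dots> = frechet_derivative ?h (at (f x)) (tangent f x d)"
    proof (rule tangent_compose)
      show "coord_Ck_on (Suc 0) V f" by (rule local_repD[OF rep])
      have "smooth_on ?U ?h" using M c c'(1) unfolding smooth_manifold_def by blast
      then show "?h differentiable (at (f x))" using fxU by (rule smooth_on_differentiable)
    qed (rule x(1))
    finally show ?thesis .
  qed
  then have "map (tangent f' x) ds = map (frechet_derivative ?h (at (f x))) (map (tangent f x) ds)"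
    unfolding map_map by (intro map_cong refl) simp
  moreover have "\<omega> c (f x) (map (tangent f x) ds) =
      \<omega> c' (?h (f x)) (map (frechet_derivative ?h (at (f x))) (map (tangent f x) ds))"
    by (rule forms_transition[OF \<omega> c c'(1) fxU]) (simp add: ds(1))
  ultimately show ?thesis
    unfolding simplex_form_def Let_def c'_def[symmetric] f'_def[symmetric] by (simp only:)
qed

lemma simplex_form_singular_face:
  assumes M: "smooth_manifold M" and \<sigma>: "smooth_simplex (Suc q) M \<sigma>" and \<omega>: "\<omega> \<in> forms k M"
    and l: "l \<le> Suc q" and x: "x \<in> standard_simplex q"
    and ds: "length ds = k" "\<And>d. d \<in> set ds \<Longrightarrow> fst d \<le> q \<and> snd d \<le> q"
  shows "simplex_form q M \<omega> (singular_face (Suc q) l \<sigma>) ds x =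
    simplex_form (Suc q) M \<omega> \<sigma> (map (map_prod (skip l) (skip l)) ds) (simplical_face l x)"
proof -
  have fx: "simplical_face l x \<in> standard_simplex (Suc q)"
    using simplical_face_in_standard_simplex[of "Suc q" l x] l x by simp
  obtain V f where V: "simplical_face l x \<in> V" "local_rep (Suc q) M \<sigma> (chart_at M (\<sigma> (simplical_face l x))) V f"
    using local_rep_exists[OF M \<sigma> fx chart_at[OF M smooth_simplex_topspace[OF \<sigma> fx]]] .
  have f: "coord_Ck_on (Suc 0) V f" by (rule local_repD[OF V(2)])
  have "tangent (\<lambda>y. f (simplical_face l y)) x d = tangent f (simplical_face l x) (map_prod (skip l) (skip l) d)" for d
    by (simp add: tangent_def coord_deriv_simplical_face[OF f V(1)])
  then have m: "map (tangent (\<lambda>y. f (simplical_face l y)) x) ds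
      = map (tangent f (simplical_face l x)) (map (map_prod (skip l) (skip l)) ds)"
    by simp
  have "simplex_form q M \<omega> (singular_face (Suc q) l \<sigma>) ds x
      = \<omega> (chart_at M (\<sigma> (simplical_face l x))) (f (simplical_face l x)) (map (tangent (\<lambda>y. f (simplical_face l y)) x) ds)"
    by (rule simplex_form_eq[OF M smooth_simplex_singular_face[OF M \<sigma> l] \<omega> local_rep_singular_face[OF V(2) l] _ x ds])
      (simp add: V(1))
  also have "\<dots> = simplex_form (Suc q) M \<omega> \<sigma> (map (map_prod (skip l) (skip l)) ds) (simplical_face l x)"
    unfolding m
  proof (rule simplex_form_eq[OF M \<sigma> \<omega> V(2,1) fx, symmetric])
    show "length (map (map_prod (skip l) (skip l)) ds) = k" by (simp add: ds(1))
    show "fst d \<le> Suc q \<and> snd d \<le> Suc q" if "d \<in> set (map (map_prod (skip l) (skip l)) ds)" for d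
    proof -
      from that obtain e where "e \<in> set ds" "d = map_prod (skip l) (skip l) e" by auto
      with ds(2)[of e] show ?thesis by (simp add: skip_def)
    qed
  qed
  finally show ?thesis .
qed

section \<open>Alternating multilinear maps\<close>

lemma alternating_multilinear_linear:
  assumes "alternating_multilinear k A" "length v = k" "i < k"
  shows "linear (\<lambda>u. A (v[i := u]))"
  using assms unfolding alternating_multilinear_def by blast

lemma alternating_multilinear_eq_0:
  assumes "alternating_multilinear k A" "length v = k" "i < k" "j < k" "i \<noteq> j" "v ! i = v ! j"
  shows "A v = 0"
proof (cases "i < j")
  case True
  then show ?thesis using assms unfolding alternating_multilinear_def by blast
next
  case False
  then have "j < i" using assms(5) by simp
  moreover have "v ! j = v ! i" using assms(6) by simp
  ultimately show ?thesis using assms(1,2,3) unfolding alternating_multilinear_def by blast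
qed

lemma alternating_swap_adjacent:
  assumes A: "alternating_multilinear k A" and len: "length (xs @ a # b # ys) = k"
  shows "A (xs @ a # b # ys) = - A (xs @ b # a # ys)"
proof -
  let ?l = "length xs"
  have L1: "A (xs @ (u + u') # w # ys) = A (xs @ u # w # ys) + A (xs @ u' # w # ys)" for u u' w
  proof -
    have "linear (\<lambda>u. A ((xs @ w # w # ys)[?l := u]))"
      by (rule alternating_multilinear_linear[OF A]) (use len in auto)
    from linear_add[OF this, of u u'] show ?thesis by simp
  qed
  have L2: "A (xs @ w # (u + u') # ys) = A (xs @ w # u # ys) + A (xs @ w # u' # ys)" for u u' w
  proof -
    have "linear (\<lambda>u. A ((xs @ w # w # ys)[Suc ?l := u]))"
      by (rule alternating_multilinear_linear[OF A]) (use len in auto)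
    from linear_add[OF this, of u u'] show ?thesis by (simp add: list_update_append)
  qed
  have Z: "A (xs @ u # u # ys) = 0" for u
    by (rule alternating_multilinear_eq_0[OF A, of _ ?l "Suc ?l"]) (use len in \<open>auto simp: nth_append\<close>)
  have "A (xs @ (a + b) # (a + b) # ys) = A (xs @ a # b # ys) + A (xs @ b # a # ys)"
    unfolding L1 L2 Z[of a] Z[of b] by simp
  with Z[of "a + b"] show ?thesis by linarith
qed

text \<open>
Moving an argument past \<open>m\<close> others takes \<open>m\<close> transpositions of neighbours.
\<close>

lemma alternating_move:
  assumes A: "alternating_multilinear k A" and len: "length (xs @ h # ms @ ys) = k"
  shows "A (xs @ ms @ h # ys) = (- 1) ^ length ms * A (xs @ h # ms @ ys)"
  using len
proof (induction ms arbitrary: xs)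
  case (Cons m ms)
  have "A (xs @ (m # ms) @ h # ys) = A ((xs @ [m]) @ ms @ h # ys)" by simp
  also have "\<dots> = (- 1) ^ length ms * A ((xs @ [m]) @ h # ms @ ys)"
    by (rule Cons.IH) (use Cons.prems in simp)
  also have "A ((xs @ [m]) @ h # ms @ ys) = - A (xs @ h # m # ms @ ys)"
    using alternating_swap_adjacent[OF A, of xs m h "ms @ ys"] Cons.prems by simp
  finally show ?case by simp
qed simp

definition slot_lists :: "'e set \<Rightarrow> nat \<Rightarrow> 'e list set" where
  "slot_lists E m = {bs. set bs \<subseteq> E \<and> length bs = m}"

lemma slot_lists_Suc: "slot_lists E (Suc m) = (\<lambda>(bs, b). bs @ [b]) ` (slot_lists E m \<times> E)"
proof
  show "slot_lists E (Suc m) \<subseteq> (\<lambda>(bs, b). bs @ [b]) ` (slot_lists E m \<times> E)"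
  proof
    fix cs assume cs: "cs \<in> slot_lists E (Suc m)"
    then have ne: "cs \<noteq> []" by (auto simp: slot_lists_def)
    then have "butlast cs \<in> slot_lists E m" "last cs \<in> E" "cs = butlast cs @ [last cs]"
      using cs last_in_set[OF ne] in_set_butlastD[of _ cs] by (auto simp: slot_lists_def)
    then show "cs \<in> (\<lambda>(bs, b). bs @ [b]) ` (slot_lists E m \<times> E)"
      by (intro image_eqI[of _ _ "(butlast cs, last cs)"]) auto
  qed
qed (auto simp: slot_lists_def)

lemma sum_slot_lists_Suc:
  fixes G :: "'e list \<Rightarrow> real"
  assumes "finite E"
  shows "(\<Sum>bs\<in>slot_lists E (Suc m). G bs) = (\<Sum>bs\<in>slot_lists E m. \<Sum>b\<in>E. G (bs @ [b]))"
  unfolding slot_lists_Suc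
  by (subst sum.reindex) (auto simp: inj_on_def sum.cartesian_product case_prod_unfold)

text \<open>
The slots are expanded from left to right; after \<open>m\<close> steps the first \<open>m\<close> arguments run through basis
vectors and the others are still those of \<open>v\<close>.
\<close>

lemma multilinear_expansion:
  fixes A :: "'e::real_inner list \<Rightarrow> real"
  assumes E: "finite E" "\<And>x::'e. x = (\<Sum>b\<in>E. (x \<bullet> b) *\<^sub>R b)"
    and A: "alternating_multilinear k A" and len: "length v = k"
  shows "A v = (\<Sum>bs\<in>slot_lists E k. (\<Prod>l<k. v ! l \<bullet> bs ! l) * A bs)"
proof -
  have "A v = (\<Sum>bs\<in>slot_lists E m. (\<Prod>l<m. v ! l \<bullet> bs ! l) * A (bs @ drop m v))" if "m \<le> k" for m
    using that
  proof (induction m)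
    case 0
    have "slot_lists E 0 = {[]}" by (auto simp: slot_lists_def)
    then show ?case by simp
  next
    case (Suc m)
    have "A (bs @ drop m v) = (\<Sum>b\<in>E. (v ! m \<bullet> b) * A (bs @ b # drop (Suc m) v))" if "bs \<in> slot_lists E m" for bs
    proof -
      have lb: "length bs = m" using that by (simp add: slot_lists_def)
      have d: "drop m v = v ! m # drop (Suc m) v" using Suc.prems len by (simp add: Cons_nth_drop_Suc)
      have lin: "linear (\<lambda>u. A ((bs @ drop m v)[m := u]))"
        by (rule alternating_multilinear_linear[OF A]) (use lb len Suc.prems in auto)
      have upd: "(bs @ drop m v)[m := u] = bs @ u # drop (Suc m) v" for u
        using lb d by (simp add: list_update_append)
      have "A (bs @ drop m v) = A ((bs @ drop m v)[m := (\<Sum>b\<in>E. (v ! m \<bullet> b) *\<^sub>R b)])"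
        using E(2)[of "v ! m"] upd d by simp
      also have "\<dots> = (\<Sum>b\<in>E. (v ! m \<bullet> b) * A ((bs @ drop m v)[m := b]))"
        by (simp add: linear_sum[OF lin] linear_scale[OF lin])
      finally show ?thesis unfolding upd .
    qed
    then have "A v = (\<Sum>bs\<in>slot_lists E m. (\<Prod>l<m. v ! l \<bullet> bs ! l) * (\<Sum>b\<in>E. (v ! m \<bullet> b) * A (bs @ b # drop (Suc m) v)))"
      using Suc by simp
    also have "\<dots> = (\<Sum>bs\<in>slot_lists E m. \<Sum>b\<in>E. (\<Prod>l<Suc m. v ! l \<bullet> (bs @ [b]) ! l) * A ((bs @ [b]) @ drop (Suc m) v))"
    proof (rule sum.cong[OF refl])
      fix bs assume "bs \<in> slot_lists E m"
      then have lb: "length bs = m" by (simp add: slot_lists_def)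
      then have "(\<Prod>l<m. v ! l \<bullet> (bs @ [b]) ! l) = (\<Prod>l<m. v ! l \<bullet> bs ! l)" for b
        by (intro prod.cong) (auto simp: nth_append)
      with lb show "(\<Prod>l<m. v ! l \<bullet> bs ! l) * (\<Sum>b\<in>E. (v ! m \<bullet> b) * A (bs @ b # drop (Suc m) v)) =
          (\<Sum>b\<in>E. (\<Prod>l<Suc m. v ! l \<bullet> (bs @ [b]) ! l) * A ((bs @ [b]) @ drop (Suc m) v))"
        using nth_append_length[of bs] by (simp add: sum_distrib_left mult.assoc)
    qed
    finally show ?case by (simp only: sum_slot_lists_Suc[OF E(1)])
  qed
  from this[of k] show ?thesis using len by simp
qed

lemma alternating_subtract_slot:
  assumes A: "alternating_multilinear k A" and len: "length v = k" and lm: "l < k" "m < k" "l \<noteq> m"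
  shows "A (v[l := v ! l - v ! m]) = A v"
proof -
  have lin: "linear (\<lambda>u. A (v[l := u]))" by (rule alternating_multilinear_linear[OF A len lm(1)])
  have "A (v[l := v ! m]) = 0"
    by (rule alternating_multilinear_eq_0[OF A, of _ l m]) (use len lm in auto)
  with linear_diff[OF lin, of "v ! l" "v ! m"] show ?thesis by simp
qed

text \<open>
Replacing the slots \<open>u\<close> by \<open>u - w\<close> one after the other, a step subtracts the value with \<open>w\<close> in that
slot; there, the terms \<open>w\<close> already subtracted from earlier slots may be dropped.
\<close>

lemma alternating_differences:
  assumes A: "alternating_multilinear k A" and len: "length us = k"
  shows "A (map (\<lambda>u. u - w) us) = A us - (\<Sum>l<k. A (us[l := w]))"
proof -
  let ?D = "\<lambda>m. map (\<lambda>u. u - w) (take m us)"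
  have slot: "A (?D m @ w # drop (Suc m) us) = A (us[m := w])" if m: "m < k" for m
  proof -
    have "A (map (\<lambda>u. u - w) (take j us) @ drop j (us[m := w])) = A (us[m := w])" if "j \<le> m" for j
      using that
    proof (induction j)
      case (Suc j)
      let ?v = "map (\<lambda>u. u - w) (take j us) @ drop j (us[m := w])"
      have jk: "j < k" "j < m" using Suc.prems m by auto
      have v: "length ?v = k" "?v ! j = us ! j" "?v ! m = w"
        using jk m len by (auto simp: nth_append)
      have "?v[j := us ! j - w] = map (\<lambda>u. u - w) (take (Suc j) us) @ drop (Suc j) (us[m := w])"
        using jk m len by (auto simp: list_update_append take_Suc_conv_app_nth Cons_nth_drop_Suc[symmetric])
      moreover have "A (?v[j := ?v ! j - ?v ! m]) = A ?v"
        by (rule alternating_subtract_slot[OF A v(1)]) (use jk m in auto)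
      ultimately show ?case using Suc.IH jk v by simp
    qed simp
    from this[of m] m len show ?thesis
      by (simp add: Cons_nth_drop_Suc[symmetric])
  qed
  have "A (?D m @ drop m us) = A us - (\<Sum>l<m. A (us[l := w]))" if "m \<le> k" for m
    using that
  proof (induction m)
    case (Suc m)
    have m: "m < k" using Suc.prems by simp
    have d: "drop m us = us ! m # drop (Suc m) us" using m len by (simp add: Cons_nth_drop_Suc)
    have lin: "linear (\<lambda>u. A ((?D m @ drop m us)[m := u]))"
      by (rule alternating_multilinear_linear[OF A]) (use m len in auto)
    have upd: "(?D m @ drop m us)[m := u] = ?D m @ u # drop (Suc m) us" for u
      using m len d by (simp add: list_update_append)
    have "A (?D (Suc m) @ drop (Suc m) us) = A ((?D m @ drop m us)[m := us ! m - w])"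
      unfolding upd using m len by (simp add: take_Suc_conv_app_nth)
    also have "\<dots> = A (?D m @ drop m us) - A (?D m @ w # drop (Suc m) us)"
      using linear_diff[OF lin, of "us ! m" w] unfolding upd by (simp only: d)
    finally show ?case using Suc.IH m slot[OF m] by simp
  qed simp
  from this[of k] len show ?thesis by simp
qed

text \<open>
This is the coefficient of a form on the face opposite to vertex \<open>0\<close>: the edges of that face starting
at vertex \<open>1\<close> are the differences \<open>u - w\<close> of the edges \<open>w, us\<close> of the whole simplex starting at
vertex \<open>0\<close>, and the terms on the right belong to the remaining faces.
\<close>

lemma alternating_differences_omit:
  assumes A: "alternating_multilinear q A" and len: "length us = q"
  shows "A (map (\<lambda>u. u - w) us) = (\<Sum>i\<le>q. (- 1) ^ i * A (take i (w # us) @ drop (Suc i) (w # us)))"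
proof -
  have "A (us[l := w]) = (- 1) ^ l * A (take (Suc l) (w # us) @ drop (Suc (Suc l)) (w # us))" if "l < q" for l
  proof -
    have "us[l := w] = [] @ take l us @ w # drop (Suc l) us"
      using that len by (simp add: upd_conv_take_nth_drop)
    then show ?thesis
      using alternating_move[OF A, of "[]" w "take l us" "drop (Suc l) us"] that len by simp
  qed
  then have "(\<Sum>l<q. A (us[l := w])) = (\<Sum>l<q. (- 1) ^ l * A (take (Suc l) (w # us) @ drop (Suc (Suc l)) (w # us)))"
    by simp
  moreover have "(\<Sum>i\<le>q. (- 1) ^ i * A (take i (w # us) @ drop (Suc i) (w # us))) =
     A us + (\<Sum>l<q. (- 1) ^ Suc l * A (take (Suc l) (w # us) @ drop (Suc (Suc l)) (w # us)))"
    by (subst sum.atMost_shift) simp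
  ultimately show ?thesis
    using alternating_differences[OF A len, of w] by (simp add: sum_negf)
qed

lemma omit_update:
  assumes "length v = Suc q" "i < j" "j \<le> q"
  shows "(take i v @ drop (Suc i) v)[j - 1 := h] = take i v @ (take (j - Suc i) (drop (Suc i) v)) @ h # drop (Suc j) v"
    and "(take j v @ drop (Suc j) v)[i := h] = take i v @ h # (take (j - Suc i) (drop (Suc i) v)) @ drop (Suc j) v"
  using assms by (auto intro!: nth_equalityI simp: nth_append nth_list_update nth_Cons' min_def)

text \<open>
In the term \<open>(i, l)\<close> the vector \<open>v ! i\<close> is omitted and \<open>v ! j\<close>, with \<open>j = skip i l\<close>, is replaced
by \<open>h i j\<close>. The terms of \<open>(i, j)\<close> and \<open>(j, i)\<close> contain the same vectors in an order that differs by a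
move across \<open>\<bar>i - j\<bar> - 1\<close> positions, whereas the exponents of their signs differ by \<open>\<bar>i - j\<bar>\<close>, so they
cancel.
\<close>

lemma alternating_symmetric_cancel:
  fixes h :: "nat \<Rightarrow> nat \<Rightarrow> 'e::real_vector"
  assumes A: "alternating_multilinear q A" and len: "length v = Suc q"
    and h: "\<And>i j. i \<le> q \<Longrightarrow> j \<le> q \<Longrightarrow> h i j = h j i"
  shows "(\<Sum>i\<le>q. (- 1) ^ i * (\<Sum>l<q. A ((take i v @ drop (Suc i) v)[l := h i (skip i l)]))) = 0"
proof -
  let ?T = "\<lambda>i l. (- 1) ^ i * A ((take i v @ drop (Suc i) v)[l := h i (skip i l)])"
  have cancel: "?T i (j - 1) = - ?T j i" if "i < j" "j \<le> q" for i j
  proof -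
    let ?ms = "take (j - Suc i) (drop (Suc i) v)"
    have lms: "length ?ms = j - Suc i" using that len by simp
    have "A (take i v @ ?ms @ h i j # drop (Suc j) v) = (- 1) ^ (j - Suc i) * A (take i v @ h i j # ?ms @ drop (Suc j) v)"
      using alternating_move[OF A, of "take i v" "h i j" ?ms "drop (Suc j) v"] that len lms by simp
    moreover have "skip i (j - 1) = j" "skip j i = i" using that by (auto simp: skip_def)
    moreover have "h j i = h i j" using h that by auto
    moreover have "(- 1 :: real) ^ i * (- 1) ^ (j - Suc i) = - ((- 1) ^ j)"
      using that by (metis (no_types, lifting) Suc_leI add_Suc le_add_diff_inverse minus_minus mult_minus1 power_Suc power_add)
    ultimately show ?thesis
      using omit_update[OF len that] by (simp flip: mult.assoc)
  qed
  have "(\<Sum>i\<le>q. \<Sum>l<q. ?T i l) = (\<Sum>p\<in>{..q} \<times> {..<q}. ?T (fst p) (snd p))"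
    by (simp add: sum.cartesian_product case_prod_unfold)
  also have "\<dots> = (\<Sum>p\<in>{p \<in> {..q} \<times> {..<q}. fst p \<le> snd p}. ?T (fst p) (snd p)) +
     (\<Sum>p\<in>{p \<in> {..q} \<times> {..<q}. \<not> fst p \<le> snd p}. ?T (fst p) (snd p))"
    by (subst sum.union_disjoint[symmetric]) (auto intro!: sum.cong)
  also have "(\<Sum>p\<in>{p \<in> {..q} \<times> {..<q}. \<not> fst p \<le> snd p}. ?T (fst p) (snd p)) =
     (\<Sum>p\<in>{p \<in> {..q} \<times> {..<q}. fst p \<le> snd p}. ?T (Suc (snd p)) (fst p))"
    by (rule sum.reindex_bij_witness[of _ "\<lambda>p. (Suc (snd p), fst p)" "\<lambda>p. (snd p, fst p - 1)"]) auto
  also have "\<dots> = (\<Sum>p\<in>{p \<in> {..q} \<times> {..<q}. fst p \<le> snd p}. - ?T (fst p) (snd p))"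
  proof (rule sum.cong[OF refl])
    fix p assume "p \<in> {p \<in> {..q} \<times> {..<q}. fst p \<le> snd p}"
    then show "?T (Suc (snd p)) (fst p) = - ?T (fst p) (snd p)"
      using cancel[of "fst p" "Suc (snd p)"] by auto
  qed
  finally have "(\<Sum>i\<le>q. \<Sum>l<q. ?T i l) = 0" by (simp add: sum_negf)
  then show ?thesis by (simp add: sum_distrib_left)
qed

lemma has_vector_derivative_inner_left:
  "(f has_vector_derivative f') (at a) \<Longrightarrow> ((\<lambda>s. f s \<bullet> b) has_real_derivative f' \<bullet> b) (at a)"
  unfolding has_real_derivative_iff_has_vector_derivative
  by (rule bounded_linear.has_vector_derivative[OF bounded_linear_inner_left])

text \<open>
The product rule for a family of multilinear maps: all arguments and the base point of the form move at the same
time. Expansion in an orthonormal basis turns it into the product rule for real functions.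
\<close>

lemma form_along_curve_derivative:
  fixes A :: "'e::real_inner \<Rightarrow> 'e list \<Rightarrow> real" and y :: "real \<Rightarrow> 'e" and v :: "'i \<Rightarrow> real \<Rightarrow> 'e"
  assumes fin: "\<exists>B. finite B \<and> span B = (UNIV :: 'e set)"
    and U: "open U" "y a \<in> U" and A: "\<And>z. z \<in> U \<Longrightarrow> alternating_multilinear k (A z)"
    and dA: "\<And>w. length w = k \<Longrightarrow> (\<lambda>z. A z w) differentiable (at (y a))"
    and y: "(y has_vector_derivative y') (at a)"
    and v: "\<And>i. i \<in> set is \<Longrightarrow> (v i has_vector_derivative v' i) (at a)" and len: "length is = k"
  shows "((\<lambda>s. A (y s) (map (\<lambda>i. v i s) is)) has_real_derivative
     frechet_derivative (\<lambda>z. A z (map (\<lambda>i. v i a) is)) (at (y a)) y' +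
     (\<Sum>l<k. A (y a) ((map (\<lambda>i. v i a) is)[l := v' (is ! l)]))) (at a)"
proof -
  obtain E :: "'e set" where E: "finite E" "\<And>x::'e. x = (\<Sum>b\<in>E. (x \<bullet> b) *\<^sub>R b)"
    using orthonormal_expansion[OF fin] by blast
  let ?v = "\<lambda>s. map (\<lambda>i. v i s) is"
  let ?P = "\<lambda>bs s. \<Prod>l<k. ?v s ! l \<bullet> bs ! l"
  let ?D = "\<lambda>bs. frechet_derivative (\<lambda>z. A z bs) (at (y a))"
  have expand: "A z w = (\<Sum>bs\<in>slot_lists E k. (\<Prod>l<k. w ! l \<bullet> bs ! l) * A z bs)" if "z \<in> U" "length w = k" for z w
    by (rule multilinear_expansion[OF E A[OF that(1)] that(2)])
  have lbs: "length bs = k" if "bs \<in> slot_lists E k" for bs using that by (simp add: slot_lists_def)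
  have dP: "(?P bs has_real_derivative (\<Sum>l<k. (v' (is ! l) \<bullet> bs ! l) * (\<Prod>m\<in>{..<k} - {l}. ?v a ! m \<bullet> bs ! m))) (at a)" for bs
  proof -
    have "((\<lambda>s. ?v s ! l \<bullet> bs ! l) has_derivative (\<lambda>t. t * (v' (is ! l) \<bullet> bs ! l))) (at a)" if "l < k" for l
    proof -
      have "((\<lambda>s. v (is ! l) s \<bullet> bs ! l) has_real_derivative v' (is ! l) \<bullet> bs ! l) (at a)"
        using v[of "is ! l"] that len by (intro has_vector_derivative_inner_left) auto
      then show ?thesis using that len by (simp add: has_field_derivative_def mult_commute_abs)
    qed
    then have "(?P bs has_derivative (\<lambda>t. \<Sum>l<k. (t * (v' (is ! l) \<bullet> bs ! l)) * (\<Prod>m\<in>{..<k} - {l}. ?v a ! m \<bullet> bs ! m))) (at a)"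
      by (intro has_derivative_prod) auto
    moreover have "(\<lambda>t. \<Sum>l<k. (t * (v' (is ! l) \<bullet> bs ! l)) * (\<Prod>m\<in>{..<k} - {l}. ?v a ! m \<bullet> bs ! m)) =
        times (\<Sum>l<k. (v' (is ! l) \<bullet> bs ! l) * (\<Prod>m\<in>{..<k} - {l}. ?v a ! m \<bullet> bs ! m))"
      by (simp add: fun_eq_iff sum_distrib_left mult_ac)
    ultimately show ?thesis by (simp only: has_field_derivative_def)
  qed
  have dA': "((\<lambda>s. A (y s) bs) has_real_derivative ?D bs y') (at a)" if "bs \<in> slot_lists E k" for bs
  proof -
    have "((\<lambda>z. A z bs) has_derivative ?D bs) (at (y a))"
      using dA[OF lbs[OF that]] by (simp add: frechet_derivative_works)
    from vector_derivative_diff_chain_within[OF y has_derivative_at_withinI[OF this]]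
    show ?thesis by (simp add: o_def has_real_derivative_iff_has_vector_derivative)
  qed
  let ?R = "\<Sum>bs\<in>slot_lists E k. ?P bs a * ?D bs y' +
       (\<Sum>l<k. (v' (is ! l) \<bullet> bs ! l) * (\<Prod>m\<in>{..<k} - {l}. ?v a ! m \<bullet> bs ! m)) * A (y a) bs"
  have "((\<lambda>s. \<Sum>bs\<in>slot_lists E k. ?P bs s * A (y s) bs) has_real_derivative ?R) (at a)"
    by (intro DERIV_sum DERIV_mult' dP dA')
  moreover have "\<forall>\<^sub>F s in nhds a. y s \<in> U"
    by (rule eventually_curve_in_open[where \<gamma> = y and a = a, OF U(1) _ U(2)])
      (rule has_vector_derivative_continuous[OF y])
  then have "\<forall>\<^sub>F s in nhds a. (\<Sum>bs\<in>slot_lists E k. ?P bs s * A (y s) bs) = A (y s) (?v s)"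
    by (rule eventually_mono) (simp add: expand len)
  ultimately have main: "((\<lambda>s. A (y s) (?v s)) has_real_derivative ?R) (at a)"
    unfolding has_real_derivative_iff_has_vector_derivative by (rule has_vector_derivative_cong_nhds)
  have first: "frechet_derivative (\<lambda>z. A z (?v a)) (at (y a)) = (\<lambda>t. \<Sum>bs\<in>slot_lists E k. ?P bs a * ?D bs t)"
  proof (rule frechet_derivative_at[symmetric])
    have "((\<lambda>z. \<Sum>bs\<in>slot_lists E k. ?P bs a * A z bs) has_derivative
        (\<lambda>t. \<Sum>bs\<in>slot_lists E k. ?P bs a * ?D bs t)) (at (y a))"
      using dA[OF lbs] by (intro has_derivative_sum has_derivative_mult_right) (simp add: frechet_derivative_works)
    then show "((\<lambda>z. A z (?v a)) has_derivative (\<lambda>t. \<Sum>bs\<in>slot_lists E k. ?P bs a * ?D bs t)) (at (y a))"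
      by (rule has_derivative_transform_within_open[OF _ U]) (simp add: expand len)
  qed
  have second: "A (y a) ((?v a)[l := v' (is ! l)]) =
      (\<Sum>bs\<in>slot_lists E k. (v' (is ! l) \<bullet> bs ! l) * (\<Prod>m\<in>{..<k} - {l}. ?v a ! m \<bullet> bs ! m) * A (y a) bs)" if "l < k" for l
  proof -
    have "(\<Prod>m<k. ((?v a)[l := v' (is ! l)]) ! m \<bullet> bs ! m) = (v' (is ! l) \<bullet> bs ! l) * (\<Prod>m\<in>{..<k} - {l}. ?v a ! m \<bullet> bs ! m)" for bs
    proof -
      have "(\<Prod>m<k. ((?v a)[l := v' (is ! l)]) ! m \<bullet> bs ! m) =
         (((?v a)[l := v' (is ! l)]) ! l \<bullet> bs ! l) * (\<Prod>m\<in>{..<k} - {l}. ((?v a)[l := v' (is ! l)]) ! m \<bullet> bs ! m)"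
        by (rule prod.remove) (use that in auto)
      moreover have "(\<Prod>m\<in>{..<k} - {l}. ((?v a)[l := v' (is ! l)]) ! m \<bullet> bs ! m) = (\<Prod>m\<in>{..<k} - {l}. ?v a ! m \<bullet> bs ! m)"
        by (rule prod.cong) auto
      ultimately show ?thesis using that len by simp
    qed
    then show ?thesis by (subst expand[OF U(2)]) (simp_all add: len)
  qed
  have "?R = frechet_derivative (\<lambda>z. A z (?v a)) (at (y a)) y' + (\<Sum>l<k. A (y a) ((?v a)[l := v' (is ! l)]))"
    by (simp add: first second sum.distrib sum_distrib_right)
      (rule sum.swap)
  with main show ?thesis by simp
qed

section \<open>Stokes' theorem and naturality for simplices\<close>

lemma coord_Ck_on_tangent:
  assumes "open V" "coord_smooth_on V f"
  shows "coord_Ck_on m V (\<lambda>x. tangent f x d)"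
  unfolding tangent_def
  by (intro coord_Ck_on_minus assms(1) coord_smooth_on_C1 coord_smooth_on_coord_deriv assms(2))

abbreviation form_coeff :: "('a, 'e::real_inner) form \<Rightarrow> ('a, 'e) chart \<Rightarrow> ((nat \<Rightarrow> real) \<Rightarrow> 'e)
    \<Rightarrow> (nat \<times> nat) list \<Rightarrow> (nat \<Rightarrow> real) \<Rightarrow> real" where
  "form_coeff \<omega> c f ds \<equiv> \<lambda>y. \<omega> c (f y) (map (tangent f y) ds)"

lemma coord_smooth_form_coefficient:
  fixes M :: "('a, 'e::real_inner) manifold"
  assumes M: "smooth_manifold M" and \<omega>: "\<omega> \<in> forms k M" and rep: "local_rep p M \<sigma> c V f" and ds: "length ds = k"
  shows "coord_Ck_on m V (\<lambda>x. \<omega> c (f x) (map (tangent f x) ds))"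
proof -
  note V = local_repD[OF rep]
  have fin: "\<exists>B. finite B \<and> span B = (UNIV :: 'e set)" using M unfolding smooth_manifold_def by (elim conjE)
  obtain E :: "'e set" where E: "finite E" "\<And>x::'e. x = (\<Sum>b\<in>E. (x \<bullet> b) *\<^sub>R b)"
    using orthonormal_expansion[OF fin] by blast
  have "coord_Ck_on m V (\<lambda>x. \<Sum>bs\<in>slot_lists E k. (\<Prod>l<k. tangent f x (ds ! l) \<bullet> bs ! l) * \<omega> c (f x) bs)"
  proof (rule coord_Ck_on_sum[OF V(2)])
    fix bs assume bs: "bs \<in> slot_lists E k"
    show "coord_Ck_on m V (\<lambda>x. (\<Prod>l<k. tangent f x (ds ! l) \<bullet> bs ! l) * \<omega> c (f x) bs)"
    proof (rule coord_Ck_on_bilinear[OF bounded_bilinear_mult V(2)])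
      show "coord_Ck_on m V (\<lambda>x. \<Prod>l<k. tangent f x (ds ! l) \<bullet> bs ! l)"
        by (rule coord_Ck_on_prod[OF V(2) coord_Ck_on_inner[OF V(2) coord_Ck_on_tangent[OF V(2,3)]]])
      have "smooth_on (chart_image c) (\<lambda>z. \<omega> c z bs)"
        by (rule forms_smooth[OF \<omega> V(1)]) (use bs in \<open>simp add: slot_lists_def\<close>)
      then have "Ck_on m (chart_image c) (\<lambda>z. \<omega> c z bs)" by (simp add: smooth_on_def)
      then show "coord_Ck_on m V (\<lambda>x. \<omega> c (f x) bs)"
        by (rule coord_Ck_on_compose[OF fin V(2) V(4)]) (use V(5) in auto)
    qed
  qed
  then show ?thesis
  proof (rule coord_Ck_on_cong[OF V(2), rotated])
    fix x assume "x \<in> V"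
    from multilinear_expansion[OF E forms_alternating[OF \<omega> V(1) V(5)[OF this]], of "map (tangent f x) ds"]
    show "(\<Sum>bs\<in>slot_lists E k. (\<Prod>l<k. tangent f x (ds ! l) \<bullet> bs ! l) * \<omega> c (f x) bs)
        = \<omega> c (f x) (map (tangent f x) ds)"
      by (simp add: ds)
  qed
qed

lemma tangent_form_coefficient:
  fixes M :: "('a, 'e::real_inner) manifold"
  assumes M: "smooth_manifold M" and \<omega>: "\<omega> \<in> forms k M" and rep: "local_rep p M \<sigma> c V f" and x: "x \<in> V"
    and ds: "length ds = k"
  shows "tangent (form_coeff \<omega> c f ds) x e =
     frechet_derivative (\<lambda>z. \<omega> c z (map (tangent f x) ds)) (at (f x)) (tangent f x e) +
     (\<Sum>l<k. \<omega> c (f x) ((map (tangent f x) ds)[l := tangent (\<lambda>y. tangent f y (ds ! l)) x e]))"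
proof -
  note V = local_repD[OF rep]
  have fin: "\<exists>B. finite B \<and> span B = (UNIV :: 'e set)" using M unfolding smooth_manifold_def by (elim conjE)
  have dA: "(\<lambda>z. \<omega> c z w) differentiable (at (f x))" if "length w = k" for w
    by (rule smooth_on_differentiable[OF forms_smooth[OF \<omega> V(1) that] V(5)[OF x]])
  have alt: "alternating_multilinear k (\<omega> c z)" if "z \<in> chart_image c" for z
    by (rule forms_alternating[OF \<omega> V(1) that])
  let ?w = "form_coeff \<omega> c f ds"
  let ?D = "frechet_derivative (\<lambda>z. \<omega> c z (map (tangent f x) ds)) (at (f x))"
  have cd: "coord_deriv i ?w x = ?D (coord_deriv i f x) +
      (\<Sum>l<k. \<omega> c (f x) ((map (tangent f x) ds)[l := coord_deriv i (\<lambda>y. tangent f y (ds ! l)) x]))" for i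
  proof (rule coord_derivI)
    have "((\<lambda>s. \<omega> c (f (x(i := s))) (map (\<lambda>d. tangent f (x(i := s)) d) ds)) has_real_derivative
       frechet_derivative (\<lambda>z. \<omega> c z (map (\<lambda>d. tangent f (x(i := x i)) d) ds)) (at (f (x(i := x i)))) (coord_deriv i f x) +
       (\<Sum>l<k. \<omega> c (f (x(i := x i))) ((map (\<lambda>d. tangent f (x(i := x i)) d) ds)[l := coord_deriv i (\<lambda>y. tangent f y (ds ! l)) x]))) (at (x i))"
    proof (rule form_along_curve_derivative[OF fin open_chart_image[OF M V(1)]])
      show "((\<lambda>s. f (x(i := s))) has_vector_derivative coord_deriv i f x) (at (x i))"
        by (rule has_coord_deriv[OF V(4) x])
      show "((\<lambda>s. tangent f (x(i := s)) d) has_vector_derivative coord_deriv i (\<lambda>y. tangent f y d) x) (at (x i))" for d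
        by (rule has_coord_deriv[OF coord_Ck_on_tangent[OF V(2,3)] x])
    qed (use V(5)[OF x] dA alt ds in auto)
    then show "((\<lambda>s. \<omega> c (f (x(i := s))) (map (tangent f (x(i := s))) ds)) has_vector_derivative
       ?D (coord_deriv i f x) +
       (\<Sum>l<k. \<omega> c (f x) ((map (tangent f x) ds)[l := coord_deriv i (\<lambda>y. tangent f y (ds ! l)) x]))) (at (x i))"
      unfolding has_real_derivative_iff_has_vector_derivative fun_upd_triv .
  qed
  have linD: "?D (u - u') = ?D u - ?D u'" for u u'
    by (rule linear_diff[OF linear_frechet_derivative[OF dA]]) (simp add: ds)
  have linA: "\<omega> c (f x) ((map (tangent f x) ds)[l := u - u']) =
     \<omega> c (f x) ((map (tangent f x) ds)[l := u]) - \<omega> c (f x) ((map (tangent f x) ds)[l := u'])" if "l < k" for l u u'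
    by (rule linear_diff[OF alternating_multilinear_linear[OF alt[OF V(5)[OF x]] _ that]]) (simp add: ds)
  have "tangent ?w x e = ?D (coord_deriv (fst e) f x) - ?D (coord_deriv (snd e) f x) +
     (\<Sum>l<k. \<omega> c (f x) ((map (tangent f x) ds)[l := coord_deriv (fst e) (\<lambda>y. tangent f y (ds ! l)) x]) -
        \<omega> c (f x) ((map (tangent f x) ds)[l := coord_deriv (snd e) (\<lambda>y. tangent f y (ds ! l)) x]))"
    by (simp add: tangent_def[of ?w] cd sum_subtractf)
  also have "\<dots> = ?D (tangent f x e) +
     (\<Sum>l<k. \<omega> c (f x) ((map (tangent f x) ds)[l := tangent (\<lambda>y. tangent f y (ds ! l)) x e]))"
    by (simp add: tangent_def[of f x e] tangent_def[of "\<lambda>y. tangent f y d" x e for d] linD linA)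
  finally show ?thesis .
qed

lemma tangent_tangent_commute:
  assumes V: "open V" "x \<in> V" and f: "coord_smooth_on V (f :: _ \<Rightarrow> 'e::real_inner)"
  shows "tangent (\<lambda>y. tangent f y d) x e = tangent (\<lambda>y. tangent f y e) x d"
proof -
  have "coord_deriv i (\<lambda>y. tangent f y d) x = coord_deriv i (coord_deriv (fst d) f) x - coord_deriv i (coord_deriv (snd d) f) x" for i d
    unfolding tangent_def
    by (rule coord_derivI) (intro has_vector_derivative_diff
        has_coord_deriv[OF coord_smooth_on_C1[OF coord_smooth_on_coord_deriv[OF f]] V(2)])
  moreover have "coord_deriv i (coord_deriv j f) x = coord_deriv j (coord_deriv i f) x" for i j
    by (rule coord_deriv_commute[OF V coord_smooth_on_C1[OF f]])
  ultimately show ?thesis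
    by (simp add: tangent_def[of "\<lambda>y. tangent f y d'" for d'])
qed

text \<open>
The edges of the standard simplex issuing from vertex \<open>0\<close>: the coordinate directions of the
parametrisation of the simplex by its barycentric coordinates \<open>1, \<dots>, p\<close>.
\<close>

definition edge_dirs :: "nat \<Rightarrow> (nat \<times> nat) list" where
  "edge_dirs p = map (\<lambda>j. (j, 0)) [1..<Suc p]"

text \<open>
The directions into which the \<open>k\<close>-th face map takes the edges of the smaller simplex.
\<close>

definition face_dirs :: "nat \<Rightarrow> nat \<Rightarrow> (nat \<times> nat) list" where
  "face_dirs q k = map (map_prod (skip k) (skip k)) (edge_dirs q)"

lemma length_edge_dirs [simp]: "length (edge_dirs p) = p"
  by (simp add: edge_dirs_def)

lemma length_face_dirs [simp]: "length (face_dirs q k) = q"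
  by (simp add: face_dirs_def)

lemma nth_edge_dirs: "i < p \<Longrightarrow> edge_dirs p ! i = (Suc i, 0)"
  by (simp add: edge_dirs_def del: upt_Suc)

lemma edge_dirs_bound: "d \<in> set (edge_dirs p) \<Longrightarrow> fst d \<le> p \<and> snd d \<le> p"
  by (auto simp: edge_dirs_def)

lemma face_dirs_bound: "d \<in> set (face_dirs q k) \<Longrightarrow> fst d \<le> Suc q \<and> snd d \<le> Suc q"
  by (auto simp: face_dirs_def edge_dirs_def skip_def)

lemma face_dirs_Suc:
  assumes "i \<le> q"
  shows "face_dirs q (Suc i) = take i (edge_dirs (Suc q)) @ drop (Suc i) (edge_dirs (Suc q))"
proof (rule nth_equalityI)
  fix l assume "l < length (face_dirs q (Suc i))"
  then have l: "l < q" by simp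
  show "face_dirs q (Suc i) ! l = (take i (edge_dirs (Suc q)) @ drop (Suc i) (edge_dirs (Suc q))) ! l"
  proof (cases "l < i")
    case True
    then show ?thesis using l assms
      by (simp add: face_dirs_def nth_append nth_edge_dirs skip_def)
  next
    case False
    then show ?thesis using l assms
      by (simp add: face_dirs_def nth_append nth_edge_dirs skip_def min_def)
  qed
qed (use assms in simp)

lemma nth_face_dirs_Suc: "l < q \<Longrightarrow> face_dirs q (Suc i) ! l = (Suc (skip i l), 0)"
  by (simp add: face_dirs_def nth_edge_dirs skip_def)

text \<open>
By the product rule, differentiating the coefficients produces the derivatives of the form itself, which
assemble to its exterior derivative, and terms in which one argument is replaced by a second derivative of
\<open>f\<close>. The latter cancel since second derivatives are symmetric. Only one chart is involved, so that compatibility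
of \<open>d\<omega>\<close> with chart transitions is not an issue.
\<close>

lemma ext_deriv_along_simplex:
  assumes M: "smooth_manifold M" and \<omega>: "\<omega> \<in> forms q M" and rep: "local_rep p M \<sigma> c V f" and x: "x \<in> V"
  shows "(\<Sum>i\<le>q. (- 1) ^ i * tangent (form_coeff \<omega> c f (face_dirs q (Suc i))) x (Suc i, 0))
    = ext_deriv q M \<omega> c (f x) (map (tangent f x) (edge_dirs (Suc q)))"
proof -
  note V = local_repD[OF rep]
  let ?vs = "map (tangent f x) (edge_dirs (Suc q))"
  let ?h = "\<lambda>i j. tangent (\<lambda>y. tangent f y (Suc j, 0)) x (Suc i, 0)"
  have vs: "map (tangent f x) (face_dirs q (Suc i)) = take i ?vs @ drop (Suc i) ?vs" if "i \<le> q" for i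
    by (simp add: face_dirs_Suc[OF that] take_map drop_map)
  have "tangent (form_coeff \<omega> c f (face_dirs q (Suc i))) x (Suc i, 0) =
     frechet_derivative (\<lambda>z. \<omega> c z (take i ?vs @ drop (Suc i) ?vs)) (at (f x)) (?vs ! i) +
     (\<Sum>l<q. \<omega> c (f x) ((take i ?vs @ drop (Suc i) ?vs)[l := ?h i (skip i l)]))" if i: "i \<le> q" for i
  proof -
    have "?vs ! i = tangent f x (Suc i, 0)" using i by (simp add: nth_edge_dirs)
    moreover have "(\<Sum>l<q. \<omega> c (f x) ((take i ?vs @ drop (Suc i) ?vs)[l := tangent (\<lambda>y. tangent f y (face_dirs q (Suc i) ! l)) x (Suc i, 0)])) =
       (\<Sum>l<q. \<omega> c (f x) ((take i ?vs @ drop (Suc i) ?vs)[l := ?h i (skip i l)]))"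
      by (rule sum.cong) (simp_all add: nth_face_dirs_Suc)
    ultimately show ?thesis
      using tangent_form_coefficient[OF M \<omega> rep x length_face_dirs, of "Suc i" "(Suc i, 0)"]
      unfolding vs[OF i] by (simp only:)
  qed
  then have "(\<Sum>i\<le>q. (- 1) ^ i * tangent (form_coeff \<omega> c f (face_dirs q (Suc i))) x (Suc i, 0)) =
    (\<Sum>i\<le>q. (- 1) ^ i * frechet_derivative (\<lambda>z. \<omega> c z (take i ?vs @ drop (Suc i) ?vs)) (at (f x)) (?vs ! i)) +
    (\<Sum>i\<le>q. (- 1) ^ i * (\<Sum>l<q. \<omega> c (f x) ((take i ?vs @ drop (Suc i) ?vs)[l := ?h i (skip i l)])))"
    by (simp add: distrib_left sum.distrib)
  also have "(\<Sum>i\<le>q. (- 1) ^ i * (\<Sum>l<q. \<omega> c (f x) ((take i ?vs @ drop (Suc i) ?vs)[l := ?h i (skip i l)]))) = 0"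
  proof (rule alternating_symmetric_cancel[OF forms_alternating[OF \<omega> V(1) V(5)[OF x]]])
    show "?h i j = ?h j i" for i j by (rule tangent_tangent_commute[OF V(2) x V(3)])
  qed simp
  finally show ?thesis using V(1) V(5)[OF x] by (simp add: ext_deriv_def form_arg_def)
qed

lemma coord_deriv_bary:
  assumes rep: "local_rep p M \<sigma> c V f" and x: "bary p t \<in> V" "bary p t \<in> open_face {..p}" and i: "1 \<le> i" "i \<le> p"
  shows "coord_deriv i (snd c \<circ> \<sigma> \<circ> bary p) t = tangent f (bary p t) (i, 0)"
proof (rule coord_derivI)
  note V = local_repD[OF rep]
  let ?x = "bary p t"
  let ?\<gamma> = "\<lambda>r. ?x(i := ?x i + r, 0 := ?x 0 - r)"
  have i0: "i \<noteq> 0" using i by simp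
  have deriv: "((\<lambda>r. f (?\<gamma> r)) has_vector_derivative tangent f ?x (i, 0)) (at 0)"
    using has_vector_derivative_two_coords[OF V(2) x(1) V(4) i0] by (simp add: tangent_def)
  have "\<forall>\<^sub>F r in nhds 0. ?\<gamma> r \<in> open_face {..p} \<inter> V"
    by (rule eventually_curve_in_simplex[OF x(2) V(2) x(1) i(2) _ i0]) simp
  then have "\<forall>\<^sub>F r in nhds 0. f (?\<gamma> r) = snd c (\<sigma> (?\<gamma> r))"
  proof eventually_elim
    case (elim r)
    then have "?\<gamma> r \<in> standard_simplex p"
      using open_face_in_standard_simplex by blast
    with elim show ?case using V(7) by simp
  qed
  with deriv have "((\<lambda>r. snd c (\<sigma> (?\<gamma> r))) has_vector_derivative tangent f ?x (i, 0)) (at 0)"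
    by (rule has_vector_derivative_cong_nhds)
  then have "((\<lambda>r. snd c (\<sigma> (?\<gamma> r))) has_vector_derivative tangent f ?x (i, 0)) (at (t i - t i))" by simp
  moreover have "((\<lambda>s. s - t i) has_vector_derivative 1) (at (t i))"
    by (auto intro!: derivative_eq_intros simp: has_vector_derivative_def)
  ultimately have "((\<lambda>r. snd c (\<sigma> (?\<gamma> r))) \<circ> (\<lambda>s. s - t i) has_vector_derivative 1 *\<^sub>R tangent f ?x (i, 0)) (at (t i))"
    using vector_diff_chain_at by blast
  moreover have "?\<gamma> (s - t i) = bary p (t(i := s))" for s
  proof -
    have "(\<Sum>j=1..p. (t(i := s)) j) = (\<Sum>j=1..p. t j) + (s - t i)"
    proof -
      have "(\<Sum>j\<in>{1..p} - {i}. (t(i := s)) j) = (\<Sum>j\<in>{1..p} - {i}. t j)" by (rule sum.cong) auto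
      then show ?thesis using i sum.remove[of "{1..p}" i "t(i := s)"] sum.remove[of "{1..p}" i t] by simp
    qed
    then show ?thesis using i by (auto simp: bary_def fun_eq_iff)
  qed
  ultimately show "((\<lambda>s. (snd c \<circ> \<sigma> \<circ> bary p) (t(i := s))) has_vector_derivative tangent f ?x (i, 0)) (at (t i))"
    by (simp add: o_def)
qed

lemma bary_eq_face_coords: "bary p t = face_coords {..p} 0 t"
proof -
  have "{..p} - {0} = {1..p}" by auto
  then show ?thesis by (auto simp: bary_def face_coords_def fun_eq_iff)
qed

lemma open_simplex_coords_iff:
  assumes "t \<in> extensional {1..p}"
  shows "t \<in> open_simplex_coords p \<longleftrightarrow> bary p t \<in> open_face {..p}"
proof -
  have "{..p} = insert 0 {1..p}" by auto
  then have "sum (bary p t) {..p} = 1" by (simp add: bary_def)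
  moreover have "(\<forall>j\<in>{..p}. 0 < bary p t j) \<longleftrightarrow> (\<forall>i\<in>{1..p}. 0 < t i) \<and> (\<Sum>i=1..p. t i) < 1"
    unfolding \<open>{..p} = insert 0 {1..p}\<close> by (auto simp: bary_def)
  moreover have "bary p t j = 0" if "j \<notin> {..p}" for j using that by (simp add: bary_def)
  ultimately show ?thesis using assms by (auto simp: open_simplex_coords_def open_face_def)
qed

text \<open>
The integral uses, at each point, the chart chosen there. Any smooth representative in that chart has the same
partial derivatives in the open simplex. The hypothesis is about the chosen charts only, because \<open>\<omega>\<close> is
arbitrary here; it will also be an exterior derivative or a pullback.
\<close>

lemma simplex_integral_eq_face_integral:
  assumes M: "smooth_manifold M" and \<sigma>: "smooth_simplex p M \<sigma>"
    and H: "\<And>x V f. x \<in> open_face {..p} \<Longrightarrow> x \<in> V \<Longrightarrow> local_rep p M \<sigma> (chart_at M (\<sigma> x)) V f \<Longrightarrow>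
       \<omega> (chart_at M (\<sigma> x)) (f x) (map (tangent f x) (edge_dirs p)) = H x"
  shows "simplex_integral p M \<omega> \<sigma> = face_integral {..p} 0 H"
  unfolding simplex_integral_def face_integral_def set_lebesgue_integral_def
proof -
  have I: "{..p} - {0} = {1..p}" by auto
  show "(\<integral>t. indicat_real (open_simplex_coords p) t *\<^sub>R
       (let q = \<sigma> (bary p t); c = chart_at M q
            in \<omega> c (snd c q) (map (\<lambda>i. coord_deriv i (snd c \<circ> \<sigma> \<circ> bary p) t) [1..<Suc p])) \<partial>Pi\<^sub>M {1..p} (\<lambda>_. lborel)) =
     (\<integral>t. indicat_real (open_face {..p}) (face_coords {..p} 0 t) * H (face_coords {..p} 0 t) \<partial>Pi\<^sub>M ({..p} - {0}) (\<lambda>_. lborel))"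
    unfolding I
  proof (rule Bochner_Integration.integral_cong[OF refl])
    fix t :: "nat \<Rightarrow> real" assume "t \<in> space (PiM {1..p} (\<lambda>_. lborel :: real measure))"
    then have t: "t \<in> extensional {1..p}" by (simp add: space_PiM PiE_def)
    let ?x = "bary p t"
    let ?c = "chart_at M (\<sigma> ?x)"
    show "indicat_real (open_simplex_coords p) t *\<^sub>R
       (let q = \<sigma> (bary p t); c = chart_at M q
            in \<omega> c (snd c q) (map (\<lambda>i. coord_deriv i (snd c \<circ> \<sigma> \<circ> bary p) t) [1..<Suc p])) =
       indicat_real (open_face {..p}) (face_coords {..p} 0 t) * H (face_coords {..p} 0 t)"
    proof (cases "?x \<in> open_face {..p}")
      case True
      then have x: "?x \<in> standard_simplex p"
        using open_face_in_standard_simplex by blast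
      obtain V f where V: "?x \<in> V" "local_rep p M \<sigma> ?c V f"
        by (rule local_rep_exists[OF M \<sigma> x chart_at[OF M smooth_simplex_topspace[OF \<sigma> x]]])
      have "map (\<lambda>i. coord_deriv i (snd ?c \<circ> \<sigma> \<circ> bary p) t) [1..<Suc p] = map (tangent f ?x) (edge_dirs p)"
        using coord_deriv_bary[OF V(2,1) True] by (simp add: edge_dirs_def del: upt_Suc)
      moreover have "snd ?c (\<sigma> ?x) = f ?x" by (rule local_repD(7)[OF V(2,1) x])
      ultimately show ?thesis
        using H[OF True V] True open_simplex_coords_iff[OF t]
        by (simp add: bary_eq_face_coords[symmetric] Let_def)
    next
      case False
      then show ?thesis using open_simplex_coords_iff[OF t] by (simp add: bary_eq_face_coords[symmetric])
    qed
  qed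
qed

lemma simplex_integral_form:
  assumes M: "smooth_manifold M" and \<sigma>: "smooth_simplex p M \<sigma>" and \<omega>: "\<omega> \<in> forms p M"
  shows "simplex_integral p M \<omega> \<sigma> = face_integral {..p} 0 (simplex_form p M \<omega> \<sigma> (edge_dirs p))"
proof (rule simplex_integral_eq_face_integral[OF M \<sigma>])
  fix x V f assume x: "x \<in> open_face {..p}" "x \<in> V" and rep: "local_rep p M \<sigma> (chart_at M (\<sigma> x)) V f"
  then have "x \<in> standard_simplex p"
    using open_face_in_standard_simplex by blast
  then show "\<omega> (chart_at M (\<sigma> x)) (f x) (map (tangent f x) (edge_dirs p)) = simplex_form p M \<omega> \<sigma> (edge_dirs p) x"
    by (intro simplex_form_eq[OF M \<sigma> \<omega> rep x(2), symmetric] length_edge_dirs edge_dirs_bound)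
qed

lemma face_integral_cong:
  "(\<And>x. x \<in> open_face A \<Longrightarrow> H x = H' x) \<Longrightarrow> face_integral A i H = face_integral A i H'"
  unfolding face_integral_def by (intro Bochner_Integration.integral_cong) (auto simp: indicator_def)

lemma face_integral_sum:
  fixes H :: "'i \<Rightarrow> (nat \<Rightarrow> real) \<Rightarrow> real"
  assumes A: "finite A" and H: "\<And>j. j \<in> J \<Longrightarrow> continuous_on (open_face A) (H j)"
    "\<And>j x. j \<in> J \<Longrightarrow> x \<in> open_face A \<Longrightarrow> \<bar>H j x\<bar> \<le> B j"
  shows "face_integral A i (\<lambda>x. \<Sum>j\<in>J. a j * H j x) = (\<Sum>j\<in>J. a j * face_integral A i (H j))"
proof -
  let ?P = "PiM (A - {i}) (\<lambda>_. lborel :: real measure)"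
  let ?h = "\<lambda>j t. indicator (open_face A) (face_coords A i t) * H j (face_coords A i t)"
  have "integrable ?P (\<lambda>t. a j * ?h j t)" if "j \<in> J" for j
    by (rule integrable_mult_right[OF face_integrand_integrable[OF A H(1)[OF that] H(2)[OF that]]])
  then have "(\<integral>t. (\<Sum>j\<in>J. a j * ?h j t) \<partial>?P) = (\<Sum>j\<in>J. \<integral>t. a j * ?h j t \<partial>?P)"
    by (rule Bochner_Integration.integral_sum)
  then show ?thesis
    unfolding face_integral_def by (simp add: sum_distrib_left mult.left_commute)
qed

lemma continuous_on_local:
  fixes H :: "'x::t2_space \<Rightarrow> real"
  assumes "\<And>x. x \<in> S \<Longrightarrow> \<exists>V g. open V \<and> x \<in> V \<and> continuous_on V g \<and> (\<forall>y\<in>V \<inter> S. H y = g y)"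
  shows "continuous_on S H"
  unfolding continuous_on_eq_continuous_within
proof
  fix x assume x: "x \<in> S"
  from assms[OF x] obtain V g where V: "open V" "x \<in> V" "continuous_on V g" "\<And>y. y \<in> V \<inter> S \<Longrightarrow> H y = g y"
    by auto
  have "isCont g x" using V by (simp add: continuous_on_eq_continuous_at)
  then have "(g \<longlongrightarrow> g x) (at x within S)"
    unfolding isCont_def by (rule tendsto_within_subset) simp
  then have "(H \<longlongrightarrow> g x) (at x within S)"
  proof (rule Lim_transform_eventually)
    have "\<forall>\<^sub>F y in at x within S. y \<in> V \<inter> S"
      using V(1,2) by (auto simp: eventually_at_topological)
    then show "\<forall>\<^sub>F y in at x within S. g y = H y" by (rule eventually_mono) (simp add: V(4))
  qed
  then show "continuous (at x within S) H" using V(2,4) x by (simp add: continuous_within)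
qed

text \<open>
The coefficient functions are defined chart by chart; their derivatives in the open simplex are locally
restrictions of functions that are continuous up to the boundary, and compactness of the closed simplex makes
them bounded.
\<close>

lemma bounded_local:
  fixes H :: "'x::topological_space \<Rightarrow> real"
  assumes "compact K"
    and loc: "\<And>x. x \<in> K \<Longrightarrow> \<exists>V g. open V \<and> x \<in> V \<and> continuous_on V g \<and> (\<forall>y\<in>V \<inter> S. H y = g y)" and "S \<subseteq> K"
  obtains B where "\<And>y. y \<in> S \<Longrightarrow> \<bar>H y\<bar> \<le> B"
proof -
  have "\<exists>W. open W \<and> x \<in> W \<and> (\<exists>B. \<forall>y\<in>W \<inter> S. \<bar>H y\<bar> \<le> B)" if x: "x \<in> K" for x
  proof -
    from loc[OF x] obtain V g where V: "open V" "x \<in> V" "continuous_on V g" "\<And>y. y \<in> V \<inter> S \<Longrightarrow> H y = g y"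
      by auto
    have "open {y \<in> V. g y \<in> ball (g x) 1}"
      using continuous_open_preimage[OF V(3,1), of "ball (g x) 1"] by (simp add: vimage_def Int_def)
    moreover have "\<bar>H y\<bar> \<le> \<bar>g x\<bar> + 1" if "y \<in> {y \<in> V. g y \<in> ball (g x) 1} \<inter> S" for y
      using that V(4)[of y] by (auto simp: dist_real_def)
    ultimately show ?thesis
      using V(2) by (intro exI[of _ "{y \<in> V. g y \<in> ball (g x) 1}"]) auto
  qed
  then obtain W where W: "\<And>x. x \<in> K \<Longrightarrow> open (W x)" "\<And>x. x \<in> K \<Longrightarrow> x \<in> W x"
     "\<And>x. x \<in> K \<Longrightarrow> \<exists>B. \<forall>y\<in>W x \<inter> S. \<bar>H y\<bar> \<le> B"
    by metis
  then obtain B where B: "\<And>x y. x \<in> K \<Longrightarrow> y \<in> W x \<inter> S \<Longrightarrow> \<bar>H y\<bar> \<le> B x" by metis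
  obtain C where C: "C \<subseteq> K" "finite C" "K \<subseteq> (\<Union>x\<in>C. W x)"
    by (rule compactE_image[OF assms(1), of K W]) (use W(1,2) in auto)
  have "\<bar>H y\<bar> \<le> (\<Sum>x\<in>C. \<bar>B x\<bar>)" if y: "y \<in> S" for y
  proof -
    obtain x where x: "x \<in> C" "y \<in> W x" using C(3) y assms(3) by auto
    then have "\<bar>H y\<bar> \<le> \<bar>B x\<bar>" using B[of x y] C(1) y by auto
    also have "\<dots> \<le> (\<Sum>x\<in>C. \<bar>B x\<bar>)" using x C(2) by (intro member_le_sum) auto
    finally show ?thesis .
  qed
  with that show ?thesis by blast
qed

text \<open>
The coefficient \<open>W i\<close> of \<open>\<omega>\<close> omits the edge from vertex \<open>0\<close> to vertex \<open>i + 1\<close>, and \<open>G i\<close> is its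
derivative along that edge. The integral of \<open>G i\<close> is the difference of the integrals of \<open>W i\<close> over the
faces \<open>0\<close> and \<open>i + 1\<close>. On face \<open>i + 1\<close>, \<open>W i\<close> is the integrand of the face itself; on face \<open>0\<close> the
alternating sum of all \<open>W i\<close> is.
\<close>

lemma Stokes_simplex:
  assumes M: "smooth_manifold M" and \<sigma>: "smooth_simplex (Suc q) M \<sigma>" and \<omega>: "\<omega> \<in> forms q M"
  shows "simplex_integral (Suc q) M (ext_deriv q M \<omega>) \<sigma> =
    (\<Sum>k\<le>Suc q. (- 1) ^ k * simplex_integral q M \<omega> (singular_face (Suc q) k \<sigma>))"
proof -
  define W where "W = (\<lambda>i. simplex_form (Suc q) M \<omega> \<sigma> (face_dirs q (Suc i)))"
  define G where "G = (\<lambda>i x. vector_derivative (\<lambda>s. W i (x(Suc i := x (Suc i) + s, 0 := x 0 - s))) (at 0))"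
  have simplex: "x \<in> standard_simplex (Suc q)" if "x \<in> open_face {..Suc q}" for x
    using that by (rule open_face_in_standard_simplex)
  have W_eq: "W i y = \<omega> c (f y) (map (tangent f y) (face_dirs q (Suc i)))"
    if "local_rep (Suc q) M \<sigma> c V f" "y \<in> V" "y \<in> standard_simplex (Suc q)" for i y c V f
    unfolding W_def by (rule simplex_form_eq[OF M \<sigma> \<omega> that length_face_dirs face_dirs_bound])
  have W_deriv: "((\<lambda>s. W i (y(Suc i := y (Suc i) + s, 0 := y 0 - s))) has_vector_derivative
        tangent (form_coeff \<omega> c f (face_dirs q (Suc i))) y (Suc i, 0)) (at 0)"
    if rep: "local_rep (Suc q) M \<sigma> c V f" and y: "y \<in> V" "y \<in> open_face {..Suc q}" and i: "i \<le> q" for i y c V f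
  proof -
    note V = local_repD[OF rep]
    have "((\<lambda>s. \<omega> c (f (y(Suc i := y (Suc i) + s, 0 := y 0 - s)))
        (map (tangent f (y(Suc i := y (Suc i) + s, 0 := y 0 - s))) (face_dirs q (Suc i)))) has_vector_derivative
        tangent (form_coeff \<omega> c f (face_dirs q (Suc i))) y (Suc i, 0)) (at 0)"
      unfolding tangent_def[of "form_coeff \<omega> c f (face_dirs q (Suc i))"] fst_conv snd_conv
      by (rule has_vector_derivative_two_coords[OF V(2) y(1)
            coord_smooth_form_coefficient[OF M \<omega> rep length_face_dirs]]) simp
    moreover have "\<forall>\<^sub>F s in nhds 0. y(Suc i := y (Suc i) + s, 0 := y 0 - s) \<in> open_face {..Suc q} \<inter> V"
      by (rule eventually_curve_in_simplex[OF y(2) V(2) y(1)]) (use i in auto)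
    then have "\<forall>\<^sub>F s in nhds 0. \<omega> c (f (y(Suc i := y (Suc i) + s, 0 := y 0 - s)))
        (map (tangent f (y(Suc i := y (Suc i) + s, 0 := y 0 - s))) (face_dirs q (Suc i))) =
        W i (y(Suc i := y (Suc i) + s, 0 := y 0 - s))"
      by (rule eventually_mono) (rule W_eq[OF rep, symmetric], auto intro: simplex)
    ultimately show ?thesis by (rule has_vector_derivative_cong_nhds)
  qed
  have rep_exists: "\<exists>V f. x \<in> V \<and> local_rep (Suc q) M \<sigma> (chart_at M (\<sigma> x)) V f" if x: "x \<in> standard_simplex (Suc q)" for x
  proof -
    obtain V f where V: "x \<in> V" "local_rep (Suc q) M \<sigma> (chart_at M (\<sigma> x)) V f"
      by (rule local_rep_exists[OF M \<sigma> x chart_at[OF M smooth_simplex_topspace[OF \<sigma> x]]])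
    then show ?thesis by (intro exI conjI)
  qed
  have W_cont: "continuous_on (standard_simplex (Suc q)) (W i)" for i
  proof (rule continuous_on_local)
    fix x assume x: "x \<in> standard_simplex (Suc q)"
    obtain V f where V: "x \<in> V" "local_rep (Suc q) M \<sigma> (chart_at M (\<sigma> x)) V f"
      using rep_exists[OF x] by (elim exE conjE)
    let ?w = "form_coeff \<omega> (chart_at M (\<sigma> x)) f (face_dirs q (Suc i))"
    have "continuous_on V ?w"
      by (rule coord_Ck_on_continuous[OF coord_smooth_form_coefficient[OF M \<omega> V(2) length_face_dirs, of 0]])
    moreover have "\<forall>y\<in>V \<inter> standard_simplex (Suc q). W i y = ?w y"
      using W_eq[OF V(2)] by simp
    ultimately show "\<exists>V g. open V \<and> x \<in> V \<and> continuous_on V g \<and> (\<forall>y\<in>V \<inter> standard_simplex (Suc q). W i y = g y)"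
      using V(1) local_repD(2)[OF V(2)] by (intro exI[of _ V] exI[of _ ?w] conjI)
  qed
  have G_local: "\<exists>V g. open V \<and> x \<in> V \<and> continuous_on V g \<and> (\<forall>y\<in>V \<inter> open_face {..Suc q}. G i y = g y)"
    if x: "x \<in> standard_simplex (Suc q)" and i: "i \<le> q" for x i
  proof -
    obtain V f where V: "x \<in> V" "local_rep (Suc q) M \<sigma> (chart_at M (\<sigma> x)) V f"
      using rep_exists[OF x] by (elim exE conjE)
    let ?w = "form_coeff \<omega> (chart_at M (\<sigma> x)) f (face_dirs q (Suc i))"
    have "coord_Ck_on (Suc 0) V ?w"
      by (rule coord_smooth_form_coefficient[OF M \<omega> V(2) length_face_dirs])
    then have "continuous_on V (\<lambda>y. tangent ?w y (Suc i, 0))"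
      unfolding tangent_def[of ?w] by (intro continuous_on_diff) auto
    moreover have "\<forall>y\<in>V \<inter> open_face {..Suc q}. G i y = tangent ?w y (Suc i, 0)"
      unfolding G_def using vector_derivative_at[OF W_deriv[OF V(2) _ _ i]] by simp
    ultimately show ?thesis
      using V(1) local_repD(2)[OF V(2)] by (intro exI[of _ V] exI[of _ "\<lambda>y. tangent ?w y (Suc i, 0)"] conjI)
  qed
  have G_cont: "continuous_on (open_face {..Suc q}) (G i)" if "i \<le> q" for i
    by (rule continuous_on_local) (rule G_local[OF simplex that])
  have G_bounded: "\<exists>B. \<forall>x\<in>open_face {..Suc q}. \<bar>G i x\<bar> \<le> B" if "i \<le> q" for i
    using bounded_local[OF compact_standard_simplex G_local[OF _ that]] simplex by (metis subsetI)
  obtain B where B: "\<And>i x. i \<le> q \<Longrightarrow> x \<in> open_face {..Suc q} \<Longrightarrow> \<bar>G i x\<bar> \<le> B i"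
    using G_bounded by metis
  have "simplex_integral (Suc q) M (ext_deriv q M \<omega>) \<sigma> = face_integral {..Suc q} 0 (\<lambda>x. \<Sum>i\<le>q. (- 1) ^ i * G i x)"
  proof (rule simplex_integral_eq_face_integral[OF M \<sigma>])
    fix x V f assume x: "x \<in> open_face {..Suc q}" "x \<in> V" and rep: "local_rep (Suc q) M \<sigma> (chart_at M (\<sigma> x)) V f"
    have "G i x = tangent (form_coeff \<omega> (chart_at M (\<sigma> x)) f (face_dirs q (Suc i))) x (Suc i, 0)" if "i \<le> q" for i
      unfolding G_def using vector_derivative_at[OF W_deriv[OF rep x(2,1) that]] .
    then show "ext_deriv q M \<omega> (chart_at M (\<sigma> x)) (f x) (map (tangent f x) (edge_dirs (Suc q))) = (\<Sum>i\<le>q. (- 1) ^ i * G i x)"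
      using ext_deriv_along_simplex[OF M \<omega> rep x(2)] by simp
  qed
  also have "\<dots> = (\<Sum>i\<le>q. (- 1) ^ i * face_integral {..Suc q} 0 (G i))"
    by (rule face_integral_sum) (use G_cont B in auto)
  also have "\<dots> = (\<Sum>i\<le>q. (- 1) ^ i * (face_integral {..q} 0 (\<lambda>x. W i (simplical_face 0 x))
      - face_integral {..q} 0 (\<lambda>x. W i (simplical_face (Suc i) x))))"
  proof (rule sum.cong[OF refl])
    fix i assume "i \<in> {..q}"
    then have i: "i \<le> q" by simp
    have "face_integral {..Suc q} 0 (G i) = face_integral {..q} 0 (\<lambda>x. W i (simplical_face 0 x))
        - face_integral {..q} 0 (\<lambda>x. W i (simplical_face (Suc i) x))"
    proof (rule face_integral_boundary_difference[OF _ _ W_cont G_cont[OF i] B[OF i]])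
      fix x assume x: "x \<in> open_face {..Suc q}"
      obtain V f where V: "x \<in> V" "local_rep (Suc q) M \<sigma> (chart_at M (\<sigma> x)) V f"
        using rep_exists[OF simplex[OF x]] by (elim exE conjE)
      have d: "((\<lambda>s. W i (x(Suc i := x (Suc i) + s, 0 := x 0 - s))) has_vector_derivative
        tangent (form_coeff \<omega> (chart_at M (\<sigma> x)) f (face_dirs q (Suc i))) x (Suc i, 0)) (at 0)"
        by (rule W_deriv[OF V(2,1) x i])
      then show "((\<lambda>s. W i (x(Suc i := x (Suc i) + s, 0 := x 0 - s))) has_real_derivative G i x) (at 0)"
        unfolding has_real_derivative_iff_has_vector_derivative G_def
        using vector_derivative_at[OF d] by simp
    qed (use i in auto)
    then show "(- 1) ^ i * face_integral {..Suc q} 0 (G i) = (- 1) ^ i * (face_integral {..q} 0 (\<lambda>x. W i (simplical_face 0 x))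
      - face_integral {..q} 0 (\<lambda>x. W i (simplical_face (Suc i) x)))" by simp
  qed
  also have "\<dots> = (\<Sum>i\<le>q. (- 1) ^ i * face_integral {..q} 0 (\<lambda>x. W i (simplical_face 0 x))) +
      (\<Sum>i\<le>q. (- 1) ^ Suc i * face_integral {..q} 0 (\<lambda>x. W i (simplical_face (Suc i) x)))"
    by (simp add: right_diff_distrib sum_subtractf sum_negf)
  also have "(\<Sum>i\<le>q. (- 1) ^ i * face_integral {..q} 0 (\<lambda>x. W i (simplical_face 0 x))) =
     simplex_integral q M \<omega> (singular_face (Suc q) 0 \<sigma>)"
  proof -
    have face0: "simplical_face 0 x \<in> standard_simplex (Suc q)" if "x \<in> standard_simplex q" for x
      using simplical_face_in_standard_simplex[of "Suc q" 0 x] that by simp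
    have c: "continuous_on (standard_simplex q) (\<lambda>x. W i (simplical_face 0 x))" for i
      by (rule continuous_on_compose2[OF W_cont continuous_on_simplical_face]) (use face0 in auto)
    have sub: "open_face {..q} \<subseteq> standard_simplex q"
      using open_face_in_standard_simplex by blast
    have "\<exists>C. \<forall>x\<in>standard_simplex q. \<bar>W i (simplical_face 0 x)\<bar> \<le> C" for i
      using compact_imp_bounded[OF compact_continuous_image[OF c[of i] compact_standard_simplex]]
      by (simp add: bounded_iff)
    then obtain C where C: "\<And>i x. x \<in> standard_simplex q \<Longrightarrow> \<bar>W i (simplical_face 0 x)\<bar> \<le> C i" by metis
    have "(\<Sum>i\<le>q. (- 1) ^ i * face_integral {..q} 0 (\<lambda>x. W i (simplical_face 0 x))) =
       face_integral {..q} 0 (\<lambda>x. \<Sum>i\<le>q. (- 1) ^ i * W i (simplical_face 0 x))"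
      by (rule face_integral_sum[symmetric]) (use continuous_on_subset[OF c sub] C sub in auto)
    also have "\<dots> = face_integral {..q} 0 (simplex_form q M \<omega> (singular_face (Suc q) 0 \<sigma>) (edge_dirs q))"
    proof (rule face_integral_cong)
      fix x assume "x \<in> open_face {..q}"
      then have x: "x \<in> standard_simplex q" using sub by auto
      let ?y = "simplical_face 0 x"
      obtain V f where V: "?y \<in> V" "local_rep (Suc q) M \<sigma> (chart_at M (\<sigma> ?y)) V f"
        using rep_exists[OF face0[OF x]] by (elim exE conjE)
      let ?c = "chart_at M (\<sigma> ?y)"
      let ?us = "map (\<lambda>j. tangent f ?y (Suc j, 0)) [1..<Suc q]" and ?w = "tangent f ?y (1, 0)"
      \<comment> \<open>the edges from vertex \<open>0\<close>, with the one to vertex \<open>1\<close> split off\<close>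
      have edge: "map (tangent f ?y) (edge_dirs (Suc q)) = ?w # ?us"
        by (rule nth_equalityI) (auto simp: nth_edge_dirs nth_Cons' simp del: upt_Suc)
      have "simplex_form q M \<omega> (singular_face (Suc q) 0 \<sigma>) (edge_dirs q) x = simplex_form (Suc q) M \<omega> \<sigma> (face_dirs q 0) ?y"
        unfolding face_dirs_def by (rule simplex_form_singular_face[OF M \<sigma> \<omega> _ x length_edge_dirs edge_dirs_bound]) simp
      also have "\<dots> = \<omega> ?c (f ?y) (map (tangent f ?y) (face_dirs q 0))"
        by (rule simplex_form_eq[OF M \<sigma> \<omega> V(2,1) face0[OF x] length_face_dirs face_dirs_bound])
      also have "map (tangent f ?y) (face_dirs q 0) = map (\<lambda>u. u - ?w) ?us"
        by (simp add: face_dirs_def edge_dirs_def skip_def tangent_def del: upt_Suc)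
      also have "\<omega> ?c (f ?y) (map (\<lambda>u. u - ?w) ?us) = (\<Sum>i\<le>q. (- 1) ^ i * \<omega> ?c (f ?y) (take i (?w # ?us) @ drop (Suc i) (?w # ?us)))"
        by (rule alternating_differences_omit[OF forms_alternating[OF \<omega> local_repD(1)[OF V(2)] local_repD(5)[OF V(2,1)]]]) simp
      also have "\<dots> = (\<Sum>i\<le>q. (- 1) ^ i * W i ?y)"
      proof (rule sum.cong[OF refl])
        fix i assume "i \<in> {..q}"
        then have "W i ?y = \<omega> ?c (f ?y) (take i (?w # ?us) @ drop (Suc i) (?w # ?us))"
          using W_eq[OF V(2,1) face0[OF x], of i] unfolding edge[symmetric]
          by (simp add: face_dirs_Suc take_map drop_map)
        then show "(- 1) ^ i * \<omega> ?c (f ?y) (take i (?w # ?us) @ drop (Suc i) (?w # ?us)) = (- 1) ^ i * W i ?y" by simp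
      qed
      finally show "(\<Sum>i\<le>q. (- 1) ^ i * W i ?y) = simplex_form q M \<omega> (singular_face (Suc q) 0 \<sigma>) (edge_dirs q) x" ..
    qed
    also have "\<dots> = simplex_integral q M \<omega> (singular_face (Suc q) 0 \<sigma>)"
      by (rule simplex_integral_form[OF M smooth_simplex_singular_face[OF M \<sigma>] \<omega>, symmetric]) simp
    finally show ?thesis .
  qed
  also have "(\<Sum>i\<le>q. (- 1) ^ Suc i * face_integral {..q} 0 (\<lambda>x. W i (simplical_face (Suc i) x))) =
     (\<Sum>i\<le>q. (- 1) ^ Suc i * simplex_integral q M \<omega> (singular_face (Suc q) (Suc i) \<sigma>))"
  proof (rule sum.cong[OF refl])
    fix i assume "i \<in> {..q}"
    then have i: "Suc i \<le> Suc q" by simp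
    have "face_integral {..q} 0 (\<lambda>x. W i (simplical_face (Suc i) x)) =
       face_integral {..q} 0 (simplex_form q M \<omega> (singular_face (Suc q) (Suc i) \<sigma>) (edge_dirs q))"
    proof (rule face_integral_cong)
      fix x assume "x \<in> open_face {..q}"
      then have "x \<in> standard_simplex q" using open_face_in_standard_simplex by blast
      from simplex_form_singular_face[OF M \<sigma> \<omega> i this length_edge_dirs edge_dirs_bound]
      show "W i (simplical_face (Suc i) x) = simplex_form q M \<omega> (singular_face (Suc q) (Suc i) \<sigma>) (edge_dirs q) x"
        by (simp add: W_def face_dirs_def)
    qed
    then show "(- 1) ^ Suc i * face_integral {..q} 0 (\<lambda>x. W i (simplical_face (Suc i) x)) =
       (- 1) ^ Suc i * simplex_integral q M \<omega> (singular_face (Suc q) (Suc i) \<sigma>)"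
      using simplex_integral_form[OF M smooth_simplex_singular_face[OF M \<sigma> i] \<omega>] by simp
  qed
  also have "simplex_integral q M \<omega> (singular_face (Suc q) 0 \<sigma>) +
     (\<Sum>i\<le>q. (- 1) ^ Suc i * simplex_integral q M \<omega> (singular_face (Suc q) (Suc i) \<sigma>)) =
     (\<Sum>k\<le>Suc q. (- 1) ^ k * simplex_integral q M \<omega> (singular_face (Suc q) k \<sigma>))"
    by (subst sum.atMost_Suc_shift) simp
  finally show ?thesis .
qed

text \<open>
At each point both integrands are computed from the same charts of \<open>M\<close> and \<open>N\<close>, and they agree by the chain
rule for the coordinate representation of \<open>F\<close>.
\<close>

lemma simplex_integral_pullback:
  assumes M: "smooth_manifold M" and N: "smooth_manifold N" and F: "smooth_map M N F"
    and \<sigma>: "smooth_simplex p M \<sigma>"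
  shows "simplex_integral p N \<omega> (simplex_map p F \<sigma>) = simplex_integral p M (pullback p M N F \<omega>) \<sigma>"
proof -
  define H where "H = (\<lambda>x. let c = chart_at N (F (\<sigma> x)); f = SOME f. \<exists>V. x \<in> V \<and> local_rep p N (simplex_map p F \<sigma>) c V f
     in \<omega> c (f x) (map (tangent f x) (edge_dirs p)))"
  have \<tau>: "smooth_simplex p N (simplex_map p F \<sigma>)" by (rule smooth_simplex_simplex_map[OF M N F \<sigma>])
  have simplex: "x \<in> standard_simplex p" if "x \<in> open_face {..p}" for x
    using that by (rule open_face_in_standard_simplex)
  have map_eq: "simplex_map p F \<sigma> x = F (\<sigma> x)" if "x \<in> open_face {..p}" for x
    using simplex[OF that] by (simp add: simplex_map_def)
  have H_eq: "\<omega> (chart_at N (F (\<sigma> x))) (f x) (map (tangent f x) (edge_dirs p)) = H x"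
    if x: "x \<in> open_face {..p}" "x \<in> V" and rep: "local_rep p N (simplex_map p F \<sigma>) (chart_at N (F (\<sigma> x))) V f" for x V f
  proof -
    define f' where "f' = (SOME f. \<exists>V. x \<in> V \<and> local_rep p N (simplex_map p F \<sigma>) (chart_at N (F (\<sigma> x))) V f)"
    have "\<exists>f V. x \<in> V \<and> local_rep p N (simplex_map p F \<sigma>) (chart_at N (F (\<sigma> x))) V f"
      using x(2) rep by (intro exI conjI)
    from someI_ex[OF this] obtain V' where V': "x \<in> V'" "local_rep p N (simplex_map p F \<sigma>) (chart_at N (F (\<sigma> x))) V' f'"
      unfolding f'_def by blast
    note V = local_repD[OF rep] and W = local_repD[OF V'(2)]
    have "tangent f x d = tangent f' x d" if "d \<in> set (edge_dirs p)" for d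
    proof (rule tangent_unique[OF V(2) x(2) W(2) V'(1) simplex[OF x(1)] V(4) W(4)])
      show "f y = f' y" if "y \<in> V" "y \<in> V'" "y \<in> standard_simplex p" for y
        using V(7)[OF that(1,3)] W(7)[OF that(2,3)] by simp
    qed (use edge_dirs_bound[OF that] in auto)
    moreover have "f x = f' x" using V(7)[OF x(2) simplex[OF x(1)]] W(7)[OF V'(1) simplex[OF x(1)]] by simp
    ultimately have "\<omega> (chart_at N (F (\<sigma> x))) (f x) (map (tangent f x) (edge_dirs p)) =
       \<omega> (chart_at N (F (\<sigma> x))) (f' x) (map (tangent f' x) (edge_dirs p))"
      by (simp cong: map_cong)
    then show ?thesis unfolding H_def Let_def f'_def .
  qed
  have "simplex_integral p N \<omega> (simplex_map p F \<sigma>) = face_integral {..p} 0 H"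
    by (rule simplex_integral_eq_face_integral[OF N \<tau>]) (use H_eq map_eq in simp)
  moreover have "simplex_integral p M (pullback p M N F \<omega>) \<sigma> = face_integral {..p} 0 H"
  proof (rule simplex_integral_eq_face_integral[OF M \<sigma>])
    fix x V f assume x: "x \<in> open_face {..p}" "x \<in> V" and rep: "local_rep p M \<sigma> (chart_at M (\<sigma> x)) V f"
    let ?c = "chart_at M (\<sigma> x)" and ?d = "chart_at N (F (\<sigma> x))"
    note V = local_repD[OF rep]
    let ?g = "snd ?d \<circ> F \<circ> chart_inv ?c" and ?U = "{y \<in> chart_image ?c. F (chart_inv ?c y) \<in> fst ?d}"
    have d: "?d \<in> atlas N" "F (\<sigma> x) \<in> fst ?d"
      using chart_at[OF N smooth_simplex_topspace[OF \<tau> simplex[OF x(1)]]] map_eq[OF x(1)] by auto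
    have inv: "chart_inv ?c (f x) = \<sigma> x"
      using chart_inv_snd[OF M V(1) V(6)] V(7) x(2) simplex[OF x(1)] by metis
    have fxU: "f x \<in> ?U" using V(5)[OF x(2)] d(2) inv by simp
    have "?g differentiable (at (f x))"
      by (rule smooth_on_differentiable[OF smooth_map_coordinate_rep(2)[OF M F V(1) d(1) N] fxU])
    then have "tangent (\<lambda>y. ?g (f y)) x e = frechet_derivative ?g (at (f x)) (tangent f x e)" for e
      by (rule tangent_compose[OF V(4) x(2)])
    then have m: "map (tangent (\<lambda>y. ?g (f y)) x) (edge_dirs p) =
       map (frechet_derivative ?g (at (f x))) (map (tangent f x) (edge_dirs p))" by simp
    have "pullback p M N F \<omega> ?c (f x) (map (tangent f x) (edge_dirs p)) =
      \<omega> ?d (?g (f x)) (map (frechet_derivative ?g (at (f x))) (map (tangent f x) (edge_dirs p)))"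
      using V(1) V(5)[OF x(2)] inv by (simp add: pullback_def form_arg_def Let_def)
    also have "\<dots> = H x"
      unfolding m[symmetric]
      by (rule H_eq[OF x(1) _ local_rep_simplex_map[OF M N F rep d(1)]]) (use x(2) fxU in simp)
    finally show "pullback p M N F \<omega> ?c (f x) (map (tangent f x) (edge_dirs p)) = H x" .
  qed
  ultimately show ?thesis by simp
qed

section \<open>Integration of chains and homology classes\<close>

lemma chain_integral_superset:
  assumes "finite K" "Poly_Mapping.keys S \<subseteq> K"
  shows "chain_integral p M \<omega> S = (\<Sum>\<sigma>\<in>K. of_int (Poly_Mapping.lookup S \<sigma>) * simplex_integral p M \<omega> \<sigma>)"
  unfolding chain_integral_def
  by (rule sum.mono_neutral_left) (use assms in \<open>auto simp: in_keys_iff\<close>)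

lemma chain_integral_diff:
  "chain_integral p M \<omega> (S - S') = chain_integral p M \<omega> S - chain_integral p M \<omega> S'"
proof -
  let ?K = "Poly_Mapping.keys S \<union> Poly_Mapping.keys S'"
  have "Poly_Mapping.keys (S - S') \<subseteq> ?K" by (rule keys_diff)
  then show ?thesis
    using chain_integral_superset[of ?K S p M \<omega>] chain_integral_superset[of ?K S' p M \<omega>]
      chain_integral_superset[of ?K "S - S'" p M \<omega>]
    by (simp add: lookup_minus left_diff_distrib sum_subtractf)
qed

lemma chain_integral_0 [simp]: "chain_integral p M \<omega> 0 = 0"
  by (simp add: chain_integral_def)

lemma chain_integral_add:
  "chain_integral p M \<omega> (S + S') = chain_integral p M \<omega> S + chain_integral p M \<omega> S'"
  using chain_integral_diff[of p M \<omega> "S + S'" S'] by simp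

lemma chain_integral_frag_of [simp]: "chain_integral p M \<omega> (frag_of \<sigma>) = simplex_integral p M \<omega> \<sigma>"
  by (simp add: chain_integral_def)

lemma chain_integral_frag_cmul: "chain_integral p M \<omega> (frag_cmul a S) = of_int a * chain_integral p M \<omega> S"
  using chain_integral_superset[of "Poly_Mapping.keys S" "frag_cmul a S" p M \<omega>] keys_cmul[of a S]
  by (simp add: chain_integral_def sum_distrib_left mult.assoc)

lemma chain_integral_sum: "chain_integral p M \<omega> (sum f I) = (\<Sum>i\<in>I. chain_integral p M \<omega> (f i))"
  by (induction I rule: infinite_finite_induct) (auto simp: chain_integral_add)

lemma smooth_chains_iff: "c \<in> smooth_chains k M \<longleftrightarrow> Poly_Mapping.keys c \<subseteq> Collect (smooth_simplex k M)"
  by (simp add: smooth_chain_group_def)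

lemma smooth_chains_0: "0 \<in> smooth_chains k M"
  by (simp add: smooth_chains_iff)

lemma smooth_chains_diff: "a \<in> smooth_chains k M \<Longrightarrow> b \<in> smooth_chains k M \<Longrightarrow> a - b \<in> smooth_chains k M"
  using keys_diff[of a b] by (auto simp: smooth_chains_iff)

lemma smooth_chains_add: "a \<in> smooth_chains k M \<Longrightarrow> b \<in> smooth_chains k M \<Longrightarrow> a + b \<in> smooth_chains k M"
  using keys_add[of a b] by (auto simp: smooth_chains_iff)

lemma smooth_chains_induct [consumes 1, case_names zero simplex diff]:
  assumes "c \<in> smooth_chains k M" "P 0" "\<And>\<sigma>. smooth_simplex k M \<sigma> \<Longrightarrow> P (frag_of \<sigma>)"
    "\<And>a b. P a \<Longrightarrow> P b \<Longrightarrow> P (a - b)"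
  shows "P c"
  by (rule frag_induction[of c "Collect (smooth_simplex k M)"]) (use assms in \<open>auto simp: smooth_chains_iff\<close>)

lemma smooth_chains_map:
  assumes "smooth_manifold M" "smooth_manifold N" "smooth_map M N F" and "c \<in> smooth_chains k M"
  shows "chain_map k F c \<in> smooth_chains k N"
  using assms(4)
proof (induction rule: smooth_chains_induct)
  case (simplex \<sigma>)
  then show ?case using smooth_simplex_simplex_map[OF assms(1-3)] by (simp add: smooth_chains_iff)
qed (auto simp: chain_map_diff smooth_chains_diff smooth_chains_0)

lemma smooth_chains_singular: "c \<in> smooth_chains k M \<Longrightarrow> singular_chain k (mtop M) c"
  by (auto simp: smooth_chains_iff singular_chain_def smooth_simplex_def)

lemma Stokes:
  assumes M: "smooth_manifold M" and \<omega>: "\<omega> \<in> forms q M" and "c \<in> smooth_chains (Suc q) M"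
  shows "chain_integral (Suc q) M (ext_deriv q M \<omega>) c = chain_integral q M \<omega> (chain_boundary (Suc q) c)"
  using assms(3)
proof (induction rule: smooth_chains_induct)
  case (simplex \<sigma>)
  then show ?case
    by (simp add: chain_boundary_of chain_integral_add chain_integral_sum chain_integral_frag_cmul
        Stokes_simplex[OF M simplex \<omega>])
qed (auto simp: chain_boundary_diff chain_integral_diff)

lemma chain_integral_pullback:
  assumes "smooth_manifold M" "smooth_manifold N" "smooth_map M N F" and "c \<in> smooth_chains k M"
  shows "chain_integral k N \<omega> (chain_map k F c) = chain_integral k M (pullback k M N F \<omega>) c"
  using assms(4)
proof (induction rule: smooth_chains_induct)
  case (simplex \<sigma>)
  then show ?case by (simp add: simplex_integral_pullback[OF assms(1-3)])
qed (auto simp: chain_map_diff chain_integral_diff)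

lemma chain_integral_zero_form [simp]: "chain_integral k M zero_form c = 0"
  by (simp add: chain_integral_def simplex_integral_def set_lebesgue_integral_def Let_def)

text \<open>
Stated for a set closed under differences in an additive group, the facts about cosets apply to chains modulo
boundaries and to reals modulo periods alike.
\<close>

lemma additive_coset_eq_iff:
  fixes B :: "'g::ab_group_add set"
  assumes "0 \<in> B" "\<And>a b. a \<in> B \<Longrightarrow> b \<in> B \<Longrightarrow> a - b \<in> B"
  shows "(\<lambda>b. b + x) ` B = (\<lambda>b. b + y) ` B \<longleftrightarrow> x - y \<in> B"
proof
  assume "(\<lambda>b. b + x) ` B = (\<lambda>b. b + y) ` B"
  then have "0 + x \<in> (\<lambda>b. b + y) ` B" using assms(1) by blast
  then show "x - y \<in> B" by (auto simp: algebra_simps)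
next
  assume d: "x - y \<in> B"
  have add: "a + b \<in> B" if "a \<in> B" "b \<in> B" for a b
    using assms(2)[OF that(1) assms(2)[OF assms(1) that(2)]] by simp
  show "(\<lambda>b. b + x) ` B = (\<lambda>b. b + y) ` B"
  proof (intro equalityI image_subsetI)
    fix b assume "b \<in> B"
    then show "b + x \<in> (\<lambda>b. b + y) ` B"
      using add[OF _ d] by (intro image_eqI[of _ _ "b + (x - y)"]) auto
    show "b + y \<in> (\<lambda>b. b + x) ` B"
      using assms(2)[OF \<open>b \<in> B\<close> d] by (intro image_eqI[of _ _ "b - (x - y)"]) auto
  qed
qed

lemma additive_coset_add:
  fixes B :: "'g::ab_group_add set"
  assumes "0 \<in> B" "\<And>a b. a \<in> B \<Longrightarrow> b \<in> B \<Longrightarrow> a - b \<in> B"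
  shows "(\<Union>h\<in>(\<lambda>b. b + x) ` B. \<Union>k\<in>(\<lambda>b. b + y) ` B. {h + k}) = (\<lambda>b. b + (x + y)) ` B"
proof -
  have add: "a + b \<in> B" if "a \<in> B" "b \<in> B" for a b
    using assms(2)[OF that(1) assms(2)[OF assms(1) that(2)]] by simp
  show ?thesis
  proof (intro equalityI subsetI)
    fix z assume "z \<in> (\<Union>h\<in>(\<lambda>b. b + x) ` B. \<Union>k\<in>(\<lambda>b. b + y) ` B. {h + k})"
    then obtain a b where "a \<in> B" "b \<in> B" "z = (a + x) + (b + y)" by auto
    then show "z \<in> (\<lambda>b. b + (x + y)) ` B"
      using add by (intro image_eqI[of _ _ "a + b"]) (auto simp: algebra_simps)
  next
    fix z assume "z \<in> (\<lambda>b. b + (x + y)) ` B"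
    then obtain b where "b \<in> B" "z = (b + x) + (0 + y)" by (auto simp: algebra_simps)
    then show "z \<in> (\<Union>h\<in>(\<lambda>b. b + x) ` B. \<Union>k\<in>(\<lambda>b. b + y) ` B. {h + k})"
      using assms(1) by blast
  qed
qed

lemma smooth_boundaries_0: "0 \<in> smooth_boundaries k M"
  unfolding smooth_boundaries_def using smooth_chains_0[of "Suc k" M] by (intro image_eqI[of _ _ 0]) auto

lemma smooth_boundaries_diff:
  assumes "a \<in> smooth_boundaries k M" "b \<in> smooth_boundaries k M"
  shows "a - b \<in> smooth_boundaries k M"
  using assms unfolding smooth_boundaries_def
  by (auto simp: chain_boundary_diff[symmetric] intro!: smooth_chains_diff)

lemma smooth_cycles_0: "0 \<in> smooth_cycles k M"
  by (simp add: smooth_cycles_def smooth_chain_group_def)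

lemma smooth_cycles_diff: "a \<in> smooth_cycles k M \<Longrightarrow> b \<in> smooth_cycles k M \<Longrightarrow> a - b \<in> smooth_cycles k M"
  by (auto simp: smooth_cycles_def chain_boundary_diff intro: smooth_chains_diff)

lemma smooth_cycles_add: "a \<in> smooth_cycles k M \<Longrightarrow> b \<in> smooth_cycles k M \<Longrightarrow> a + b \<in> smooth_cycles k M"
  by (auto simp: smooth_cycles_def chain_boundary_add intro: smooth_chains_add)

lemma carrier_subgroup_generated_cycles:
  "carrier (subgroup_generated (smooth_chain_group k M) (smooth_cycles k M)) = smooth_cycles k M"
proof -
  interpret group "smooth_chain_group k M" by (simp add: smooth_chain_group_def)
  have "subgroup (smooth_cycles k M) (smooth_chain_group k M)"
  proof (rule subgroupI)
    show "smooth_cycles k M \<noteq> {}" using smooth_cycles_0 by auto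
    fix a assume a: "a \<in> smooth_cycles k M"
    then have "inv\<^bsub>smooth_chain_group k M\<^esub> a = 0 - a"
      by (simp add: smooth_cycles_def smooth_chain_group_def)
    then show "inv\<^bsub>smooth_chain_group k M\<^esub> a \<in> smooth_cycles k M"
      using smooth_cycles_diff[OF smooth_cycles_0 a] by simp
    fix b assume "b \<in> smooth_cycles k M"
    then show "a \<otimes>\<^bsub>smooth_chain_group k M\<^esub> b \<in> smooth_cycles k M"
      using smooth_cycles_add[OF a] by (simp add: smooth_chain_group_def)
  qed (auto simp: smooth_cycles_def)
  then show ?thesis
    by (intro equalityI subgroup_generated_minimal subgroup_generated_subset_carrier_subset subgroup.subset) auto
qed

lemma homology_class_eq_image: "homology_class k M T = (\<lambda>b. b + T) ` smooth_boundaries k M"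
  by (auto simp: homology_class_def r_coset_def smooth_chain_group_def)

lemma homology_class_eq_iff: "homology_class k M T = homology_class k M T' \<longleftrightarrow> T - T' \<in> smooth_boundaries k M"
  unfolding homology_class_eq_image
  by (rule additive_coset_eq_iff[OF smooth_boundaries_0 smooth_boundaries_diff])

lemma carrier_smooth_homology: "carrier (smooth_homology k M) = homology_class k M ` smooth_cycles k M"
  unfolding smooth_homology_def FactGroup_def RCOSETS_def carrier_subgroup_generated_cycles
    homology_class_def r_coset_def by auto

lemma set_mult_smooth_homology: "\<kappa> \<otimes>\<^bsub>smooth_homology k M\<^esub> \<kappa>' = (\<Union>h\<in>\<kappa>. \<Union>k\<in>\<kappa>'. {h + k})"
  by (simp add: smooth_homology_def FactGroup_def set_mult_def smooth_chain_group_def)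

lemma mult_smooth_homology:
  "homology_class k M T \<otimes>\<^bsub>smooth_homology k M\<^esub> homology_class k M T' = homology_class k M (T + T')"
  unfolding set_mult_smooth_homology homology_class_eq_image
  by (rule additive_coset_add[OF smooth_boundaries_0 smooth_boundaries_diff])

lemma one_smooth_homology: "\<one>\<^bsub>smooth_homology k M\<^esub> = homology_class k M 0"
  by (simp add: smooth_homology_def FactGroup_def homology_class_eq_image)

text \<open>
The coset on the left is represented by all \<open>F\<^sub>* (b + T)\<close> with \<open>b\<close> a boundary; since \<open>F\<^sub>*\<close> commutes with
\<open>\<partial>\<close>, these differ from \<open>F\<^sub>* T\<close> by boundaries.
\<close>

lemma homology_map_class:
  assumes M: "smooth_manifold M" and N: "smooth_manifold N" and F: "smooth_map M N F"
  shows "homology_map k N F (homology_class k M T) = homology_class k N (chain_map k F T)"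
proof -
  have map_boundary: "chain_map k F b \<in> smooth_boundaries k N" if b: "b \<in> smooth_boundaries k M" for b
  proof -
    obtain R where R: "R \<in> smooth_chains (Suc k) M" "b = chain_boundary (Suc k) R"
      using b by (auto simp: smooth_boundaries_def)
    have "chain_map k F b = chain_boundary (Suc k) (chain_map (Suc k) F R)"
      using chain_boundary_chain_map[OF smooth_chains_singular[OF R(1)], of F] R(2) by simp
    then show ?thesis
      unfolding smooth_boundaries_def using smooth_chains_map[OF M N F R(1)] by simp
  qed
  let ?B = "smooth_boundaries k N"
  have "homology_map k N F (homology_class k M T) =
     (\<Union>h\<in>?B. \<Union>b\<in>smooth_boundaries k M. {h + (chain_map k F b + chain_map k F T)})"
    by (simp add: homology_map_def set_mult_def homology_class_eq_image smooth_chain_group_def chain_map_add image_image)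
  also have "\<dots> = homology_class k N (chain_map k F T)"
  proof (intro equalityI subsetI)
    fix z assume "z \<in> (\<Union>h\<in>?B. \<Union>b\<in>smooth_boundaries k M. {h + (chain_map k F b + chain_map k F T)})"
    then obtain h b where hb: "h \<in> ?B" "b \<in> smooth_boundaries k M" "z = h + (chain_map k F b + chain_map k F T)" by auto
    have "h - (0 - chain_map k F b) \<in> ?B"
      by (intro smooth_boundaries_diff hb(1) smooth_boundaries_0 map_boundary hb(2))
    then show "z \<in> homology_class k N (chain_map k F T)"
      unfolding homology_class_eq_image hb(3) by (intro image_eqI[of _ _ "h - (0 - chain_map k F b)"]) (auto simp: algebra_simps)
  next
    fix z assume "z \<in> homology_class k N (chain_map k F T)"
    then obtain h where h: "h \<in> ?B" "z = h + chain_map k F T" by (auto simp: homology_class_eq_image)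
    then show "z \<in> (\<Union>h\<in>?B. \<Union>b\<in>smooth_boundaries k M. {h + (chain_map k F b + chain_map k F T)})"
      using smooth_boundaries_0[of k M] by (intro UN_I[of h] UN_I[of 0]) auto
  qed
  finally show ?thesis .
qed

lemma homology_class_in_kernel_iff:
  assumes "smooth_manifold M" "smooth_manifold N" "smooth_map M N F" and T: "T \<in> smooth_cycles k M"
  shows "homology_class k M T \<in> homology_kernel k M N F \<longleftrightarrow>
    (\<exists>S\<in>smooth_chains (Suc k) N. chain_boundary (Suc k) S = chain_map k F T)"
proof -
  have "homology_class k M T \<in> homology_kernel k M N F \<longleftrightarrow> chain_map k F T - 0 \<in> smooth_boundaries k N"
    unfolding homology_kernel_def kernel_def
    using imageI[OF T, of "homology_class k M"]
    by (simp add: carrier_smooth_homology one_smooth_homology homology_map_class[OF assms(1-3)] homology_class_eq_iff)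
  then show ?thesis unfolding smooth_boundaries_def image_iff Bex_def by (simp add: eq_commute)
qed

lemma homology_kernelE:
  assumes "smooth_manifold M" "smooth_manifold N" "smooth_map M N F" and "\<kappa> \<in> homology_kernel k M N F"
  obtains S T where "T \<in> smooth_cycles k M" "homology_class k M T = \<kappa>"
    "S \<in> smooth_chains (Suc k) N" "chain_boundary (Suc k) S = chain_map k F T"
proof -
  have "\<kappa> \<in> homology_class k M ` smooth_cycles k M"
    using assms(4) by (simp add: homology_kernel_def kernel_def carrier_smooth_homology)
  then obtain T where T: "T \<in> smooth_cycles k M" "\<kappa> = homology_class k M T" by auto
  with assms(4) homology_class_in_kernel_iff[OF assms(1-3) T(1)] that show ?thesis by auto
qed

section \<open>The homomorphism on the kernel\<close>

lemma real_coset: "P #>\<^bsub>real_group\<^esub> r = (\<lambda>p. p + r) ` P"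
  by (auto simp: r_coset_def real_group_def)

lemma periods_0: "0 \<in> periods k M \<omega>"
  unfolding periods_def using smooth_cycles_0 by force

lemma periods_diff:
  assumes "a \<in> periods k M \<omega>" "b \<in> periods k M \<omega>"
  shows "a - b \<in> periods k M \<omega>"
proof -
  obtain S S' where "S \<in> smooth_cycles k M" "a = chain_integral k M \<omega> S" "S' \<in> smooth_cycles k M" "b = chain_integral k M \<omega> S'"
    using assms by (auto simp: periods_def)
  then show ?thesis
    unfolding periods_def using smooth_cycles_diff chain_integral_diff by (metis (mono_tags, lifting) mem_Collect_eq)
qed

lemma periods_coset_eq_iff: "periods k M \<omega> #>\<^bsub>real_group\<^esub> r = periods k M \<omega> #>\<^bsub>real_group\<^esub> s \<longleftrightarrow> r - s \<in> periods k M \<omega>"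
  unfolding real_coset by (rule additive_coset_eq_iff[OF periods_0 periods_diff])

lemma group_real_group: "group real_group"
proof (rule groupI)
  fix x :: real
  show "\<exists>y\<in>carrier real_group. y \<otimes>\<^bsub>real_group\<^esub> x = \<one>\<^bsub>real_group\<^esub>"
    by (intro bexI[of _ "- x"]) (auto simp: real_group_def)
qed (auto simp: real_group_def)

lemma subgroup_periods: "subgroup (periods k M \<omega>) real_group"
proof -
  interpret group real_group by (rule group_real_group)
  show ?thesis
  proof (rule subgroupI)
    show "periods k M \<omega> \<noteq> {}" using periods_0 by auto
    fix a assume a: "a \<in> periods k M \<omega>"
    have "inv\<^bsub>real_group\<^esub> a = 0 - a"
      by (rule inv_equality) (auto simp: real_group_def)
    then show "inv\<^bsub>real_group\<^esub> a \<in> periods k M \<omega>" using periods_diff[OF periods_0 a] by simp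
    fix b assume b: "b \<in> periods k M \<omega>"
    then show "a \<otimes>\<^bsub>real_group\<^esub> b \<in> periods k M \<omega>"
      using periods_diff[OF a periods_diff[OF periods_0 b]] by (simp add: real_group_def)
  qed (auto simp: real_group_def)
qed

lemma mult_real_cosets:
  "(periods k M \<omega> #>\<^bsub>real_group\<^esub> r) \<otimes>\<^bsub>real_group Mod periods k M \<omega>\<^esub> (periods k M \<omega> #>\<^bsub>real_group\<^esub> s)
     = periods k M \<omega> #>\<^bsub>real_group\<^esub> (r + s)"
proof -
  have "C \<otimes>\<^bsub>real_group Mod P\<^esub> C' = (\<Union>h\<in>C. \<Union>k\<in>C'. {h + k})" for C C' P
    by (simp add: FactGroup_def set_mult_def real_group_def)
  then show ?thesis
    unfolding real_coset by (simp only: additive_coset_add[OF periods_0 periods_diff])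
qed

lemma periods_eq_0_if_trivial_homology:
  assumes M: "smooth_manifold M" and \<omega>: "\<omega> \<in> forms k M" "ext_deriv k M \<omega> = zero_form"
    and triv: "trivial_group (smooth_homology k M)"
  shows "periods k M \<omega> = {0}"
proof -
  have "chain_integral k M \<omega> S = 0" if S: "S \<in> smooth_cycles k M" for S
  proof -
    have "homology_class k M S = homology_class k M 0"
      using triv S one_smooth_homology[of k M] by (auto simp: trivial_group_def carrier_smooth_homology)
    then obtain R where R: "R \<in> smooth_chains (Suc k) M" "S = chain_boundary (Suc k) R"
      by (auto simp: homology_class_eq_iff smooth_boundaries_def)
    then show ?thesis using Stokes[OF M \<omega>(1) R(1)] \<omega>(2) by simp
  qed
  then have "periods k M \<omega> \<subseteq> {0}" by (auto simp: periods_def)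
  then show ?thesis using periods_0[of k M \<omega>] by blast
qed

text \<open>
With \<open>T - T' = \<partial>R\<close>, the chain \<open>S - S' - F\<^sub>* R\<close> is a cycle, and its \<open>\<omega>\<close>-integral is the difference in
question by naturality and Stokes' theorem for \<open>\<eta>\<close> on \<open>R\<close>.
\<close>

lemma relative_period_indep:
  assumes M: "smooth_manifold M" and N: "smooth_manifold N" and F: "smooth_map M N F"
    and \<eta>: "\<eta> \<in> forms n M" and pull: "pullback (Suc n) M N F \<omega> = ext_deriv n M \<eta>"
    and hom: "T - T' \<in> smooth_boundaries n M"
    and S: "S \<in> smooth_chains (Suc n) N" "chain_boundary (Suc n) S = chain_map n F T"
    and S': "S' \<in> smooth_chains (Suc n) N" "chain_boundary (Suc n) S' = chain_map n F T'"
  shows "(chain_integral (Suc n) N \<omega> S - chain_integral n M \<eta> T) - (chain_integral (Suc n) N \<omega> S' - chain_integral n M \<eta> T')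
     \<in> periods (Suc n) N \<omega>"
proof -
  obtain R where R: "R \<in> smooth_chains (Suc n) M" "T - T' = chain_boundary (Suc n) R"
    using hom by (auto simp: smooth_boundaries_def)
  let ?C = "S - S' - chain_map (Suc n) F R"
  have "chain_boundary (Suc n) (chain_map (Suc n) F R) = chain_map n F T - chain_map n F T'"
    using chain_boundary_chain_map[OF smooth_chains_singular[OF R(1)], of F] R(2)
    by (simp add: chain_map_diff[symmetric])
  then have "?C \<in> smooth_cycles (Suc n) N"
    using S S' smooth_chains_map[OF M N F R(1)]
    by (auto simp: smooth_cycles_def chain_boundary_diff intro!: smooth_chains_diff)
  moreover have "chain_integral (Suc n) N \<omega> (chain_map (Suc n) F R) = chain_integral n M \<eta> T - chain_integral n M \<eta> T'"
    using chain_integral_pullback[OF M N F R(1), of \<omega>] Stokes[OF M \<eta> R(1)] pull R(2)[symmetric]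
    by (simp add: chain_integral_diff)
  then have "chain_integral (Suc n) N \<omega> ?C =
     (chain_integral (Suc n) N \<omega> S - chain_integral n M \<eta> T) - (chain_integral (Suc n) N \<omega> S' - chain_integral n M \<eta> T')"
    by (simp add: chain_integral_diff)
  ultimately show ?thesis unfolding periods_def by (metis (mono_tags, lifting) mem_Collect_eq)
qed

lemma Theta_eq:
  assumes M: "smooth_manifold M" and N: "smooth_manifold N" and F: "smooth_map M N F"
    and \<eta>: "\<eta> \<in> forms n M" and pull: "pullback (Suc n) M N F \<omega> = ext_deriv n M \<eta>"
    and T: "T \<in> smooth_cycles n M"
    and S: "S \<in> smooth_chains (Suc n) N" "chain_boundary (Suc n) S = chain_map n F T"
  shows "Theta n M N F \<omega> \<eta> (homology_class n M T) =
     periods (Suc n) N \<omega> #>\<^bsub>real_group\<^esub> (chain_integral (Suc n) N \<omega> S - chain_integral n M \<eta> T)"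
proof -
  let ?P = "\<lambda>(S', T'). T' \<in> smooth_cycles n M \<and> homology_class n M T' = homology_class n M T \<and>
            S' \<in> smooth_chains (Suc n) N \<and> chain_boundary (Suc n) S' = chain_map n F T'"
  have "?P (S, T)" using T S by simp
  then have P: "?P (Eps ?P)" by (rule someI)
  obtain S' T' where ST': "Eps ?P = (S', T')" by (cases "Eps ?P")
  have hom: "T' - T \<in> smooth_boundaries n M"
    and S': "S' \<in> smooth_chains (Suc n) N" "chain_boundary (Suc n) S' = chain_map n F T'"
    using P unfolding ST' by (auto simp: homology_class_eq_iff)
  have "Theta n M N F \<omega> \<eta> (homology_class n M T) =
     periods (Suc n) N \<omega> #>\<^bsub>real_group\<^esub> (chain_integral (Suc n) N \<omega> S' - chain_integral n M \<eta> T')"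
    unfolding Theta_def ST' by simp
  also have "\<dots> = periods (Suc n) N \<omega> #>\<^bsub>real_group\<^esub> (chain_integral (Suc n) N \<omega> S - chain_integral n M \<eta> T)"
    unfolding periods_coset_eq_iff by (rule relative_period_indep[OF M N F \<eta> pull hom S' S])
  finally show ?thesis .
qed

theorem theorem3p8:
  fixes M :: "('a, 'e::real_inner) manifold"
    and N :: "('b, 'f::real_inner) manifold"
    and F :: "'a \<Rightarrow> 'b"
    and n :: nat
    and \<omega> :: "('b, 'f) form"
    and \<eta> :: "('a, 'e) form"
  assumes "n \<ge> 1"
    and "smooth_manifold M" and "smooth_manifold N"
    and "smooth_map M N F"
    and "rel_closed (n + 1) M N F (\<omega>, \<eta>)"
  shows
    "let K = homology_kernel n M N F;
         Pw = periods (n + 1) N \<omega>;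
         Prel = rel_periods (n + 1) M N F (\<omega>, \<eta>);
         \<Theta> = Theta n M N F \<omega> \<eta>;
         integral_rel = rel_integral (n + 1) M N F (\<omega>, \<eta>)
     in
       \<comment> \<open>\<open>\<Theta>\<close> is a well-defined homomorphism\<close>
       subgroup Pw real_group \<and>
       (\<forall>\<kappa>\<in>K. \<exists>T\<in>smooth_cycles n M. homology_class n M T = \<kappa>) \<and>
       (\<forall>T\<in>smooth_cycles n M. homology_class n M T \<in> K \<longrightarrow>
          (\<exists>S\<in>smooth_chains (n + 1) N. chain_boundary (n + 1) S = chain_map n F T)) \<and>
       (\<forall>T\<in>smooth_cycles n M. homology_class n M T \<in> K \<longrightarrow>
          (\<forall>S\<in>smooth_chains (n + 1) N. chain_boundary (n + 1) S = chain_map n F T \<longrightarrow>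
             \<Theta> (homology_class n M T) =
               Pw #>\<^bsub>real_group\<^esub> (chain_integral (n + 1) N \<omega> S - chain_integral n M \<eta> T))) \<and>
       \<Theta> \<in> hom ((smooth_homology n M)\<lparr>carrier := K\<rparr>) (real_group Mod Pw) \<and>
       \<comment> \<open>(i)\<close>
       (Pw \<subseteq> Prel \<and> Prel = {r. Pw #>\<^bsub>real_group\<^esub> r \<in> \<Theta> ` K}) \<and>
       \<comment> \<open>(ii)\<close>
       (integral_rel \<longleftrightarrow>
          Pw \<subseteq> \<int> \<and> \<Theta> ` K \<subseteq> carrier (real_group\<lparr>carrier := \<int>\<rparr> Mod Pw)) \<and>
       \<comment> \<open>(iii)\<close>
       (inj_on (homology_map n N F) (carrier (smooth_homology n M)) \<longrightarrow>
          Prel = Pw \<and> (integral_rel \<longleftrightarrow> Pw \<subseteq> \<int>)) \<and>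
       \<comment> \<open>(iv)\<close>
       (trivial_group (smooth_homology (n + 1) N) \<longrightarrow>
          Pw = {0} \<and>
          (\<exists>\<theta> \<in> hom ((smooth_homology n M)\<lparr>carrier := K\<rparr>) real_group.
             (\<forall>\<kappa>\<in>K. \<Theta> \<kappa> = {\<theta> \<kappa>}) \<and>
             (integral_rel \<longleftrightarrow> \<theta> ` K \<subseteq> \<int>)))"
proof -
  note M = assms(2) and N = assms(3) and F = assms(4)
  define K where "K = homology_kernel n M N F"
  define Pw where "Pw = periods (Suc n) N \<omega>"
  define Prel where "Prel = rel_periods (Suc n) M N F (\<omega>, \<eta>)"
  define \<Theta> where "\<Theta> = Theta n M N F \<omega> \<eta>"
  let ?val = "\<lambda>S T. chain_integral (Suc n) N \<omega> S - chain_integral n M \<eta> T"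
  have \<omega>: "\<omega> \<in> forms (Suc n) N" and \<eta>: "\<eta> \<in> forms n M"
    and d\<omega>: "ext_deriv (Suc n) N \<omega> = zero_form" and pull: "pullback (Suc n) M N F \<omega> = ext_deriv n M \<eta>"
    using assms(5) by (auto simp: rel_closed_def rel_forms_def rel_deriv_def fun_eq_iff)
  note coset_iff = periods_coset_eq_iff[of "Suc n" N \<omega>, folded Pw_def]
  have kernel: "homology_class n M T \<in> K \<longleftrightarrow> (\<exists>S\<in>smooth_chains (Suc n) N. chain_boundary (Suc n) S = chain_map n F T)"
    if "T \<in> smooth_cycles n M" for T
    unfolding K_def by (rule homology_class_in_kernel_iff[OF M N F that])
  have \<Theta>: "\<Theta> (homology_class n M T) = Pw #>\<^bsub>real_group\<^esub> ?val S T"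
    if "T \<in> smooth_cycles n M" "S \<in> smooth_chains (Suc n) N" "chain_boundary (Suc n) S = chain_map n F T" for S T
    unfolding \<Theta>_def Pw_def by (rule Theta_eq[OF M N F \<eta> pull that])
  have Prel_iff: "r \<in> Prel \<longleftrightarrow> (\<exists>S T. T \<in> smooth_cycles n M \<and> S \<in> smooth_chains (Suc n) N \<and>
      chain_boundary (Suc n) S = chain_map n F T \<and> r = ?val S T)" for r
    by (auto simp: Prel_def rel_periods_def rel_cycles_def rel_chains_def rel_boundary_def rel_pairing_def smooth_cycles_def)
  have Pw_Prel: "Pw \<subseteq> Prel"
  proof
    fix r assume "r \<in> Pw"
    then obtain S where "S \<in> smooth_cycles (Suc n) N" "r = chain_integral (Suc n) N \<omega> S"
      by (auto simp: Pw_def periods_def)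
    then show "r \<in> Prel"
      unfolding Prel_iff using smooth_cycles_0 by (intro exI[of _ S] exI[of _ 0]) (simp add: smooth_cycles_def)
  qed
  have K_cases: "\<exists>S T. T \<in> smooth_cycles n M \<and> homology_class n M T = \<kappa> \<and> S \<in> smooth_chains (Suc n) N \<and>
      chain_boundary (Suc n) S = chain_map n F T" if "\<kappa> \<in> K" for \<kappa>
    using homology_kernelE[OF M N F that[unfolded K_def]] by metis
  have hom: "\<Theta> \<in> hom ((smooth_homology n M)\<lparr>carrier := K\<rparr>) (real_group Mod Pw)"
  proof (rule homI)
    fix \<kappa> assume "\<kappa> \<in> carrier ((smooth_homology n M)\<lparr>carrier := K\<rparr>)"
    then obtain S T where "T \<in> smooth_cycles n M" "homology_class n M T = \<kappa>" "S \<in> smooth_chains (Suc n) N"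
      "chain_boundary (Suc n) S = chain_map n F T" using K_cases[of \<kappa>] by auto
    then have "\<Theta> \<kappa> = Pw #>\<^bsub>real_group\<^esub> ?val S T" using \<Theta> by auto
    then show "\<Theta> \<kappa> \<in> carrier (real_group Mod Pw)"
      by (auto simp: FactGroup_def RCOSETS_def real_group_def)
  next
    fix \<kappa> \<kappa>' assume "\<kappa> \<in> carrier ((smooth_homology n M)\<lparr>carrier := K\<rparr>)" "\<kappa>' \<in> carrier ((smooth_homology n M)\<lparr>carrier := K\<rparr>)"
    then obtain S T S' T' where 1: "T \<in> smooth_cycles n M" "homology_class n M T = \<kappa>" "S \<in> smooth_chains (Suc n) N"
      "chain_boundary (Suc n) S = chain_map n F T"
      and 2: "T' \<in> smooth_cycles n M" "homology_class n M T' = \<kappa>'" "S' \<in> smooth_chains (Suc n) N"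
      "chain_boundary (Suc n) S' = chain_map n F T'" using K_cases[of \<kappa>] K_cases[of \<kappa>'] by auto
    have "\<Theta> (\<kappa> \<otimes>\<^bsub>smooth_homology n M\<^esub> \<kappa>') = \<Theta> (homology_class n M (T + T'))"
      using 1(2) 2(2) mult_smooth_homology by metis
    also have "\<dots> = Pw #>\<^bsub>real_group\<^esub> ?val (S + S') (T + T')"
      by (rule \<Theta>) (use 1 2 in \<open>simp_all add: smooth_cycles_add smooth_chains_add chain_boundary_add chain_map_add\<close>)
    also have "?val (S + S') (T + T') = ?val S T + ?val S' T'" by (simp add: chain_integral_add)
    also have "Pw #>\<^bsub>real_group\<^esub> (?val S T + ?val S' T') = \<Theta> \<kappa> \<otimes>\<^bsub>real_group Mod Pw\<^esub> \<Theta> \<kappa>'"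
      using \<Theta>[OF 1(1,3,4)] \<Theta>[OF 2(1,3,4)] 1(2) 2(2) mult_real_cosets[of "Suc n" N \<omega>] by (simp add: Pw_def)
    finally show "\<Theta> (\<kappa> \<otimes>\<^bsub>(smooth_homology n M)\<lparr>carrier := K\<rparr>\<^esub> \<kappa>') = \<Theta> \<kappa> \<otimes>\<^bsub>real_group Mod Pw\<^esub> \<Theta> \<kappa>'" by simp
  qed
  have Prel_eq: "Prel = {r. Pw #>\<^bsub>real_group\<^esub> r \<in> \<Theta> ` K}"
  proof (intro equalityI subsetI CollectI)
    fix r assume "r \<in> Prel"
    then obtain S T where ST: "T \<in> smooth_cycles n M" "S \<in> smooth_chains (Suc n) N"
      "chain_boundary (Suc n) S = chain_map n F T" "r = ?val S T" unfolding Prel_iff by auto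
    then have "homology_class n M T \<in> K" using kernel by auto
    then show "Pw #>\<^bsub>real_group\<^esub> r \<in> \<Theta> ` K"
      using \<Theta>[OF ST(1-3)] ST(4) by (intro image_eqI[of _ _ "homology_class n M T"]) auto
  next
    fix r assume "r \<in> {r. Pw #>\<^bsub>real_group\<^esub> r \<in> \<Theta> ` K}"
    then obtain \<kappa> where \<kappa>: "\<kappa> \<in> K" "Pw #>\<^bsub>real_group\<^esub> r = \<Theta> \<kappa>" by auto
    then obtain S T where ST: "T \<in> smooth_cycles n M" "homology_class n M T = \<kappa>" "S \<in> smooth_chains (Suc n) N"
      "chain_boundary (Suc n) S = chain_map n F T" using K_cases[of \<kappa>] by auto
    then have "r - ?val S T \<in> Pw" using \<kappa>(2) \<Theta>[OF ST(1,3,4)] coset_iff by auto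
    then obtain Z where Z: "Z \<in> smooth_cycles (Suc n) N" "r - ?val S T = chain_integral (Suc n) N \<omega> Z"
      by (auto simp: Pw_def periods_def)
    then have "S + Z \<in> smooth_chains (Suc n) N" "chain_boundary (Suc n) (S + Z) = chain_map n F T"
      "r = ?val (S + Z) T"
      using ST by (auto simp: smooth_cycles_def chain_boundary_add chain_integral_add intro!: smooth_chains_add)
    \<comment> \<open>adding the cycle \<open>Z\<close> to \<open>S\<close> absorbs the period by which \<open>r\<close> differs from the value at \<open>(S, T)\<close>\<close>
    with ST(1) show "r \<in> Prel" unfolding Prel_iff by (intro exI conjI)
  qed
  have integral: "Prel \<subseteq> \<int> \<longleftrightarrow> Pw \<subseteq> \<int> \<and> \<Theta> ` K \<subseteq> carrier (real_group\<lparr>carrier := \<int>\<rparr> Mod Pw)"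
  proof -
    have "carrier (real_group\<lparr>carrier := \<int>\<rparr> Mod Pw) = (\<lambda>z. Pw #>\<^bsub>real_group\<^esub> z) ` \<int>"
      by (auto simp: FactGroup_def RCOSETS_def r_coset_def)
    moreover have "\<Theta> ` K \<subseteq> (\<lambda>z. Pw #>\<^bsub>real_group\<^esub> z) ` \<int>" if "Prel \<subseteq> \<int>"
    proof
      fix C assume "C \<in> \<Theta> ` K"
      then obtain S T where ST: "T \<in> smooth_cycles n M" "C = \<Theta> (homology_class n M T)" "S \<in> smooth_chains (Suc n) N"
      "chain_boundary (Suc n) S = chain_map n F T" using K_cases by blast
      then have "?val S T \<in> Prel" unfolding Prel_iff by blast
      with that ST \<Theta>[OF ST(1,3,4)] show "C \<in> (\<lambda>z. Pw #>\<^bsub>real_group\<^esub> z) ` \<int>" by blast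
    qed
    moreover have "Prel \<subseteq> \<int>" if Pw: "Pw \<subseteq> \<int>" and im: "\<Theta> ` K \<subseteq> (\<lambda>z. Pw #>\<^bsub>real_group\<^esub> z) ` \<int>"
    proof
      fix r assume "r \<in> Prel"
      then have "Pw #>\<^bsub>real_group\<^esub> r \<in> \<Theta> ` K" unfolding Prel_eq by simp
      then obtain z where "z \<in> \<int>" "Pw #>\<^bsub>real_group\<^esub> r = Pw #>\<^bsub>real_group\<^esub> z" using im by blast
      then have "(r - z) + z \<in> \<int>" using Pw coset_iff Ints_add by blast
      then show "r \<in> \<int>" by simp
    qed
    ultimately show ?thesis using Pw_Prel by auto
  qed
  have injective: "Prel = Pw" if inj: "inj_on (homology_map n N F) (carrier (smooth_homology n M))"
  proof -
    have "\<kappa> = homology_class n M 0" if "\<kappa> \<in> K" for \<kappa>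
    proof (rule inj_onD[OF inj])
      show "homology_map n N F \<kappa> = homology_map n N F (homology_class n M 0)"
        using that by (simp add: K_def homology_kernel_def kernel_def homology_map_class[OF M N F] one_smooth_homology)
      show "\<kappa> \<in> carrier (smooth_homology n M)" using that by (simp add: K_def homology_kernel_def kernel_def)
      show "homology_class n M 0 \<in> carrier (smooth_homology n M)"
        unfolding carrier_smooth_homology by (rule imageI[OF smooth_cycles_0])
    qed
    moreover have "\<Theta> (homology_class n M 0) = Pw #>\<^bsub>real_group\<^esub> 0"
      using \<Theta>[OF smooth_cycles_0 smooth_chains_0] by simp
    ultimately have "Prel \<subseteq> Pw"
      unfolding Prel_eq using coset_iff[of _ 0] by auto
    with Pw_Prel show ?thesis by simp
  qed
  have trivial: "Pw = {0} \<and> (\<exists>\<theta> \<in> hom ((smooth_homology n M)\<lparr>carrier := K\<rparr>) real_group.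
             (\<forall>\<kappa>\<in>K. \<Theta> \<kappa> = {\<theta> \<kappa>}) \<and> (Prel \<subseteq> \<int> \<longleftrightarrow> \<theta> ` K \<subseteq> \<int>))"
    if "trivial_group (smooth_homology (Suc n) N)"
  proof -
    have Pw0: "Pw = {0}"
      unfolding Pw_def by (rule periods_eq_0_if_trivial_homology[OF N \<omega> d\<omega> that])
    have coset0: "Pw #>\<^bsub>real_group\<^esub> r = {r}" for r by (simp add: Pw0 real_coset)
    define \<theta> where "\<theta> = (\<lambda>\<kappa>. the_elem (\<Theta> \<kappa>))"
    have \<theta>: "\<Theta> \<kappa> = {\<theta> \<kappa>}" if \<kappa>: "\<kappa> \<in> K" for \<kappa>
    proof -
      obtain S T where "T \<in> smooth_cycles n M" "homology_class n M T = \<kappa>" "S \<in> smooth_chains (Suc n) N"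
        "chain_boundary (Suc n) S = chain_map n F T" using K_cases[OF \<kappa>] by auto
      then have "\<Theta> \<kappa> = {?val S T}" using \<Theta> coset0 by auto
      then show ?thesis by (simp add: \<theta>_def)
    qed
    have "\<theta> \<in> hom ((smooth_homology n M)\<lparr>carrier := K\<rparr>) real_group"
    proof (rule homI)
      fix \<kappa> \<kappa>' assume "\<kappa> \<in> carrier ((smooth_homology n M)\<lparr>carrier := K\<rparr>)" "\<kappa>' \<in> carrier ((smooth_homology n M)\<lparr>carrier := K\<rparr>)"
      then have k: "\<kappa> \<in> K" "\<kappa>' \<in> K" by auto
      have "\<Theta> (\<kappa> \<otimes>\<^bsub>smooth_homology n M\<^esub> \<kappa>') = \<Theta> \<kappa> \<otimes>\<^bsub>real_group Mod Pw\<^esub> \<Theta> \<kappa>'"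
        using hom_mult[OF hom, of \<kappa> \<kappa>'] k by simp
      also have "\<dots> = {\<theta> \<kappa> + \<theta> \<kappa>'}"
        using mult_real_cosets[of "Suc n" N \<omega> "\<theta> \<kappa>" "\<theta> \<kappa>'"] \<theta>[OF k(1)] \<theta>[OF k(2)]
        by (simp add: Pw_def[symmetric] coset0)
      finally show "\<theta> (\<kappa> \<otimes>\<^bsub>(smooth_homology n M)\<lparr>carrier := K\<rparr>\<^esub> \<kappa>') = \<theta> \<kappa> \<otimes>\<^bsub>real_group\<^esub> \<theta> \<kappa>'"
        by (simp add: \<theta>_def real_group_def)
    qed (simp add: real_group_def)
    moreover have "Prel = \<theta> ` K"
      unfolding Prel_eq coset0 using \<theta> by auto
    ultimately show ?thesis
      by (intro conjI bexI[of _ \<theta>] ballI) (simp_all add: Pw0 \<theta>)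
  qed
  have surj: "\<forall>\<kappa>\<in>K. \<exists>T\<in>smooth_cycles n M. homology_class n M T = \<kappa>" using K_cases by blast
  show ?thesis
    unfolding Let_def rel_integral_def Suc_eq_plus1[symmetric]
      K_def[symmetric] Pw_def[symmetric] Prel_def[symmetric] \<Theta>_def[symmetric]
  proof (intro conjI)
    show "subgroup Pw real_group" unfolding Pw_def by (rule subgroup_periods)
    show "\<forall>T\<in>smooth_cycles n M. homology_class n M T \<in> K \<longrightarrow>
        (\<exists>S\<in>smooth_chains (Suc n) N. chain_boundary (Suc n) S = chain_map n F T)"
      using kernel by blast
    show "\<forall>T\<in>smooth_cycles n M. homology_class n M T \<in> K \<longrightarrow>
        (\<forall>S\<in>smooth_chains (Suc n) N. chain_boundary (Suc n) S = chain_map n F T \<longrightarrow>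
          \<Theta> (homology_class n M T) = Pw #>\<^bsub>real_group\<^esub> ?val S T)"
      using \<Theta> by blast
    show "inj_on (homology_map n N F) (carrier (smooth_homology n M)) \<longrightarrow>
        Prel = Pw \<and> (Prel \<subseteq> \<int> \<longleftrightarrow> Pw \<subseteq> \<int>)"
      by (intro impI conjI) (simp_all only: injective)
    show "trivial_group (smooth_homology (Suc n) N) \<longrightarrow> Pw = {0} \<and>
        (\<exists>\<theta> \<in> hom ((smooth_homology n M)\<lparr>carrier := K\<rparr>) real_group.
           (\<forall>\<kappa>\<in>K. \<Theta> \<kappa> = {\<theta> \<kappa>}) \<and> (Prel \<subseteq> \<int> \<longleftrightarrow> \<theta> ` K \<subseteq> \<int>))"
      by (intro impI trivial)
  qed (rule surj hom Pw_Prel Prel_eq integral)+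
qed

end
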